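(* Assume $RP([\omega_2]^\omega)$ holds. Whenever $\vec I$ is a tower of ideals which concentrates on the class $GIC_{\omega_1}$ of $\omega_1$-guessing, internally club sets, then $\vec I$ is not presaturated.
   Context: The base theory is ZFC. $[X]^\omega$ is the set of countable subsets of $X$; a club in $[X]^\omega$ is a $\subseteq$-cofinal subset closed under unions of countable increasing chains, and stationary means meeting every club. $RP([\omega_2]^\omega)$: for every stationary $S\subseteq[\omega_2]^\omega$ there is $X\subseteq\omega_2$ with $\omega_1\subseteq X$, $|X|=\omega_1$ and $S\cap[X]^\omega$ stationary in $[X]^\omega$. $GIC_{\omega_1}$. $ZF^-$ is ZF without Power Set. A transitive $ZF^-$ model $H$ with $\omega_1\in H$ has the $\omega_1$-approximation property iff for every $\eta\in H$ and $A\subseteq\eta$: if $z\cap A\in H$ for every $z\in H$ which is countable in $H$, then $A\in H$. A set $M$ with $\omega_1\subset M\prec H_\theta$ for some regular uncountable $\theta$ is $\omega_1$-guessing iff its transitive collapse has the $\omega_1$-approximation property. $G_{\omega_1}$ is the class of $\omega_1$-guessing $M$ with $|M|=\omega_1\subset M$. $IC_{\omega_1}$ (internally club sets) is the class of $M$ with $(M,\in)\models ZF^-$, $\omega_1\subseteq M$, $|M|=\omega_1$, such that $M\cap[M]^\omega$ contains a club in $[M]^\omega$. $GIC_{\omega_1}=G_{\omega_1}\cap IC_{\omega_1}$. Ideals. For a set $Z$, an ideal $I\subset\wp(Z)$ is always proper, countably complete, fine (for every $b\in\bigcup Z$, $\{M\in Z: b\notin M\}\in I$) and normal (if $S\notin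 I$ and $g$ is a function on $S$ with $g(M)\in M$ for all $M\in S$, then $g$ is constant on some $S'\subseteq S$ with $S'\notin I$). $I^+=\wp(Z)\setminus I$. $I$ concentrates on a class $\Gamma$ iff some $A\subseteq\Gamma$ belongs to the dual filter of $I$. If $I\subset\wp(Z)$, $I'\subset\wp(Z')$ and $\bigcup Z\subseteq\bigcup Z'$, then $I$ is the canonical projection of $I'$ to $Z$ iff $I=\{A\subseteq Z:\{M'\in Z': M'\cap\bigcup Z\in A\}\in I'\}$. Towers. A tower of ideals of height $\delta$ is a sequence $\vec I=\langle I_\lambda : \lambda\in U\rangle$, where the index set $U$ is an unbounded subset of $\delta$, each $I_\lambda$ is an ideal on $Z_\lambda=\wp_\kappa(H_\lambda)$ (the set of subsets of $H_\lambda$ of size $<\kappa$) for a fixed regular $\kappa\le\lambda$, all $I_\lambda$ have the same completeness, and for $\lambda\le\lambda'$ in $U$, $I_\lambda$ is the canonical projection of $I_{\lambda'}$ to $Z_\lambda$. $\vec I$ concentrates on $\Gamma$ iff every $I_\lambda$ does. $\mathbb P_{\vec I}$ is the poset of pairs $(\lambda,S)$ with $\lambda\in U$ and $S\in I_\lambda^+$, ordered by $(\lambda',S')\le(\lambda,S)$ iff $\lambda'\ge\lambda$ and $S'\subseteq\{M'\in Z_{\lambda'}: M'\cap H_\lambda\in S\}$. A tower $\vec I$ of height $\delta$ is presaturated iff $\delta$ always remains a regular cardinal in generic extensions of $V$ by $\mathbb P_{\vec I}$. *)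

theory Defs
  imports Main "HOL-Library.Countable_Set" "HOL-Library.Equipollence"
begin

text \<open>
  The instances of the following class are, up to isomorphism, the structures
  \<open>(H\<^sub>\<mu>, \<in>)\<close> for the uncountable strong limit cardinals \<open>\<mu>\<close>: Separation is
  second-order, Choice comes from HOL, and Replacement enters through its consequences
  \<open>transitive_containment\<close> and \<open>mostowski\<close>. ZFC proves that every set lies in some such
  \<open>H\<^sub>\<mu>\<close>, and all the notions defined below have the same meaning there as in \<open>V\<close> once
  \<open>\<mu>\<close> is large enough for the sets under consideration. Hence a claim about all sets of all
  these universes is the claim about all sets of \<open>V\<close>. Requiring second-order Replacement
  instead would leave only the \<open>H\<^sub>\<mu>\<close> with \<open>\<mu>\<close> inaccessible.
\<close>

class set_universe =
  fixes elts :: "'a \<Rightarrow> 'a set"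
  assumes extensionality: "elts x = elts y \<Longrightarrow> x = y"
    and foundation: "wf {(x, y). x \<in> elts y}"
    and separation: "A \<subseteq> elts x \<Longrightarrow> \<exists>y. elts y = A"
    and pairing: "\<exists>z. elts z = {x, y}"
    and union: "\<exists>y. elts y = \<Union> (elts ` elts x)"
    and power_set: "\<exists>y. elts y = {z. elts z \<subseteq> elts x}"
    and infinity: "\<exists>x. infinite (elts x)"
    and transitive_containment: "\<exists>y. x \<in> elts y \<and> (\<forall>z \<in> elts y. elts z \<subseteq> elts y)"
    and mostowski: "wf R \<Longrightarrow>
      \<exists>f y. elts y = f ` elts x \<and>
            (\<forall>u \<in> elts x. elts (f u) = f ` {v \<in> elts x. (v, u) \<in> R})"

text \<open>
  Subcollections of the universe are HOL sets. Those that are sets of the universe are converted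
  by \<open>set_of\<close>, whose value is meaningless elsewhere.
\<close>

definition set_of :: "'v::set_universe set \<Rightarrow> 'v" where
  "set_of A = (THE x. elts x = A)"

definition vpair :: "'v::set_universe \<Rightarrow> 'v \<Rightarrow> 'v" where
  "vpair x y = set_of {set_of {x}, set_of {x, y}}"

lemma set_of_elts [simp]: "set_of (elts x) = x"
  unfolding set_of_def by (rule the_equality) (auto intro: extensionality)

lemma elts_set_of: "elts x = A \<Longrightarrow> elts (set_of A) = A"
  by (metis set_of_elts)

lemma elts_set_of_subset: "A \<subseteq> elts x \<Longrightarrow> elts (set_of A) = A"
  by (metis separation elts_set_of)

lemma elts_set_of_doubleton [simp]: "elts (set_of {x, y}) = {x, y}"
  by (metis pairing elts_set_of)

lemma elts_set_of_singleton [simp]: "elts (set_of {x}) = {x}"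
  using elts_set_of_doubleton[of x x] by simp

lemma elts_vpair: "elts (vpair x y) = {set_of {x}, set_of {x, y}}"
  by (simp add: vpair_def)

lemma vpair_inject [simp]: "vpair x y = vpair x' y' \<longleftrightarrow> x = x' \<and> y = y'"
proof
  assume "vpair x y = vpair x' y'"
  then have "elts ` elts (vpair x y) = elts ` elts (vpair x' y')" by simp
  then have "{{x}, {x, y}} = {{x'}, {x', y'}}" by (simp add: elts_vpair)
  then show "x = x' \<and> y = y'" by (auto simp: doubleton_eq_iff)
qed simp

lemma fst_in_trancl_vpair:
  assumes "vpair z s \<in> elts x"
  shows "(z, x) \<in> {(x, y). x \<in> elts y}\<^sup>+"
proof -
  have "(z, set_of {z}) \<in> {(x, y). x \<in> elts y}\<^sup>+"
    by (rule r_into_trancl) simp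
  also have "(set_of {z}, vpair z s) \<in> {(x, y). x \<in> elts y}"
    by (simp add: elts_vpair)
  also have "(vpair z s, x) \<in> {(x, y). x \<in> elts y}"
    using assms by simp
  finally show ?thesis .
qed

definition Ord :: "'v::set_universe \<Rightarrow> bool" where
  "Ord \<alpha> \<longleftrightarrow> (\<forall>\<beta> \<in> elts \<alpha>. elts \<beta> \<subseteq> elts \<alpha>) \<and> (\<forall>\<beta> \<in> elts \<alpha>. \<forall>\<gamma> \<in> elts \<beta>. elts \<gamma> \<subseteq> elts \<beta>)"

definition omega :: "'v::set_universe" where
  "omega = (THE \<alpha>. Ord \<alpha> \<and> infinite (elts \<alpha>) \<and> (\<forall>\<beta> \<in> elts \<alpha>. finite (elts \<beta>)))"

definition omega1 :: "'v::set_universe" where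
  "omega1 = (THE \<alpha>. Ord \<alpha> \<and> uncountable (elts \<alpha>) \<and> (\<forall>\<beta> \<in> elts \<alpha>. countable (elts \<beta>)))"

definition omega2 :: "'v::set_universe" where
  "omega2 = (THE \<alpha>. Ord \<alpha> \<and> elts (omega1 :: 'v) \<prec> elts \<alpha> \<and>
                    (\<forall>\<beta> \<in> elts \<alpha>. elts \<beta> \<lesssim> elts (omega1 :: 'v)))"

text \<open>Regular cardinals as the limit ordinals equal to their cofinality.\<close>

definition regular :: "'v::set_universe \<Rightarrow> bool" where
  "regular \<kappa> \<longleftrightarrow> Ord \<kappa> \<and> elts \<kappa> \<noteq> {} \<and> (\<forall>\<alpha> \<in> elts \<kappa>. \<exists>\<beta> \<in> elts \<kappa>. \<alpha> \<in> elts \<beta>) \<and>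
     (\<forall>\<alpha> \<in> elts \<kappa>. \<forall>f. f ` elts \<alpha> \<subseteq> elts \<kappa> \<longrightarrow> (\<exists>\<beta> \<in> elts \<kappa>. f ` elts \<alpha> \<subseteq> elts \<beta>))"

text \<open>\<open>|A| < \<kappa>\<close>, where \<open>\<kappa>\<close> may be any ordinal and \<open>|A|\<close> is the least ordinal equipollent to \<open>A\<close>.\<close>

definition size_less :: "'b set \<Rightarrow> 'v::set_universe \<Rightarrow> bool" where
  "size_less A \<kappa> \<longleftrightarrow> (\<exists>\<mu> \<in> elts \<kappa>. A \<approx> elts \<mu>)"

definition trcl :: "'v::set_universe \<Rightarrow> 'v set" where
  "trcl x = {y. (y, x) \<in> {(u, v). u \<in> elts v}\<^sup>+}"

definition H :: "'v::set_universe \<Rightarrow> 'v set" where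
  "H \<nu> = {x. size_less (trcl x) \<nu>}"

definition countable_subsets :: "'a set \<Rightarrow> 'a set set" where
  "countable_subsets X = {x. x \<subseteq> X \<and> countable x}"

definition club :: "'a set \<Rightarrow> 'a set set \<Rightarrow> bool" where
  "club X C \<longleftrightarrow> C \<subseteq> countable_subsets X \<and>
     (\<forall>x \<in> countable_subsets X. \<exists>y \<in> C. x \<subseteq> y) \<and>
     (\<forall>f :: nat \<Rightarrow> 'a set. mono f \<and> range f \<subseteq> C \<longrightarrow> \<Union> (range f) \<in> C)"

definition stationary :: "'a set \<Rightarrow> 'a set set \<Rightarrow> bool" where
  "stationary X S \<longleftrightarrow> S \<subseteq> countable_subsets X \<and> (\<forall>C. club X C \<longrightarrow> S \<inter> C \<noteq> {})"

definition RP_omega2 :: "'v::set_universe itself \<Rightarrow> bool" where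
  "RP_omega2 _ \<longleftrightarrow>
     (\<forall>S. stationary (elts (omega2 :: 'v)) S \<longrightarrow>
        (\<exists>X. X \<subseteq> elts (omega2 :: 'v) \<and> elts omega1 \<subseteq> X \<and> X \<approx> elts (omega1 :: 'v) \<and>
             stationary X (S \<inter> countable_subsets X)))"

datatype fm = Mem nat nat | Eq nat nat | Neg fm | Conj fm fm | Forall nat fm

primrec sat :: "'v::set_universe set \<Rightarrow> fm \<Rightarrow> (nat \<Rightarrow> 'v) \<Rightarrow> bool" where
  "sat M (Mem i j) e \<longleftrightarrow> e i \<in> elts (e j)"
| "sat M (Eq i j) e \<longleftrightarrow> e i = e j"
| "sat M (Neg \<phi>) e \<longleftrightarrow> \<not> sat M \<phi> e"
| "sat M (Conj \<phi> \<psi>) e \<longleftrightarrow> sat M \<phi> e \<and> sat M \<psi> e"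
| "sat M (Forall i \<phi>) e \<longleftrightarrow> (\<forall>x \<in> M. sat M \<phi> (e(i := x)))"

definition elementary :: "'v::set_universe set \<Rightarrow> 'v set \<Rightarrow> bool" (infix "\<prec>\<^sub>e" 50) where
  "M \<prec>\<^sub>e N \<longleftrightarrow> M \<subseteq> N \<and> (\<forall>\<phi> e. range e \<subseteq> M \<longrightarrow> (sat M \<phi> e \<longleftrightarrow> sat N \<phi> e))"

text \<open>
  \<open>(M, \<in>) \<Turnstile> ZF\<^sup>-\<close>, with the satisfaction of the single axioms written out. The conjuncts are
  Extensionality, Foundation, Pairing, Union, Infinity, Separation and Replacement.
\<close>

definition ZF_minus :: "'v::set_universe set \<Rightarrow> bool" where
  "ZF_minus M \<longleftrightarrow>
     (\<forall>x \<in> M. \<forall>y \<in> M. (\<forall>z \<in> M. z \<in> elts x \<longleftrightarrow> z \<in> elts y) \<longrightarrow> x = y) \<and>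
     (\<forall>x \<in> M. (\<exists>y \<in> M. y \<in> elts x) \<longrightarrow>
        (\<exists>y \<in> M. y \<in> elts x \<and> \<not> (\<exists>z \<in> M. z \<in> elts x \<and> z \<in> elts y))) \<and>
     (\<forall>x \<in> M. \<forall>y \<in> M. \<exists>z \<in> M. \<forall>w \<in> M. w \<in> elts z \<longleftrightarrow> w = x \<or> w = y) \<and>
     (\<forall>x \<in> M. \<exists>y \<in> M. \<forall>z \<in> M. z \<in> elts y \<longleftrightarrow> (\<exists>w \<in> M. w \<in> elts x \<and> z \<in> elts w)) \<and>
     (\<exists>x \<in> M. (\<exists>y \<in> M. y \<in> elts x \<and> (\<forall>z \<in> M. z \<notin> elts y)) \<and>
        (\<forall>y \<in> M. y \<in> elts x \<longrightarrow>
           (\<exists>z \<in> M. z \<in> elts x \<and> (\<forall>w \<in> M. w \<in> elts z \<longleftrightarrow> w \<in> elts y \<or> w = y)))) \<and>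
     (\<forall>\<phi> e. range e \<subseteq> M \<longrightarrow>
        (\<forall>a \<in> M. \<exists>b \<in> M. \<forall>x \<in> M. x \<in> elts b \<longleftrightarrow> x \<in> elts a \<and> sat M \<phi> (e(0 := x)))) \<and>
     (\<forall>\<phi> e. range e \<subseteq> M \<longrightarrow>
        (\<forall>a \<in> M.
           (\<forall>x \<in> M. x \<in> elts a \<longrightarrow> (\<exists>!y. y \<in> M \<and> sat M \<phi> (e(0 := x, 1 := y)))) \<longrightarrow>
           (\<exists>b \<in> M. \<forall>y \<in> M. y \<in> elts b \<longleftrightarrow>
              (\<exists>x \<in> M. x \<in> elts a \<and> sat M \<phi> (e(0 := x, 1 := y))))))"

function collapse :: "'v::set_universe set \<Rightarrow> 'v \<Rightarrow> 'v" where
  "collapse M x = set_of (collapse M ` (elts x \<inter> M))"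
  by pat_completeness auto
termination
  by (relation "inv_image {(x, y). x \<in> elts y} snd")
    (auto intro: wf_inv_image foundation)

text \<open>
  For transitive \<open>H \<Turnstile> ZF\<^sup>-\<close>, countability of \<open>z\<close> in the sense of \<open>H\<close> means that some injection from
  \<open>z\<close> into \<open>\<omega>\<close> (a set of pairs) is an element of \<open>H\<close>.
\<close>

definition countable_in :: "'v::set_universe set \<Rightarrow> 'v \<Rightarrow> bool" where
  "countable_in M z \<longleftrightarrow>
     (\<exists>f. inj_on f (elts z) \<and> f ` elts z \<subseteq> elts omega \<and>
          set_of ((\<lambda>x. vpair x (f x)) ` elts z) \<in> M)"

definition omega1_approximation_property :: "'v::set_universe set \<Rightarrow> bool" where
  "omega1_approximation_property M \<longleftrightarrow>
     (\<forall>x \<in> M. elts x \<subseteq> M) \<and> ZF_minus M \<and> omega1 \<in> M \<and>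
     (\<forall>\<eta> \<in> M. \<forall>A \<subseteq> elts \<eta>.
        (\<forall>z \<in> M. countable_in M z \<longrightarrow> set_of (elts z \<inter> A) \<in> M) \<longrightarrow> set_of A \<in> M)"

definition omega1_guessing :: "'v::set_universe set \<Rightarrow> bool" where
  "omega1_guessing M \<longleftrightarrow>
     elts omega1 \<subseteq> M \<and> (\<exists>\<theta>. regular \<theta> \<and> uncountable (elts \<theta>) \<and> M \<prec>\<^sub>e H \<theta>) \<and>
     omega1_approximation_property (collapse M ` M)"

definition G_omega1 :: "'v::set_universe set set" where
  "G_omega1 = {M. omega1_guessing M \<and> M \<approx> elts (omega1 :: 'v) \<and> elts omega1 \<subseteq> M}"

definition IC_omega1 :: "'v::set_universe set set" where
  "IC_omega1 = {M. ZF_minus M \<and> elts omega1 \<subseteq> M \<and> M \<approx> elts (omega1 :: 'v) \<and>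
                   (\<exists>C. club M C \<and> (\<forall>x \<in> C. set_of x \<in> M))}"

definition GIC_omega1 :: "'v::set_universe set set" where
  "GIC_omega1 = G_omega1 \<inter> IC_omega1"

definition ideal_on :: "'a set set \<Rightarrow> 'a set set set \<Rightarrow> bool" where
  "ideal_on Z I \<longleftrightarrow> I \<subseteq> Pow Z \<and> Z \<notin> I \<and>
     (\<forall>A \<in> I. \<forall>B \<subseteq> A. B \<in> I) \<and>
     (\<forall>\<A> \<subseteq> I. countable \<A> \<longrightarrow> \<Union> \<A> \<in> I) \<and>
     (\<forall>b \<in> \<Union> Z. {M \<in> Z. b \<notin> M} \<in> I) \<and>
     (\<forall>S g. S \<subseteq> Z \<and> S \<notin> I \<and> (\<forall>M \<in> S. g M \<in> M) \<longrightarrow>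
        (\<exists>S' c. S' \<subseteq> S \<and> S' \<notin> I \<and> (\<forall>M \<in> S'. g M = c)))"

definition concentrates :: "'a set set \<Rightarrow> 'a set set set \<Rightarrow> 'a set set \<Rightarrow> bool" where
  "concentrates Z I \<Gamma> \<longleftrightarrow> (\<exists>A \<subseteq> \<Gamma>. A \<subseteq> Z \<and> Z - A \<in> I)"

definition canonical_projection ::
  "'a set set \<Rightarrow> 'a set set set \<Rightarrow> 'a set set \<Rightarrow> 'a set set set \<Rightarrow> bool" where
  "canonical_projection Z I Z' I' \<longleftrightarrow> I = {A. A \<subseteq> Z \<and> {M' \<in> Z'. M' \<inter> \<Union> Z \<in> A} \<in> I'}"

definition closed_under_unions :: "'a set set \<Rightarrow> 'v::set_universe \<Rightarrow> bool" where
  "closed_under_unions I \<mu> \<longleftrightarrow> (\<forall>\<A> \<subseteq> I. size_less \<A> \<mu> \<longrightarrow> \<Union> \<A> \<in> I)"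

definition Z_of :: "'v::set_universe \<Rightarrow> 'v \<Rightarrow> 'v set set" where
  "Z_of \<kappa> \<nu> = {M. M \<subseteq> H \<nu> \<and> size_less M \<kappa>}"

text \<open>The ideals \<open>I \<nu>\<close> are relevant for \<open>\<nu> \<in> U\<close> only; \<open>\<le>\<close> between ordinals is inclusion of \<open>elts\<close>.\<close>

definition tower ::
  "'v::set_universe \<Rightarrow> 'v \<Rightarrow> 'v set \<Rightarrow> ('v \<Rightarrow> 'v set set set) \<Rightarrow> bool" where
  "tower \<kappa> \<delta> U I \<longleftrightarrow> Ord \<delta> \<and> regular \<kappa> \<and>
     U \<subseteq> elts \<delta> \<and> (\<forall>\<alpha> \<in> elts \<delta>. \<exists>\<nu> \<in> U. elts \<alpha> \<subseteq> elts \<nu>) \<and>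
     (\<forall>\<nu> \<in> U. elts \<kappa> \<subseteq> elts \<nu> \<and> ideal_on (Z_of \<kappa> \<nu>) (I \<nu>)) \<and>
     (\<forall>\<nu> \<in> U. \<forall>\<nu>' \<in> U. \<forall>\<mu> :: 'v. Ord \<mu> \<longrightarrow>
        (closed_under_unions (I \<nu>) \<mu> \<longleftrightarrow> closed_under_unions (I \<nu>') \<mu>)) \<and>
     (\<forall>\<nu> \<in> U. \<forall>\<nu>' \<in> U. elts \<nu> \<subseteq> elts \<nu>' \<longrightarrow>
        canonical_projection (Z_of \<kappa> \<nu>) (I \<nu>) (Z_of \<kappa> \<nu>') (I \<nu>'))"

definition tower_concentrates ::
  "'v::set_universe \<Rightarrow> 'v set \<Rightarrow> ('v \<Rightarrow> 'v set set set) \<Rightarrow> 'v set set \<Rightarrow> bool" where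
  "tower_concentrates \<kappa> U I \<Gamma> \<longleftrightarrow> (\<forall>\<nu> \<in> U. concentrates (Z_of \<kappa> \<nu>) (I \<nu>) \<Gamma>)"

text \<open>
  Conditions \<open>(\<nu>, S)\<close> are coded as elements of the universe, so that names can be built from them.
\<close>

definition cond :: "'v::set_universe \<Rightarrow> 'v set set \<Rightarrow> 'v" where
  "cond \<nu> S = vpair \<nu> (set_of (set_of ` S))"

definition tower_poset ::
  "'v::set_universe \<Rightarrow> 'v set \<Rightarrow> ('v \<Rightarrow> 'v set set set) \<Rightarrow> 'v set" where
  "tower_poset \<kappa> U I = {cond \<nu> S | \<nu> S. \<nu> \<in> U \<and> S \<subseteq> Z_of \<kappa> \<nu> \<and> S \<notin> I \<nu>}"

definition tower_le ::
  "'v::set_universe \<Rightarrow> 'v set \<Rightarrow> ('v \<Rightarrow> 'v set set set) \<Rightarrow> 'v \<Rightarrow> 'v \<Rightarrow> bool" where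
  "tower_le \<kappa> U I p' p \<longleftrightarrow>
     (\<exists>\<nu>' S' \<nu> S. p' = cond \<nu>' S' \<and> p = cond \<nu> S \<and>
        \<nu>' \<in> U \<and> S' \<subseteq> Z_of \<kappa> \<nu>' \<and> S' \<notin> I \<nu>' \<and> \<nu> \<in> U \<and> S \<subseteq> Z_of \<kappa> \<nu> \<and> S \<notin> I \<nu> \<and>
        elts \<nu> \<subseteq> elts \<nu>' \<and> S' \<subseteq> {M' \<in> Z_of \<kappa> \<nu>'. M' \<inter> H \<nu> \<in> S})"

text \<open>
  A forcing notion is given by a set \<open>P\<close> of conditions and its ordering \<open>le\<close>, where \<open>le q p\<close> means
  that \<open>q\<close> is stronger.
\<close>

inductive is_name :: "'v::set_universe set \<Rightarrow> 'v \<Rightarrow> bool" for P where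
  "(\<And>u. u \<in> elts x \<Longrightarrow> \<exists>z s. u = vpair z s \<and> s \<in> P \<and> is_name P z) \<Longrightarrow> is_name P x"

text \<open>\<open>P\<close> need not have a largest element, so all conditions are attached to a check name.\<close>

function check_name :: "'v::set_universe set \<Rightarrow> 'v \<Rightarrow> 'v" where
  "check_name P x = set_of (\<Union>y \<in> elts x. vpair (check_name P y) ` P)"
  by pat_completeness auto
termination
  by (relation "inv_image {(x, y). x \<in> elts y} snd")
    (auto intro: wf_inv_image foundation)

text \<open>
  \<open>p \<tturnstile> x = y\<close>: densely below \<open>p\<close>, every potential element of \<open>x\<close> is forced to equal a potential
  element of \<open>y\<close>, and vice versa.
\<close>

context
  notes conj_cong [fundef_cong]
begin

function forces_eq ::
  "'v::set_universe set \<Rightarrow> ('v \<Rightarrow> 'v \<Rightarrow> bool) \<Rightarrow> 'v \<Rightarrow> 'v \<Rightarrow> 'v \<Rightarrow> bool" where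
  "forces_eq P le p x y \<longleftrightarrow>
     (\<forall>z s. vpair z s \<in> elts x \<longrightarrow> (\<forall>q \<in> P. le q p \<and> le q s \<longrightarrow>
        (\<exists>r \<in> P. le r q \<and> (\<exists>w t. vpair w t \<in> elts y \<and> le r t \<and> forces_eq P le r z w)))) \<and>
     (\<forall>w t. vpair w t \<in> elts y \<longrightarrow> (\<forall>q \<in> P. le q p \<and> le q t \<longrightarrow>
        (\<exists>r \<in> P. le r q \<and> (\<exists>z s. vpair z s \<in> elts x \<and> le r s \<and> forces_eq P le r z w))))"
  by pat_completeness auto
termination
  by (relation "inv_image ({(x, y). x \<in> elts y}\<^sup>+) (\<lambda>(P, le, p, x, y). x)")
    (auto intro: wf_inv_image wf_trancl foundation fst_in_trancl_vpair)

end

declare collapse.simps [simp del] check_name.simps [simp del] forces_eq.simps [simp del]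

definition forces_mem ::
  "'v::set_universe set \<Rightarrow> ('v \<Rightarrow> 'v \<Rightarrow> bool) \<Rightarrow> 'v \<Rightarrow> 'v \<Rightarrow> 'v \<Rightarrow> bool" where
  "forces_mem P le p x y \<longleftrightarrow>
     (\<forall>q \<in> P. le q p \<longrightarrow>
        (\<exists>r \<in> P. le r q \<and> (\<exists>w t. vpair w t \<in> elts y \<and> le r t \<and> forces_eq P le r x w)))"

primrec forces ::
  "'v::set_universe set \<Rightarrow> ('v \<Rightarrow> 'v \<Rightarrow> bool) \<Rightarrow> 'v \<Rightarrow> fm \<Rightarrow> (nat \<Rightarrow> 'v) \<Rightarrow> bool" where
  "forces P le p (Mem i j) e \<longleftrightarrow> forces_mem P le p (e i) (e j)"
| "forces P le p (Eq i j) e \<longleftrightarrow> forces_eq P le p (e i) (e j)"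
| "forces P le p (Neg \<phi>) e \<longleftrightarrow> (\<forall>q \<in> P. le q p \<longrightarrow> \<not> forces P le q \<phi> e)"
| "forces P le p (Conj \<phi> \<psi>) e \<longleftrightarrow> forces P le p \<phi> e \<and> forces P le p \<psi> e"
| "forces P le p (Forall i \<phi>) e \<longleftrightarrow> (\<forall>x. is_name P x \<longrightarrow> forces P le p \<phi> (e(i := x)))"

abbreviation "Imp \<phi> \<psi> \<equiv> Neg (Conj \<phi> (Neg \<psi>))"
abbreviation "Disj \<phi> \<psi> \<equiv> Neg (Conj (Neg \<phi>) (Neg \<psi>))"
abbreviation "Iff \<phi> \<psi> \<equiv> Conj (Imp \<phi> \<psi>) (Imp \<psi> \<phi>)"
abbreviation "Exists i \<phi> \<equiv> Neg (Forall i (Neg \<phi>))"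
abbreviation "ForallIn i j \<phi> \<equiv> Forall i (Imp (Mem i j) \<phi>)"
abbreviation "ExistsIn i j \<phi> \<equiv> Exists i (Conj (Mem i j) \<phi>)"

text \<open>
  \<open>Pair_fm z x y\<close> expresses \<open>z = \<langle>x, y\<rangle>\<close> for variables other than 7 and 8, \<open>PairIn_fm x y f\<close>
  expresses \<open>\<langle>x, y\<rangle> \<in> f\<close> for variables other than 7, 8 and 9.
\<close>

definition Pair_fm :: "nat \<Rightarrow> nat \<Rightarrow> nat \<Rightarrow> fm" where
  "Pair_fm z x y = Forall 7 (Iff (Mem 7 z)
     (Disj (Forall 8 (Iff (Mem 8 7) (Eq 8 x)))
           (Forall 8 (Iff (Mem 8 7) (Disj (Eq 8 x) (Eq 8 y))))))"

definition PairIn_fm :: "nat \<Rightarrow> nat \<Rightarrow> nat \<Rightarrow> fm" where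
  "PairIn_fm x y f = ExistsIn 9 f (Pair_fm 9 x y)"

definition Function_fm :: fm where
  "Function_fm =
     Conj (ForallIn 3 2 (ExistsIn 4 1 (ExistsIn 5 0 (Pair_fm 3 4 5))))
          (ForallIn 4 1 (ExistsIn 5 0 (Conj (PairIn_fm 4 5 2)
             (Forall 6 (Imp (PairIn_fm 4 6 2) (Eq 6 5))))))"

text \<open>See \<open>sat_Regular_fm\<close>.\<close>

definition Regular_fm :: fm where
  "Regular_fm =
     Conj (Conj (ForallIn 1 0 (ForallIn 2 1 (Mem 2 0)))
                (ForallIn 1 0 (ForallIn 2 1 (ForallIn 3 2 (Mem 3 1)))))
    (Conj (Conj (Exists 1 (Mem 1 0)) (ForallIn 1 0 (ExistsIn 2 0 (Mem 1 2))))
          (ForallIn 1 0 (Forall 2 (Imp Function_fm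
             (ExistsIn 3 0 (ForallIn 4 1 (Forall 5 (Imp (PairIn_fm 4 5 2) (Mem 5 3)))))))))"

text \<open>
  \<open>\<delta>\<close> is regular and every condition forces it to remain so. (The first conjunct is implied by the
  second one unless the poset is empty.)
\<close>

definition presaturated ::
  "'v::set_universe \<Rightarrow> 'v \<Rightarrow> 'v set \<Rightarrow> ('v \<Rightarrow> 'v set set set) \<Rightarrow> bool" where
  "presaturated \<kappa> \<delta> U I \<longleftrightarrow> regular \<delta> \<and>
     (\<forall>p \<in> tower_poset \<kappa> U I.
        forces (tower_poset \<kappa> U I) (tower_le \<kappa> U I) p Regular_fm
          (\<lambda>_. check_name (tower_poset \<kappa> U I) \<delta>))"

lemma sat_connectives:
  "sat M (Disj \<phi> \<psi>) e \<longleftrightarrow> sat M \<phi> e \<or> sat M \<psi> e"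
  "sat M (Iff \<phi> \<psi>) e \<longleftrightarrow> (sat M \<phi> e \<longleftrightarrow> sat M \<psi> e)"
  "sat M (Imp \<phi> \<psi>) e \<longleftrightarrow> (sat M \<phi> e \<longrightarrow> sat M \<psi> e)"
  "sat M (Exists i \<phi>) e \<longleftrightarrow> (\<exists>x \<in> M. sat M \<phi> (e(i := x)))"
  by auto

lemma sat_Pair_fm:
  assumes "z \<notin> {7, 8}" "x \<notin> {7, 8}" "y \<notin> {7, 8}"
  shows "sat UNIV (Pair_fm z x y) e \<longleftrightarrow> e z = vpair (e x) (e y)"
proof -
  have eq: "a = set_of {b, c} \<longleftrightarrow> (\<forall>u. u \<in> elts a \<longleftrightarrow> u = b \<or> u = c)" for a b c :: 'a
    using extensionality[of a "set_of {b, c}"] by auto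
  have eq1: "a = set_of {b} \<longleftrightarrow> (\<forall>u. u \<in> elts a \<longleftrightarrow> u = b)" for a b :: 'a
    using eq[of a b b] by simp
  have "e z = vpair (e x) (e y) \<longleftrightarrow>
        (\<forall>u. u \<in> elts (e z) \<longleftrightarrow> u = set_of {e x} \<or> u = set_of {e x, e y})"
    unfolding vpair_def by (rule eq)
  moreover have "sat UNIV (Pair_fm z x y) e \<longleftrightarrow>
        (\<forall>u. u \<in> elts (e z) \<longleftrightarrow> u = set_of {e x} \<or> u = set_of {e x, e y})"
    unfolding eq eq1 Pair_fm_def
    by (simp only: sat_connectives(1,2) sat.simps(5)) (use assms in simp)
  ultimately show ?thesis by simp
qed

lemma sat_PairIn_fm:
  assumes "f \<notin> {7, 8, 9}" "x \<notin> {7, 8, 9}" "y \<notin> {7, 8, 9}"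
  shows "sat UNIV (PairIn_fm x y f) e \<longleftrightarrow> vpair (e x) (e y) \<in> elts (e f)"
  using assms by (simp add: PairIn_fm_def sat_Pair_fm)

lemma sat_Function_fm:
  "sat UNIV Function_fm e \<longleftrightarrow>
     (\<exists>f. f ` elts (e 1) \<subseteq> elts (e 0) \<and> elts (e 2) = (\<lambda>x. vpair x (f x)) ` elts (e 1))"
    (is "_ \<longleftrightarrow> (\<exists>f. ?fun f)")
proof -
  have "sat UNIV Function_fm e \<longleftrightarrow>
      (\<forall>u \<in> elts (e 2). \<exists>x \<in> elts (e 1). \<exists>y \<in> elts (e 0). u = vpair x y) \<and>
      (\<forall>x \<in> elts (e 1). \<exists>y \<in> elts (e 0). vpair x y \<in> elts (e 2) \<and>
         (\<forall>y'. vpair x y' \<in> elts (e 2) \<longrightarrow> y' = y))" (is "_ \<longleftrightarrow> ?L1 \<and> ?L2")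
    unfolding Function_fm_def
    by (simp only: sat_connectives(3,4) sat.simps(1,2,4,5))
      (simp add: sat_PairIn_fm sat_Pair_fm Bex_def Ball_def)
  moreover have "?L1 \<and> ?L2 \<longleftrightarrow> (\<exists>f. ?fun f)"
  proof
    assume L: "?L1 \<and> ?L2"
    then have "\<forall>x \<in> elts (e 1). \<exists>y. y \<in> elts (e 0) \<and> vpair x y \<in> elts (e 2) \<and>
        (\<forall>y'. vpair x y' \<in> elts (e 2) \<longrightarrow> y' = y)"
      by (elim conjE) (simp only: Bex_def)
    from bchoice[OF this] obtain f
      where f: "\<forall>x \<in> elts (e 1). f x \<in> elts (e 0) \<and> vpair x (f x) \<in> elts (e 2) \<and>
        (\<forall>y'. vpair x y' \<in> elts (e 2) \<longrightarrow> y' = f x)"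
      by (elim exE)
    have "u \<in> (\<lambda>x. vpair x (f x)) ` elts (e 1)" if u: "u \<in> elts (e 2)" for u
    proof -
      from L u obtain x y where "x \<in> elts (e 1)" "u = vpair x y" by blast
      with f u have "y = f x" by simp
      with \<open>x \<in> elts (e 1)\<close> \<open>u = vpair x y\<close> show ?thesis by simp
    qed
    moreover have "(\<lambda>x. vpair x (f x)) ` elts (e 1) \<subseteq> elts (e 2)" "f ` elts (e 1) \<subseteq> elts (e 0)"
      using f by (simp_all add: image_subset_iff)
    ultimately show "\<exists>f. ?fun f" by (intro exI[of _ f] conjI equalityI subsetI) (simp | blast)+
  next
    assume "\<exists>f. ?fun f"
    then show "?L1 \<and> ?L2" by (auto simp: image_iff image_subset_iff)
  qed
  ultimately show ?thesis by simp
qed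

lemma graph_exists:
  assumes "f ` elts a \<subseteq> elts b"
  shows "\<exists>g. elts g = (\<lambda>x. vpair x (f x)) ` elts a"
proof -
  obtain u where u: "elts u = {a, b}" using pairing by blast
  obtain c where c: "elts c = \<Union> (elts ` elts u)" using union by blast
  obtain d where d: "elts d = {z. elts z \<subseteq> elts c}" using power_set by blast
  obtain d' where d': "elts d' = {z. elts z \<subseteq> elts d}" using power_set by blast
  have "(\<lambda>x. vpair x (f x)) ` elts a \<subseteq> elts d'"
    using assms by (auto simp: u c d d' elts_vpair image_subset_iff)
  then show ?thesis by (rule separation)
qed

lemma sat_Regular_fm: "sat UNIV Regular_fm e \<longleftrightarrow> regular (e 0)"
proof -
  have "sat UNIV Regular_fm e \<longleftrightarrow> Ord (e 0) \<and> elts (e 0) \<noteq> {} \<and>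
      (\<forall>\<alpha> \<in> elts (e 0). \<exists>\<beta> \<in> elts (e 0). \<alpha> \<in> elts \<beta>) \<and>
      (\<forall>\<alpha> \<in> elts (e 0). \<forall>g.
         (\<exists>f. f ` elts \<alpha> \<subseteq> elts (e 0) \<and> elts g = (\<lambda>x. vpair x (f x)) ` elts \<alpha>) \<longrightarrow>
         (\<exists>\<beta> \<in> elts (e 0). \<forall>x \<in> elts \<alpha>. \<forall>y. vpair x y \<in> elts g \<longrightarrow> y \<in> elts \<beta>))"
    unfolding Regular_fm_def
    by (simp only: sat_connectives(3,4) sat.simps(1,2,4,5))
      (simp add: sat_Function_fm sat_PairIn_fm Ord_def Bex_def Ball_def subset_iff
        flip: ex_in_conv)
  also have "\<dots> \<longleftrightarrow> regular (e 0)"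
  proof -
    have "(\<forall>g. (\<exists>f. f ` elts \<alpha> \<subseteq> elts \<kappa> \<and> elts g = (\<lambda>x. vpair x (f x)) ` elts \<alpha>) \<longrightarrow>
         (\<exists>\<beta> \<in> elts \<kappa>. \<forall>x \<in> elts \<alpha>. \<forall>y. vpair x y \<in> elts g \<longrightarrow> y \<in> elts \<beta>)) \<longleftrightarrow>
       (\<forall>f. f ` elts \<alpha> \<subseteq> elts \<kappa> \<longrightarrow> (\<exists>\<beta> \<in> elts \<kappa>. f ` elts \<alpha> \<subseteq> elts \<beta>))" (is "?L = ?R")
      for \<alpha> \<kappa> :: 'a
    proof
      assume L: ?L
      show ?R
      proof (intro allI impI)
        fix f assume f: "f ` elts \<alpha> \<subseteq> elts \<kappa>"
        obtain g where g: "elts g = (\<lambda>x. vpair x (f x)) ` elts \<alpha>"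
          using graph_exists[OF f] by blast
        from L f g have "\<exists>\<beta> \<in> elts \<kappa>. \<forall>x \<in> elts \<alpha>. \<forall>y. vpair x y \<in> elts g \<longrightarrow> y \<in> elts \<beta>"
          by blast
        then obtain \<beta> where \<beta>: "\<beta> \<in> elts \<kappa>"
          "\<forall>x \<in> elts \<alpha>. \<forall>y. vpair x y \<in> elts g \<longrightarrow> y \<in> elts \<beta>" by blast
        have "f ` elts \<alpha> \<subseteq> elts \<beta>"
          using \<beta>(2) by (simp add: g image_iff image_subset_iff)
        with \<beta>(1) show "\<exists>\<beta> \<in> elts \<kappa>. f ` elts \<alpha> \<subseteq> elts \<beta>" by (rule bexI[rotated])
      qed
    next
      assume R: ?R
      show ?L
      proof (intro allI impI, elim exE conjE)
        fix g f assume f: "f ` elts \<alpha> \<subseteq> elts \<kappa>" "elts g = (\<lambda>x. vpair x (f x)) ` elts \<alpha>"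
        from R f(1) have "\<exists>\<beta> \<in> elts \<kappa>. f ` elts \<alpha> \<subseteq> elts \<beta>" by simp
        then obtain \<beta> where \<beta>: "\<beta> \<in> elts \<kappa>" "f ` elts \<alpha> \<subseteq> elts \<beta>" by (elim bexE)
        have "\<forall>x \<in> elts \<alpha>. \<forall>y. vpair x y \<in> elts g \<longrightarrow> y \<in> elts \<beta>"
          using \<beta>(2) by (simp add: f(2) image_iff image_subset_iff)
        with \<beta>(1) show "\<exists>\<beta> \<in> elts \<kappa>. \<forall>x \<in> elts \<alpha>. \<forall>y. vpair x y \<in> elts g \<longrightarrow> y \<in> elts \<beta>"
          by (rule bexI[rotated])
      qed
    qed
    then show ?thesis unfolding regular_def by simp
  qed
  finally show ?thesis .
qed

end

theory Submission
  imports Defs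
begin

text \<open>
  Let \<open>j : V \<rightarrow> N \<subseteq> V[G]\<close> be the generic embedding of a presaturated tower concentrating on
  \<open>GIC\<^bsub>\<omega>\<^sub>1\<^esub>\<close>. Presaturation gives \<open>j(\<omega>\<^sub>2) = \<delta>\<close>. Guessing gives a real in \<open>N - V\<close>, and by a
  theorem of Gitik the set of countable subsets of \<open>\<delta>\<close> lying outside \<open>V\<close> is then stationary in \<open>N\<close>. By
  internal clubness, the countable subsets of any \<open>\<beta> < \<delta>\<close> contain a club of elements of \<open>V\<close>, so this
  stationary set reflects to no \<open>\<beta> < \<delta>\<close>, contradicting \<open>RP\<close> in \<open>N\<close>. For the argument inside \<open>N\<close> one has
  to define the countable subsets of \<open>\<delta>\<close> lying in \<open>V\<close> from the hereditarily countable sets of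
  \<open>V\<close>: \<open>x\<close> is one of them iff, for club many countable \<open>y \<supseteq> x\<close>, the image of \<open>x\<close> under the collapse of
  \<open>y\<close> to its order type belongs to \<open>V\<close>.

  The proof below avoids generic ultrapowers: statements about \<open>N\<close> become statements about the members
  \<open>M\<close> of sets of positive measure, with \<open>M\<close> in the role of \<open>V\<close>.
\<close>

section \<open>Sets of the universe\<close>

text \<open>Gitik's theorem is proved for \<open>M\<close> itself. The obstacle is that members of a
  club are closed sets and so contain much besides what one wants to put into them. A game controls
  the closure: it produces members of the club that meet prescribed intervals of ordinals and avoid
  others. Three of them spell a real by the order in which they meet the intervals, and since
  collapsing preserves order, codes for the three in \<open>M\<close> would put the real into
  \<open>M\<close>. A real outside \<open>M\<close> exists by counting: with all reals in
  \<open>M\<close>, guessing would put every subset of omega1 into the collapse of \<open>M\<close>,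
  a set of size omega1. Reflection, applied for each \<open>M\<close> of a positive set, gives an
  ordinal \<open>f M\<close> below omega2; the function \<open>f\<close> represents an ordinal below
  j(omega2). Presaturation passes to a positive set of larger \<open>M'\<close> for which this
  ordinal is the collapse of an ordinal in \<open>M'\<close>, and there internal clubness of
  \<open>M'\<close> refutes stationarity. The universe satisfies no Replacement scheme. Hence each
  use of \<open>set_of\<close> calls for a proof that its argument is \<open>small\<close>, and the
  \<open>mostowski\<close> axiom is the ultimate source of the recursively defined sets.\<close>

definition small :: "'v::set_universe set \<Rightarrow> bool" where
  "small A \<longleftrightarrow> (\<exists>x. elts x = A)"

lemma small_elts [simp, intro]: "small (elts x)"
  unfolding small_def by (rule exI) (rule refl)

lemma smallE:
  assumes "small A"
  obtains x where "elts x = A"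
  using assms unfolding small_def by (elim exE)

lemma elts_set_of_small [simp]: "small A \<Longrightarrow> elts (set_of A) = A"
  by (elim smallE) (rule elts_set_of)

lemma small_subset:
  assumes "small B" "A \<subseteq> B"
  shows "small A"
proof -
  obtain b where "elts b = B" using assms(1) by (rule smallE)
  with assms(2) show ?thesis unfolding small_def by (intro separation[of A b]) simp
qed

lemma small_doubleton [simp, intro]: "small {x, y}"
  unfolding small_def by (rule pairing)

lemma small_Union:
  assumes "small A"
  shows "small (\<Union> (elts ` A))"
proof -
  obtain a where "elts a = A" using assms by (rule smallE)
  with union[of a] show ?thesis unfolding small_def by simp
qed

lemma small_Un: "small A \<Longrightarrow> small B \<Longrightarrow> small (A \<union> B)"
  using small_Union[of "{set_of A, set_of B}"] elts_set_of_small[of A] elts_set_of_small[of B]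
  by (simp only: image_insert image_empty small_doubleton simp_thms Union_insert Union_empty Un_empty_right)

lemma small_insert: "small A \<Longrightarrow> small (insert x A)"
  using small_Un[of "{x, x}" A] small_doubleton[of x x] by simp

lemma small_Pow:
  assumes "small A"
  shows "small {z. elts z \<subseteq> A}"
proof -
  obtain a where "elts a = A" using assms by (rule smallE)
  with power_set[of a] show ?thesis unfolding small_def by simp
qed

text \<open>A pair of an element of \<open>A\<close> and one of \<open>B\<close> is a set of subsets
  of \<open>A \<union> B\<close>, so taking power sets twice bounds the product without
  Replacement.\<close>

lemma small_times:
  assumes "small A" "small B"
  shows "small (case_prod vpair ` (A \<times> B))"
proof -
  have "case_prod vpair ` (A \<times> B) \<subseteq> {z. elts z \<subseteq> {z. elts z \<subseteq> A \<union> B}}"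
    by (auto simp: elts_vpair)
  then show ?thesis
    by (rule small_subset[OF small_Pow[OF small_Pow[OF small_Un[OF assms]]]])
qed

lemma small_image_set_of_Pow:
  assumes "small A"
  shows "small (set_of ` Pow A)"
proof (rule small_subset[OF small_Pow[OF assms]])
  show "set_of ` Pow A \<subseteq> {z. elts z \<subseteq> A}"
    using elts_set_of_small[OF small_subset[OF assms]] by auto
qed

lemma set_of_inject_small: "small A \<Longrightarrow> small B \<Longrightarrow> set_of A = set_of B \<longleftrightarrow> A = B"
  by (auto dest: arg_cong[where f = elts])

lemma elts_induct [case_names step]:
  assumes "\<And>x. (\<And>y. y \<in> elts x \<Longrightarrow> P y) \<Longrightarrow> P x"
  shows "P (x :: 'v::set_universe)"
  using foundation by (rule wf_induct_rule) (use assms in auto)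

lemma elts_irrefl [simp]: "x \<notin> elts x"
  by (induction x rule: elts_induct) blast

lemma elts_asym: "x \<in> elts y \<Longrightarrow> y \<notin> elts x"
  by (induction x arbitrary: y rule: elts_induct) blast

lemma trcl_unfold: "trcl x = elts x \<union> (\<Union>y \<in> elts x. trcl y)"
proof -
  have "(z, x) \<in> {(u, v). u \<in> elts v}\<^sup>+ \<longleftrightarrow>
      z \<in> elts x \<or> (\<exists>y \<in> elts x. (z, y) \<in> {(u, v). u \<in> elts v}\<^sup>+)" for z
    using tranclD2[of z x "{(u, v). u \<in> elts v}"]
    by (auto simp: rtrancl_eq_or_trancl intro: trancl_into_trancl)
  then show ?thesis unfolding trcl_def by blast
qed

lemma elts_subset_trcl: "elts x \<subseteq> trcl x"
  by (subst trcl_unfold) auto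

lemma trcl_mono: "y \<in> elts x \<Longrightarrow> trcl y \<subseteq> trcl x"
  by (subst (2) trcl_unfold) auto

lemma trcl_trans: "y \<in> trcl x \<Longrightarrow> trcl y \<subseteq> trcl x"
  by (auto simp: trcl_def)

lemma trcl_transitive: "y \<in> trcl x \<Longrightarrow> elts y \<subseteq> trcl x"
  using elts_subset_trcl trcl_trans by blast

lemma trcl_subset: "(\<And>y. y \<in> A \<Longrightarrow> elts y \<subseteq> A) \<Longrightarrow> elts x \<subseteq> A \<Longrightarrow> trcl x \<subseteq> A"
proof (induction x rule: elts_induct)
  case (step x)
  then show ?case by (subst trcl_unfold) blast
qed

lemma ex_transitive_elts: "\<exists>t. x \<in> elts t \<and> (\<forall>z \<in> elts t. elts z \<subseteq> elts t)"
  using transitive_containment by blast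

section \<open>Cardinalities of unions\<close>

lemma lepoll_image: "A \<lesssim> B \<Longrightarrow> f ` A \<lesssim> B"
  using image_lepoll lepoll_trans by blast

lemma lepoll_UN:
  assumes "infinite B" "I \<lesssim> B" "\<And>i. i \<in> I \<Longrightarrow> A i \<lesssim> B"
  shows "(\<Union>i \<in> I. A i) \<lesssim> B"
  using assms card_of_UNION_ordLeq_infinite[of B I A]
  unfolding lepoll_def card_of_ordLeq by blast

lemma lepoll_Un:
  assumes "infinite B" "A \<lesssim> B" "A' \<lesssim> B"
  shows "A \<union> A' \<lesssim> B"
proof -
  have "\<Union> (id ` {A, A'}) \<lesssim> B"
  proof (rule lepoll_UN[OF assms(1)])
    show "{A, A'} \<lesssim> B"
      using assms(1) by (rule finite_lepoll_infinite) simp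
    show "id C \<lesssim> B" if "C \<in> {A, A'}" for C
      using that assms(2,3) unfolding id_def by blast
  qed
  moreover have "A \<union> A' = \<Union> (id ` {A, A'})" by auto
  ultimately show ?thesis by (simp only:)
qed

lemma lepoll_insert: "infinite B \<Longrightarrow> A \<lesssim> B \<Longrightarrow> insert x A \<lesssim> B"
  using lepoll_Un[of B "{x}" A] finite_lepoll_infinite[of B "{x}"] by simp

lemma countable_lepoll_infinite:
  assumes "countable A" "infinite B"
  shows "A \<lesssim> B"
proof -
  have "A \<lesssim> (UNIV :: nat set)"
    using assms(1) by (elim countableE) (auto simp: lepoll_def)
  then show ?thesis
    using assms(2) by (auto simp: infinite_le_lepoll intro: lepoll_trans)
qed

definition HB :: "'b set \<Rightarrow> 'v::set_universe set" where
  "HB B = {x. trcl x \<lesssim> B}"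

text \<open>A set \<open>x\<close> in \<open>HB (elts b)\<close> can be recovered from a copy on
  \<open>b\<close> of the membership relation of \<open>{x} \<union> trcl x\<close>. All
  well-founded relations on \<open>b\<close> are placed side by side as one well-founded relation on
  one set, whose Mostowski collapse takes every such \<open>x\<close> as a value.\<close>

lemma small_HB:
  fixes b :: "'v::set_universe"
  assumes inf: "infinite (elts b)"
  shows "small (HB (elts b) :: 'v set)"
proof -
  define Q :: "('v \<times> 'v) set \<Rightarrow> 'v" where "Q R = set_of (case_prod vpair ` R)" for R
  have Q_inj: "R = R'" if "R \<subseteq> elts b \<times> elts b" "R' \<subseteq> elts b \<times> elts b" "Q R = Q R'" for R R'
  proof -
    have sm: "small (case_prod vpair ` R)" if "R \<subseteq> elts b \<times> elts b" for R
      by (rule small_subset[OF small_times[of "elts b" "elts b"]]) (use that in auto)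
    have "case_prod vpair ` R = case_prod vpair ` R'"
      using that set_of_inject_small[OF sm sm] unfolding Q_def by blast
    moreover have "inj (case_prod vpair :: 'v \<times> 'v \<Rightarrow> 'v)"
      by (auto simp: inj_def)
    ultimately show ?thesis by (simp add: inj_image_eq_iff)
  qed
  define W where "W = {R. wf R \<and> R \<subseteq> elts b \<times> elts b}"
  define rel where "rel R = map_prod (vpair (Q R)) (vpair (Q R)) ` R" for R
  \<comment> \<open>The tags \<open>Q R\<close> keep the copies apart, so that a descending sequence
    cannot pass from one copy to another.\<close>
  have "wf (\<Union>R \<in> W. rel R)"
  proof (rule wf_UN)
    show "wf (rel R)" if "R \<in> W" for R
      using that unfolding W_def rel_def by (auto intro!: wf_map_prod_image simp: inj_def)
    show "Domain (rel R) \<inter> Range (rel R') = {}"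
      if R: "R \<in> W" "R' \<in> W" "rel R \<noteq> rel R'" for R R'
    proof -
      have "Q R \<noteq> Q R'" using Q_inj[of R R'] R unfolding W_def by blast
      then have "vpair (Q R) u \<noteq> vpair (Q R') u'" for u u' by simp
      moreover have "Domain (rel R) \<subseteq> range (vpair (Q R))" "Range (rel R') \<subseteq> range (vpair (Q R'))"
        unfolding rel_def by auto
      ultimately show ?thesis by blast
    qed
  qed
  let ?Y = "case_prod vpair ` (set_of ` Pow (case_prod vpair ` (elts b \<times> elts b)) \<times> elts b)"
  have "small ?Y"
    by (intro small_times small_image_set_of_Pow small_elts)
  then obtain Y where Y: "elts Y = ?Y" by (rule smallE)
  obtain f and y :: 'v where y: "elts y = f ` elts Y"
    and f: "\<forall>u \<in> elts Y. elts (f u) = f ` {v \<in> elts Y. (v, u) \<in> (\<Union>R \<in> W. rel R)}"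
    using mostowski[OF \<open>wf (\<Union>R \<in> W. rel R)\<close>, of Y] by (elim exE conjE)
  have "x \<in> elts y" if "trcl x \<lesssim> elts b" for x
  proof -
    define T where "T = insert x (trcl x)"
    have "T \<lesssim> elts b"
      unfolding T_def using inf that by (rule lepoll_insert)
    then obtain h where h: "inj_on h T" "h ` T \<subseteq> elts b"
      unfolding lepoll_def by blast
    have tr: "elts w \<subseteq> T" if "w \<in> T" for w
      using that elts_subset_trcl[of x] trcl_transitive[of w x] unfolding T_def by auto
    define R where "R = {(h u, h v) | u v. u \<in> T \<and> v \<in> T \<and> u \<in> elts v}"
    have "wf R"
    proof (rule wf_subset)
      show "wf (inv_image {(x, y). x \<in> elts y} (the_inv_into T h))"
        using foundation by (rule wf_inv_image)
      show "R \<subseteq> inv_image {(x, y). x \<in> elts y} (the_inv_into T h)"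
        using h by (auto simp: R_def inv_image_def the_inv_into_f_f)
    qed
    moreover have "R \<subseteq> elts b \<times> elts b"
      using h by (auto simp: R_def)
    ultimately have RW: "R \<in> W" by (simp add: W_def)
    have inY: "vpair (Q R) (h w) \<in> elts Y" if "w \<in> T" for w
    proof -
      have "case_prod vpair ` R \<in> Pow (case_prod vpair ` (elts b \<times> elts b))"
        using \<open>R \<subseteq> elts b \<times> elts b\<close> by blast
      then have "(Q R, h w) \<in> set_of ` Pow (case_prod vpair ` (elts b \<times> elts b)) \<times> elts b"
        unfolding Q_def using that h(2) by blast
      then have "case_prod vpair (Q R, h w) \<in> elts Y" unfolding Y by (rule imageI)
      then show ?thesis by simp
    qed
    \<comment> \<open>The tags exclude predecessors from other copies. As \<open>R\<close> copies
      membership on the transitive set \<open>T\<close>, the collapse undoes the copying, which the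
      induction below verifies.\<close>
    have pred: "(v, vpair (Q R) (h w)) \<in> (\<Union>R \<in> W. rel R) \<longleftrightarrow>
        (\<exists>w' \<in> elts w. v = vpair (Q R) (h w'))" if "w \<in> T" for v w
    proof
      assume "(v, vpair (Q R) (h w)) \<in> (\<Union>R \<in> W. rel R)"
      then obtain R' u u' where R': "R' \<in> W" "(u, u') \<in> R'" "v = vpair (Q R') u"
          "vpair (Q R) (h w) = vpair (Q R') u'"
        unfolding rel_def by auto
      then have "Q R' = Q R" "h w = u'" by simp_all
      moreover have "R' = R"
        using Q_inj[of R' R] R'(1) RW \<open>Q R' = Q R\<close> unfolding W_def by blast
      ultimately have "(u, h w) \<in> R" "v = vpair (Q R) u" using R' by simp_all
      then obtain p q where pq: "p \<in> T" "q \<in> T" "p \<in> elts q" "u = h p" "h w = h q"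
        unfolding R_def by blast
      moreover have "w = q" using inj_onD[OF h(1) pq(5) that pq(2)] .
      ultimately show "\<exists>w' \<in> elts w. v = vpair (Q R) (h w')"
        using \<open>v = vpair (Q R) u\<close> by blast
    next
      assume "\<exists>w' \<in> elts w. v = vpair (Q R) (h w')"
      then obtain w' where "w' \<in> elts w" "v = vpair (Q R) (h w')" by blast
      then have "(h w', h w) \<in> R" using tr[OF that] that unfolding R_def by auto
      then show "(v, vpair (Q R) (h w)) \<in> (\<Union>R \<in> W. rel R)"
        using RW \<open>v = _\<close> unfolding rel_def by (auto intro!: bexI[of _ R] rev_image_eqI)
    qed
    have "w \<in> T \<Longrightarrow> f (vpair (Q R) (h w)) = w" for w
    proof (induction w rule: elts_induct)
      case (step w)
      have "{v \<in> elts Y. (v, vpair (Q R) (h w)) \<in> (\<Union>R \<in> W. rel R)} =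
          (\<lambda>w'. vpair (Q R) (h w')) ` elts w"
        using pred[OF step.prems] inY tr[OF step.prems] by blast
      then have "elts (f (vpair (Q R) (h w))) = (\<lambda>w'. f (vpair (Q R) (h w'))) ` elts w"
        using bspec[OF f inY[OF step.prems]] by (simp only: image_image)
      also have "\<dots> = elts w"
        using step.IH tr[OF step.prems] by (auto simp: image_iff subset_iff)
      finally show ?case by (rule extensionality)
    qed
    then have "f (vpair (Q R) (h x)) = x" by (simp add: T_def)
    then show ?thesis
      unfolding y using inY[of x] by (metis T_def image_eqI insertI1)
  qed
  then have "HB (elts b) \<subseteq> elts y" by (auto simp: HB_def)
  then show ?thesis using small_elts small_subset by blast
qed

lemma HB_mem: "x \<in> HB B \<Longrightarrow> y \<in> elts x \<Longrightarrow> y \<in> HB B"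
  unfolding HB_def using trcl_mono lepoll_trans subset_imp_lepoll by blast

lemma small_if_HB:
  fixes b :: "'v::set_universe" and A :: "'v set"
  assumes "infinite (elts b)" "A \<subseteq> HB (elts b)"
  shows "small A"
  using small_HB[OF assms(1)] assms(2) by (rule small_subset)

text \<open>The transitive closure of the new set consists of \<open>A\<close> and of at most
  \<open>|b|\<close> sets of size at most \<open>|b|\<close>. Images under a recursion are shown to
  be sets by keeping all values in one \<open>HB (elts b)\<close>.\<close>

lemma set_of_HB:
  fixes b :: "'v::set_universe" and A :: "'v set"
  assumes "infinite (elts b)" "A \<subseteq> HB (elts b)" "A \<lesssim> elts b"
  shows "set_of A \<in> HB (elts b)"
proof -
  have "trcl (set_of A) = A \<union> (\<Union>a \<in> A. trcl a)"
    using trcl_unfold[of "set_of A"] small_if_HB[OF assms(1,2)] by simp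
  moreover have "(\<Union>a \<in> A. trcl a) \<lesssim> elts b"
    using assms by (intro lepoll_UN) (auto simp: HB_def)
  ultimately show ?thesis
    using assms lepoll_Un unfolding HB_def by auto
qed

lemma vpair_HB:
  fixes b x y :: "'v::set_universe"
  assumes "infinite (elts b)" "x \<in> HB (elts b)" "y \<in> HB (elts b)"
  shows "vpair x y \<in> HB (elts b)"
proof -
  have "finite A \<Longrightarrow> A \<subseteq> HB (elts b) \<Longrightarrow> set_of A \<in> HB (elts b)" for A :: "'v set"
    using set_of_HB[OF assms(1)] finite_lepoll_infinite[OF assms(1)] by blast
  then show ?thesis using assms unfolding vpair_def by simp
qed

lemma ex_HB:
  fixes x :: "'v::set_universe"
  shows "\<exists>b. infinite (elts b) \<and> elts x \<subseteq> elts b \<and> x \<in> HB (elts b) \<and> elts x \<subseteq> HB (elts b)"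
proof -
  obtain t where t: "x \<in> elts t" "\<forall>z \<in> elts t. elts z \<subseteq> elts t"
    using ex_transitive_elts by blast
  obtain i :: 'v where i: "infinite (elts i)" using infinity by blast
  define b where "b = set_of (elts t \<union> elts i)"
  have b: "elts b = elts t \<union> elts i" unfolding b_def by (simp add: small_Un)
  have "trcl x \<subseteq> elts t" using t by (intro trcl_subset) auto
  then have "x \<in> HB (elts b)"
    unfolding HB_def using b by (auto intro!: subset_imp_lepoll)
  then show ?thesis using b i t HB_mem by (intro exI[of _ b]) auto
qed

lemma ex_HB_small:
  fixes A :: "'v::set_universe set"
  assumes "small A"
  shows "\<exists>b::'v. infinite (elts b) \<and> A \<subseteq> elts b \<and> A \<subseteq> HB (elts b)"
  using ex_HB[of "set_of A"] assms by auto

lemma collapse_in_HB: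
  assumes "infinite (elts b)" "\<And>z. z \<in> elts t \<Longrightarrow> elts z \<subseteq> elts t" "elts t \<subseteq> elts b"
  shows "x \<in> elts t \<Longrightarrow> collapse M x \<in> HB (elts b)"
proof (induction x rule: elts_induct)
  case (step x)
  have "elts x \<inter> M \<lesssim> elts b"
    using step.prems assms by (intro subset_imp_lepoll) blast
  then show ?case
    using step assms
    by (subst collapse.simps) (intro set_of_HB, auto intro: lepoll_image)
qed

text \<open>The defining equation goes through \<open>set_of\<close> and says nothing about elements
  until the image is known to be a set. Collapsing never increases the number of elements, so its
  values over a transitive set stay in one \<open>HB (elts b)\<close>.\<close>

lemma elts_collapse: "elts (collapse M x) = collapse M ` (elts x \<inter> M)"
proof -
  obtain t where t: "x \<in> elts t" "\<forall>z \<in> elts t. elts z \<subseteq> elts t"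
    using ex_transitive_elts by blast
  obtain b where b: "infinite (elts b)" "elts t \<subseteq> elts b"
    using ex_HB by blast
  have "collapse M ` (elts x \<inter> M) \<subseteq> HB (elts b)"
    using collapse_in_HB[of b t _ M] t b by auto
  then have "small (collapse M ` (elts x \<inter> M))"
    using b small_if_HB by blast
  then show ?thesis by (subst collapse.simps) simp
qed

text \<open>As for \<open>collapse\<close>, except that each element is paired with all conditions,
  so \<open>b\<close> has to be as large as \<open>P\<close>, too.\<close>

lemma elts_check_name:
  fixes P :: "'v::set_universe set"
  assumes "small P"
  shows "elts (check_name P x) = (\<Union>y \<in> elts x. vpair (check_name P y) ` P)"
proof -
  obtain t where t: "x \<in> elts t" "\<forall>z \<in> elts t. elts z \<subseteq> elts t"
    using ex_transitive_elts by blast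
  obtain b where b: "infinite (elts b)" "elts t \<union> P \<subseteq> elts b" "elts t \<union> P \<subseteq> HB (elts b)"
    using ex_HB_small[OF small_Un[OF small_elts[of t] assms]] by blast
  have *: "vpair (check_name P y) ` P \<subseteq> HB (elts b)" if "check_name P y \<in> HB (elts b)" for y
    using that b vpair_HB by blast
  have "y \<in> elts t \<Longrightarrow> check_name P y \<in> HB (elts b)" for y
  proof (induction y rule: elts_induct)
    case (step y)
    have "elts y \<lesssim> elts b" "P \<lesssim> elts b"
      using step.prems t b by (auto intro!: subset_imp_lepoll)
    then have "(\<Union>z \<in> elts y. vpair (check_name P z) ` P) \<lesssim> elts b"
      using b by (intro lepoll_UN lepoll_image)
    moreover have "(\<Union>z \<in> elts y. vpair (check_name P z) ` P) \<subseteq> HB (elts b)"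
      using step t * by blast
    ultimately show ?case
      using b by (subst check_name.simps) (intro set_of_HB)
  qed
  then have "(\<Union>y \<in> elts x. vpair (check_name P y) ` P) \<subseteq> HB (elts b)"
    using * t by blast
  then have "small (\<Union>y \<in> elts x. vpair (check_name P y) ` P)"
    using b small_if_HB by blast
  then show ?thesis by (subst check_name.simps) simp
qed

section \<open>Ordinals\<close>

lemma Ord_in: "Ord \<alpha> \<Longrightarrow> \<beta> \<in> elts \<alpha> \<Longrightarrow> Ord \<beta>"
  unfolding Ord_def by blast

lemma Ord_subset: "Ord \<alpha> \<Longrightarrow> \<beta> \<in> elts \<alpha> \<Longrightarrow> elts \<beta> \<subseteq> elts \<alpha>"
  unfolding Ord_def by blast

lemma Ord_trans: "Ord \<alpha> \<Longrightarrow> \<beta> \<in> elts \<alpha> \<Longrightarrow> \<gamma> \<in> elts \<beta> \<Longrightarrow> \<gamma> \<in> elts \<alpha>"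
  unfolding Ord_def by blast

lemma Ord_I: "(\<And>\<beta>. \<beta> \<in> elts \<alpha> \<Longrightarrow> Ord \<beta>) \<Longrightarrow> (\<And>\<beta>. \<beta> \<in> elts \<alpha> \<Longrightarrow> elts \<beta> \<subseteq> elts \<alpha>) \<Longrightarrow> Ord \<alpha>"
  unfolding Ord_def by blast

lemma Ord_linear:
  fixes \<alpha> \<beta> :: "'v::set_universe"
  shows "Ord \<alpha> \<Longrightarrow> Ord \<beta> \<Longrightarrow> \<alpha> \<in> elts \<beta> \<or> \<alpha> = \<beta> \<or> \<beta> \<in> elts \<alpha>"
proof (induction \<alpha> arbitrary: \<beta> rule: elts_induct)
  case outer: (step \<alpha>)
  show ?case
    using outer.prems(2)
  proof (induction \<beta> rule: elts_induct)
    case inner: (step \<beta>)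
    show ?case
    proof (rule ccontr)
      assume neg: "\<not> (\<alpha> \<in> elts \<beta> \<or> \<alpha> = \<beta> \<or> \<beta> \<in> elts \<alpha>)"
      have "elts \<alpha> = elts \<beta>"
      proof (intro equalityI subsetI)
        fix \<xi> assume \<xi>: "\<xi> \<in> elts \<alpha>"
        then have "\<xi> \<in> elts \<beta> \<or> \<xi> = \<beta> \<or> \<beta> \<in> elts \<xi>"
          using outer.IH Ord_in[OF outer.prems(1)] inner.prems by blast
        then show "\<xi> \<in> elts \<beta>" using neg \<xi> Ord_trans[OF outer.prems(1)] by blast
      next
        fix \<xi> assume \<xi>: "\<xi> \<in> elts \<beta>"
        then have "\<alpha> \<in> elts \<xi> \<or> \<alpha> = \<xi> \<or> \<xi> \<in> elts \<alpha>"
          using inner.IH Ord_in[OF inner.prems] by blast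
        then show "\<xi> \<in> elts \<alpha>" using neg \<xi> Ord_trans[OF inner.prems] by blast
      qed
      then show False using neg extensionality by blast
    qed
  qed
qed

lemma Ord_not_in_iff: "Ord \<alpha> \<Longrightarrow> Ord \<beta> \<Longrightarrow> \<alpha> \<notin> elts \<beta> \<longleftrightarrow> elts \<beta> \<subseteq> elts \<alpha>"
  using Ord_linear[of \<alpha> \<beta>] Ord_subset[of \<alpha> \<beta>] elts_irrefl[of \<alpha>] by blast

lemma Ord_subset_iff: "Ord \<alpha> \<Longrightarrow> Ord \<beta> \<Longrightarrow> elts \<alpha> \<subseteq> elts \<beta> \<longleftrightarrow> \<alpha> \<in> elts \<beta> \<or> \<alpha> = \<beta>"
  using Ord_linear[of \<alpha> \<beta>] Ord_subset[of \<beta> \<alpha>] elts_irrefl[of \<beta>] by blast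

lemma Ord_subset_trans: "Ord \<gamma> \<Longrightarrow> Ord \<alpha> \<Longrightarrow> elts \<alpha> \<subseteq> elts \<beta> \<Longrightarrow> Ord \<beta> \<Longrightarrow> \<beta> \<in> elts \<gamma> \<Longrightarrow> \<alpha> \<in> elts \<gamma>"
  using Ord_subset_iff[of \<alpha> \<beta>] Ord_trans[of \<gamma> \<beta> \<alpha>] by blast

lemma Ord_set_of:
  assumes "small A" "\<And>\<alpha>. \<alpha> \<in> A \<Longrightarrow> Ord \<alpha>" "\<And>\<alpha>. \<alpha> \<in> A \<Longrightarrow> elts \<alpha> \<subseteq> A"
  shows "Ord (set_of A)"
  by (rule Ord_I) (use assms in simp_all)

lemma trcl_Ord: "Ord \<alpha> \<Longrightarrow> trcl \<alpha> = elts \<alpha>"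
  using trcl_subset[of "elts \<alpha>" \<alpha>] elts_subset_trcl[of \<alpha>] Ord_subset[of \<alpha>] by blast

lemma Ord_least:
  fixes \<alpha> :: "'v::set_universe"
  shows "Ord \<alpha> \<Longrightarrow> P \<alpha> \<Longrightarrow> \<exists>\<beta>. Ord \<beta> \<and> P \<beta> \<and> (\<forall>\<xi> \<in> elts \<beta>. \<not> P \<xi>)"
proof (induction \<alpha> rule: elts_induct)
  case (step \<alpha>)
  show ?case
  proof (cases "\<exists>\<xi> \<in> elts \<alpha>. P \<xi>")
    case True
    then show ?thesis using step.IH Ord_in[OF step.prems(1)] by blast
  next
    case False
    then show ?thesis using step.prems by blast
  qed
qed

lemma elts_least:
  fixes \<alpha> :: "'v::set_universe"
  assumes "Ord \<alpha>" "A \<subseteq> elts \<alpha>" "A \<noteq> {}"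
  shows "\<exists>\<beta> \<in> A. \<forall>\<xi> \<in> A. \<xi> \<notin> elts \<beta>"
proof -
  obtain a where a: "a \<in> A" using assms(3) by blast
  have "Ord a" using a Ord_in[OF assms(1)] assms(2) by blast
  from Ord_least[of a "\<lambda>x. x \<in> A", OF this a] show ?thesis by blast
qed

text \<open>For a property inherited by subsets, such as being finite, countable, or of size at most
  omega1, the ordinals with \<open>Q\<close> form the least ordinal without it. One argument thus
  serves omega, omega1 and omega2.\<close>

definition initial :: "('v::set_universe set \<Rightarrow> bool) \<Rightarrow> 'v set" where
  "initial Q = {\<alpha>. Ord \<alpha> \<and> Q (elts \<alpha>)}"

context
  fixes Q :: "'v::set_universe set \<Rightarrow> bool"
  assumes small_E: "small (initial Q)"
    and Q_subset: "\<forall>A B. A \<subseteq> B \<longrightarrow> Q B \<longrightarrow> Q A"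
begin

lemma Ord_initial: "Ord (set_of (initial Q))"
proof (rule Ord_set_of)
  show "small (initial Q)" by (rule small_E)
  show "Ord \<alpha>" if "\<alpha> \<in> initial Q" for \<alpha> using that unfolding initial_def by simp
  show "elts \<alpha> \<subseteq> initial Q" if "\<alpha> \<in> initial Q" for \<alpha>
    using that Ord_in[of \<alpha>] Ord_subset[of \<alpha>] Q_subset unfolding initial_def by blast
qed

text \<open>Burali-Forti: otherwise this ordinal would be an element of itself.\<close>

lemma initial_not: "\<not> Q (initial Q)"
proof
  assume "Q (initial Q)"
  then have "set_of (initial Q) \<in> initial Q"
    using Ord_initial elts_set_of_small[OF small_E] by (simp add: initial_def)
  then show False
    using elts_irrefl[of "set_of (initial Q)"] elts_set_of_small[OF small_E] by simp
qed

lemma The_initial: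
  "(THE \<alpha>. Ord \<alpha> \<and> \<not> Q (elts \<alpha>) \<and> (\<forall>\<beta> \<in> elts \<alpha>. Q (elts \<beta>))) = set_of (initial Q)"
proof (rule the_equality)
  have E: "elts (set_of (initial Q)) = initial Q" using small_E by simp
  show "Ord (set_of (initial Q)) \<and> \<not> Q (elts (set_of (initial Q))) \<and> (\<forall>\<beta> \<in> elts (set_of (initial Q)). Q (elts \<beta>))"
    using Ord_initial initial_not unfolding E by (auto simp: initial_def)
  fix \<alpha> :: 'v assume \<alpha>: "Ord \<alpha> \<and> \<not> Q (elts \<alpha>) \<and> (\<forall>\<beta> \<in> elts \<alpha>. Q (elts \<beta>))"
  have "\<alpha> \<notin> elts (set_of (initial Q))" unfolding E using \<alpha> by (simp add: initial_def)
  moreover have "set_of (initial Q) \<notin> elts \<alpha>" using \<alpha> initial_not E by auto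
  ultimately show "\<alpha> = set_of (initial Q)" using Ord_linear[of \<alpha> "set_of (initial Q)"] \<alpha> Ord_initial by blast
qed

text \<open>The union in the assumption is the least strict upper bound of \<open>A\<close>, and
  with \<open>Q\<close> it belongs to \<open>initial Q\<close>. The regularity of omega1 and omega2
  follows from this.\<close>

lemma initial_bounded:
  assumes "A \<subseteq> initial Q" "Q (\<Union>\<alpha> \<in> A. insert \<alpha> (elts \<alpha>))"
  shows "\<exists>\<beta> \<in> initial Q. A \<subseteq> elts \<beta>"
proof -
  let ?B = "\<Union>\<alpha> \<in> A. insert \<alpha> (elts \<alpha>)"
  have "elts \<alpha> \<subseteq> initial Q" if "\<alpha> \<in> initial Q" for \<alpha>
    using that Ord_in[of \<alpha>] Ord_subset[of \<alpha>] Q_subset unfolding initial_def by blast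
  then have sub: "?B \<subseteq> initial Q" using assms(1) by blast
  then have sm: "small ?B" using small_subset[OF small_E] by blast
  have "Ord (set_of ?B)"
  proof (rule Ord_set_of[OF sm])
    show "Ord \<beta>" if "\<beta> \<in> ?B" for \<beta> using that sub unfolding initial_def by blast
    show "elts \<beta> \<subseteq> ?B" if \<beta>: "\<beta> \<in> ?B" for \<beta>
    proof -
      obtain \<alpha> where "\<alpha> \<in> A" "\<beta> \<in> insert \<alpha> (elts \<alpha>)" using \<beta> by blast
      moreover have "Ord \<alpha>" using \<open>\<alpha> \<in> A\<close> assms(1) unfolding initial_def by blast
      ultimately have "elts \<beta> \<subseteq> elts \<alpha>" using Ord_subset[of \<alpha> \<beta>] by blast
      then show ?thesis using \<open>\<alpha> \<in> A\<close> by blast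
    qed
  qed
  then have "set_of ?B \<in> initial Q" using sm assms(2) unfolding initial_def by simp
  then show ?thesis using sm by (intro bexI[of _ "set_of ?B"]) auto
qed

end

section \<open>The ordinals omega, omega1 and omega2\<close>

lemma finite_down: "\<forall>A B. A \<subseteq> B \<longrightarrow> finite B \<longrightarrow> finite A"
  by (auto intro: finite_subset)

lemma countable_down: "\<forall>A B. A \<subseteq> B \<longrightarrow> countable B \<longrightarrow> countable A"
  by (auto intro: countable_subset)

lemma lepoll_subset: "A \<subseteq> B \<Longrightarrow> B \<lesssim> C \<Longrightarrow> A \<lesssim> C"
  by (rule lepoll_trans[OF subset_imp_lepoll])

lemma lepoll_down: "\<forall>A B. A \<subseteq> B \<longrightarrow> B \<lesssim> C \<longrightarrow> A \<lesssim> C"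
  by (auto intro: lepoll_subset)

text \<open>Hartogs's theorem: an ordinal is its own transitive closure, so those of size at most
  \<open>|b|\<close> lie in \<open>HB (elts b)\<close>.\<close>

lemma small_initial_lepoll:
  fixes b :: "'v::set_universe"
  assumes "infinite (elts b)"
  shows "small (initial (\<lambda>A :: 'v set. A \<lesssim> elts b))"
  by (rule small_if_HB[OF assms]) (auto simp: HB_def trcl_Ord initial_def)

lemma small_initial_countable: "small (initial (countable :: 'v::set_universe set \<Rightarrow> bool))"
proof -
  obtain b :: 'v where b: "infinite (elts b)" using infinity by blast
  show ?thesis
    using countable_lepoll_infinite[OF _ b]
    by (intro small_subset[OF small_initial_lepoll[OF b]]) (auto simp: initial_def)
qed

lemma small_initial_finite: "small (initial (finite :: 'v::set_universe set \<Rightarrow> bool))"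
  by (rule small_subset[OF small_initial_countable]) (auto simp: initial_def countable_finite)

abbreviation W1 :: "'v::set_universe set" where "W1 \<equiv> elts omega1"
abbreviation W2 :: "'v::set_universe set" where "W2 \<equiv> elts omega2"

lemma omega_eq: "omega = set_of (initial finite)"
  using The_initial[OF small_initial_finite finite_down] unfolding omega_def .

lemma elts_omega: "elts omega = {\<alpha> :: 'v::set_universe. Ord \<alpha> \<and> finite (elts \<alpha>)}"
  unfolding omega_eq elts_set_of_small[OF small_initial_finite] by (rule initial_def)

lemma Ord_omega: "Ord omega"
  unfolding omega_eq by (rule Ord_initial[OF small_initial_finite finite_down])

lemma infinite_omega: "infinite (elts omega)"
  unfolding omega_eq elts_set_of_small[OF small_initial_finite]
  by (rule initial_not[OF small_initial_finite finite_down])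

lemma omega1_eq: "omega1 = set_of (initial countable)"
  using The_initial[OF small_initial_countable countable_down] unfolding omega1_def .

lemma elts_omega1: "W1 = {\<alpha> :: 'v::set_universe. Ord \<alpha> \<and> countable (elts \<alpha>)}"
  unfolding omega1_eq elts_set_of_small[OF small_initial_countable] by (rule initial_def)

lemma Ord_omega1: "Ord omega1"
  unfolding omega1_eq by (rule Ord_initial[OF small_initial_countable countable_down])

lemma uncountable_omega1: "uncountable W1"
  unfolding omega1_eq elts_set_of_small[OF small_initial_countable]
  by (rule initial_not[OF small_initial_countable countable_down])

lemma infinite_omega1: "infinite W1"
  using uncountable_omega1 countable_finite by blast

lemma countable_lepoll_omega1: "countable A \<Longrightarrow> A \<lesssim> W1"
  using countable_lepoll_infinite[OF _ infinite_omega1] .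

lemma omega1_bounded:
  fixes A :: "'v::set_universe set"
  assumes "A \<subseteq> W1" "countable A"
  shows "\<exists>\<beta> \<in> W1. A \<subseteq> elts \<beta>"
proof -
  have W1: "(W1 :: 'v set) = initial countable" by (simp add: elts_omega1 initial_def)
  have "countable (\<Union>\<alpha> \<in> A. insert \<alpha> (elts \<alpha>))"
    using assms by (intro countable_UN countable_insert) (auto simp: elts_omega1)
  with assms(1) show ?thesis
    unfolding W1 by (intro initial_bounded[OF small_initial_countable countable_down])
qed

lemma lesspoll_iff_not_lepoll: "A \<prec> B \<longleftrightarrow> \<not> B \<lesssim> A"
proof -
  have "A \<lesssim> B \<or> B \<lesssim> A"
    using ordLeq_total[OF card_of_Well_order card_of_Well_order, of A B]
    unfolding lepoll_def card_of_ordLeq .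
  then show ?thesis
    using lepoll_antisym[of A B] eqpoll_imp_lepoll[of B A] eqpoll_sym[of A B]
    unfolding lesspoll_def by blast
qed

lemmas initial_omega2 = small_initial_lepoll[OF infinite_omega1] lepoll_down[of "elts omega1"]

lemma omega2_eq: "omega2 = set_of (initial (\<lambda>A :: 'v::set_universe set. A \<lesssim> (W1 :: 'v set)))"
  using The_initial[OF initial_omega2] unfolding omega2_def lesspoll_iff_not_lepoll .

lemma elts_omega2: "W2 = {\<alpha> :: 'v::set_universe. Ord \<alpha> \<and> elts \<alpha> \<lesssim> (W1 :: 'v set)}"
  unfolding omega2_eq elts_set_of_small[OF initial_omega2(1)] by (rule initial_def)

lemma Ord_omega2: "Ord omega2"
  unfolding omega2_eq by (rule Ord_initial[OF initial_omega2])

lemma omega2_bounded: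
  fixes A :: "'v::set_universe set"
  assumes "A \<subseteq> W2" "A \<lesssim> (W1 :: 'v set)"
  shows "\<exists>\<beta> \<in> W2. A \<subseteq> elts \<beta>"
proof -
  have W2: "(W2 :: 'v set) = initial (\<lambda>A. A \<lesssim> (W1 :: 'v set))" by (simp add: elts_omega2 initial_def)
  have "(\<Union>\<alpha> \<in> A. insert \<alpha> (elts \<alpha>)) \<lesssim> (W1 :: 'v set)"
    using assms infinite_omega1 by (intro lepoll_UN lepoll_insert) (auto simp: elts_omega2)
  with assms(1) show ?thesis
    unfolding W2 by (intro initial_bounded[OF initial_omega2])
qed

lemma omega2_bounded_countable:
  fixes A :: "'v::set_universe set"
  assumes "A \<subseteq> W2" "countable A"
  shows "\<exists>\<beta> \<in> W2. A \<subseteq> elts \<beta>"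
  by (rule omega2_bounded[OF assms(1) countable_lepoll_omega1[OF assms(2)]])

lemma omega1_subset_omega2: "(W1 :: 'v::set_universe set) \<subseteq> W2"
  using countable_lepoll_omega1 by (auto simp: elts_omega1 elts_omega2)

lemma omega_subset_omega1: "elts omega \<subseteq> W1"
  using countable_finite by (auto simp: elts_omega1 elts_omega)

subsection \<open>Transitive collapses\<close>

lemma collapse_mem: "\<xi> \<in> M \<Longrightarrow> \<xi> \<in> elts \<alpha> \<Longrightarrow> collapse M \<xi> \<in> elts (collapse M \<alpha>)"
  by (auto simp: elts_collapse)

lemma Ord_collapse: "Ord \<alpha> \<Longrightarrow> Ord (collapse M \<alpha>)"
proof (induction \<alpha> rule: elts_induct)
  case (step \<alpha>)
  show ?case
  proof (rule Ord_I)
    fix \<beta> assume "\<beta> \<in> elts (collapse M \<alpha>)"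
    then obtain \<xi> where \<xi>: "\<xi> \<in> elts \<alpha>" "\<xi> \<in> M" "\<beta> = collapse M \<xi>" by (auto simp: elts_collapse)
    then show "Ord \<beta>" using step.IH[of \<xi>] Ord_in[OF step.prems] by blast
    show "elts \<beta> \<subseteq> elts (collapse M \<alpha>)"
      using \<xi> Ord_trans[OF step.prems] by (auto simp: elts_collapse)
  qed
qed

text \<open>\<open>M\<close> is arbitrary and may fail to be extensional; on ordinals, injectivity
  comes from their linear order, because the collapse preserves membership.\<close>

lemma collapse_inj:
  assumes "Ord \<alpha>" "Ord \<beta>" "\<alpha> \<in> M" "\<beta> \<in> M" "collapse M \<alpha> = collapse M \<beta>"
  shows "\<alpha> = \<beta>"
  using Ord_linear[OF assms(1,2)] collapse_mem[of \<alpha> M \<beta>] collapse_mem[of \<beta> M \<alpha>] assms by auto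

text \<open>Only the smaller side is taken from \<open>M\<close>, so that members of
  \<open>M\<close> can be compared with a bound outside of it, such as \<open>\<zeta> 0\<close> in
  the decoding.\<close>

lemma collapse_mem_iff:
  assumes "Ord \<alpha>" "Ord \<beta>" "\<alpha> \<in> M"
  shows "collapse M \<alpha> \<in> elts (collapse M \<beta>) \<longleftrightarrow> \<alpha> \<in> elts \<beta>"
proof
  assume "collapse M \<alpha> \<in> elts (collapse M \<beta>)"
  then obtain \<xi> where "\<xi> \<in> elts \<beta>" "\<xi> \<in> M" "collapse M \<alpha> = collapse M \<xi>"
    by (auto simp: elts_collapse)
  then show "\<alpha> \<in> elts \<beta>" using collapse_inj[of \<alpha> \<xi> M] assms Ord_in[OF assms(2)] by blast
qed (use assms collapse_mem[of \<alpha> M \<beta>] in blast)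

lemma collapse_subset: "Ord \<alpha> \<Longrightarrow> elts (collapse M \<alpha>) \<subseteq> elts \<alpha>"
proof (induction \<alpha> rule: elts_induct)
  case (step \<alpha>)
  have "collapse M \<xi> \<in> elts \<alpha>" if "\<xi> \<in> elts \<alpha>" for \<xi>
    using that step Ord_in[of \<alpha> \<xi>] Ord_collapse[of \<xi> M] Ord_subset_trans[of \<alpha> "collapse M \<xi>" \<xi>] by blast
  then show ?case by (auto simp: elts_collapse)
qed

lemma collapse_cong:
  "(\<And>z. z \<in> T \<Longrightarrow> elts z \<subseteq> T) \<Longrightarrow> M \<inter> T = M' \<inter> T \<Longrightarrow> x \<in> T \<Longrightarrow> collapse M x = collapse M' x"
proof (induction x rule: elts_induct)
  case (step x)
  then have "elts x \<subseteq> T" by blast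
  then have "elts x \<inter> M = elts x \<inter> M'" using step.prems by blast
  moreover have "collapse M y = collapse M' y" if "y \<in> elts x" for y
    using step that \<open>elts x \<subseteq> T\<close> by blast
  ultimately show ?case
    by (intro extensionality) (simp add: elts_collapse)
qed

lemma collapse_id: "(\<And>z. z \<in> T \<Longrightarrow> elts z \<subseteq> T) \<Longrightarrow> T \<subseteq> M \<Longrightarrow> x \<in> T \<Longrightarrow> collapse M x = x"
proof (induction x rule: elts_induct)
  case (step x)
  then have "elts x \<subseteq> T" "elts x \<inter> M = elts x" by blast+
  moreover have "collapse M y = y" if "y \<in> elts x" for y
    using step that \<open>elts x \<subseteq> T\<close> by blast
  ultimately show ?case
    by (intro extensionality) (simp add: elts_collapse)
qed

lemma collapse_id_subset:
  assumes "\<And>z. z \<in> T \<Longrightarrow> elts z \<subseteq> T" "T \<subseteq> M" "elts x \<subseteq> T"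
  shows "collapse M x = x"
proof (rule extensionality)
  have "collapse M y = y" if "y \<in> T" for y
    using collapse_id[of T M y] assms that by blast
  then have "collapse M ` elts x = (\<lambda>y. y) ` elts x"
    using assms(3) by (intro image_cong) auto
  moreover have "elts x \<inter> M = elts x" using assms by blast
  ultimately show "elts (collapse M x) = elts x"
    by (simp add: elts_collapse)
qed

subsection \<open>Sizes\<close>

text \<open>\<open>size_less\<close> demands an exact equipollence with a member of \<kappa>,
  whereas bounds arise as injections into a member. In between stands the order type of the range of
  the injection, which \<open>collapse\<close> computes.\<close>

lemma lepoll_Ord:
  assumes "Ord \<beta>" "A \<lesssim> elts \<beta>"
  obtains \<mu> where "Ord \<mu>" "elts \<mu> \<subseteq> elts \<beta>" "A \<approx> elts \<mu>"
proof -
  obtain h where h: "inj_on h A" "h ` A \<subseteq> elts \<beta>" using assms(2) unfolding lepoll_def by blast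
  let ?B = "h ` A"
  have "inj_on (collapse ?B) ?B"
  proof (rule inj_onI)
    fix x y assume "x \<in> ?B" "y \<in> ?B" "collapse ?B x = collapse ?B y"
    then show "x = y"
      using collapse_inj[of x y ?B] Ord_in[OF assms(1)] h(2) by blast
  qed
  moreover have "elts (collapse ?B \<beta>) = collapse ?B ` ?B"
    using h(2) by (simp add: elts_collapse Int_absorb1)
  ultimately have "?B \<approx> elts (collapse ?B \<beta>)"
    using eqpoll_sym[OF inj_on_image_eqpoll_self] by metis
  then have "A \<approx> elts (collapse ?B \<beta>)"
    using eqpoll_trans[OF eqpoll_sym[OF inj_on_image_eqpoll_self[OF h(1)]]] by blast
  then show ?thesis
    using that[of "collapse ?B \<beta>"] Ord_collapse[OF assms(1)] collapse_subset[OF assms(1)] by blast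
qed

lemma size_lessI:
  assumes "Ord \<kappa>" "\<beta> \<in> elts \<kappa>" "A \<lesssim> elts \<beta>"
  shows "size_less A \<kappa>"
proof -
  have "Ord \<beta>" using Ord_in[OF assms(1,2)] .
  then obtain \<mu> where "Ord \<mu>" "elts \<mu> \<subseteq> elts \<beta>" "A \<approx> elts \<mu>"
    using assms(3) by (rule lepoll_Ord)
  then show ?thesis
    unfolding size_less_def using Ord_subset_trans[OF assms(1) _ _ \<open>Ord \<beta>\<close> assms(2), of \<mu>] by blast
qed

lemma size_lessE:
  assumes "size_less A \<kappa>"
  obtains \<beta> where "\<beta> \<in> elts \<kappa>" "A \<lesssim> elts \<beta>"
  using assms eqpoll_imp_lepoll unfolding size_less_def by blast

lemma size_less_subset:
  assumes "Ord \<kappa>" "size_less A \<kappa>" "B \<subseteq> A"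
  shows "size_less B \<kappa>"
proof -
  obtain \<beta> where "\<beta> \<in> elts \<kappa>" "A \<lesssim> elts \<beta>" using assms(2) by (rule size_lessE)
  then show ?thesis using size_lessI[OF assms(1)] lepoll_subset[OF assms(3)] by blast
qed

lemma H_mem: "Ord \<nu> \<Longrightarrow> x \<in> H \<nu> \<Longrightarrow> y \<in> elts x \<Longrightarrow> y \<in> H \<nu>"
  unfolding H_def using size_less_subset[of \<nu> "trcl x" "trcl y"] trcl_mono[of y x] by blast

lemma H_mono: "elts \<nu> \<subseteq> elts \<nu>' \<Longrightarrow> H \<nu> \<subseteq> H \<nu>'"
  unfolding H_def size_less_def by blast

lemma Ord_in_H: "Ord \<nu> \<Longrightarrow> \<alpha> \<in> elts \<nu> \<Longrightarrow> \<alpha> \<in> H \<nu>"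
  using trcl_Ord[of \<alpha>] Ord_in[of \<nu> \<alpha>] unfolding H_def size_less_def by auto

lemma small_H:
  fixes \<nu> :: "'v::set_universe"
  assumes "Ord \<nu>"
  shows "small (H \<nu>)"
proof -
  obtain b :: 'v where b: "infinite (elts b)" "elts \<nu> \<subseteq> elts b" using ex_HB by blast
  have "trcl x \<lesssim> elts b" if x: "x \<in> H \<nu>" for x
  proof -
    obtain \<beta> where "\<beta> \<in> elts \<nu>" "trcl x \<lesssim> elts \<beta>"
      using x unfolding H_def by (auto elim: size_lessE)
    moreover have "elts \<beta> \<subseteq> elts b" using Ord_subset[OF assms \<open>\<beta> \<in> elts \<nu>\<close>] b(2) by blast
    ultimately show ?thesis using lepoll_trans subset_imp_lepoll by blast
  qed
  then show ?thesis using small_if_HB[OF b(1), of "H \<nu>"] unfolding HB_def by blast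
qed

section \<open>Clubs of countable sets\<close>

lemma finite_subset_chain:
  fixes X :: "nat \<Rightarrow> 'a set"
  assumes "mono X"
  shows "finite s \<Longrightarrow> s \<subseteq> (\<Union>n. X n) \<Longrightarrow> \<exists>n. s \<subseteq> X n"
proof (induction s rule: finite_induct)
  case (insert a s)
  then obtain n m where n: "s \<subseteq> X n" "a \<in> X m" by auto
  have "X n \<subseteq> X (max n m)" "X m \<subseteq> X (max n m)"
    using assms by (auto simp: mono_def)
  then show ?case using n by (intro exI[of _ "max n m"]) blast
qed simp

text \<open>The values of \<open>G\<close> are sets rather than points, so that members of a club
  can themselves serve as values, as they do in \<open>club_generated\<close>.\<close>

definition closed_under :: "('a set \<Rightarrow> 'a set) \<Rightarrow> 'a set \<Rightarrow> bool" where
  "closed_under G x \<longleftrightarrow> (\<forall>s. finite s \<and> s \<subseteq> x \<longrightarrow> G s \<subseteq> x)"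

inductive_set Cl :: "('a set \<Rightarrow> 'a set) \<Rightarrow> 'a set \<Rightarrow> 'a set" for G X where
  base: "a \<in> X \<Longrightarrow> a \<in> Cl G X"
| step: "finite s \<Longrightarrow> \<forall>b \<in> s. b \<in> Cl G X \<Longrightarrow> a \<in> G s \<Longrightarrow> a \<in> Cl G X"

lemma Cl_subset: "X \<subseteq> Cl G X"
  by (auto intro: Cl.base)

lemma closed_under_Cl: "closed_under G (Cl G X)"
  unfolding closed_under_def by (auto intro: Cl.step)

lemma Cl_least: "X \<subseteq> Y \<Longrightarrow> closed_under G Y \<Longrightarrow> Cl G X \<subseteq> Y"
proof
  fix a assume "X \<subseteq> Y" "closed_under G Y" "a \<in> Cl G X"
  from this(3) show "a \<in> Y"
  proof induction
    case (base a)
    then show ?case using \<open>X \<subseteq> Y\<close> by blast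
  next
    case (step s a)
    then have "s \<subseteq> Y" by blast
    then show ?case using step.hyps \<open>closed_under G Y\<close> unfolding closed_under_def by blast
  qed
qed

lemma Cl_mono: "X \<subseteq> Y \<Longrightarrow> Cl G X \<subseteq> Cl G Y"
  using Cl_least[OF order_trans[OF _ Cl_subset] closed_under_Cl] .

lemma closed_under_chain:
  assumes "mono X" "\<And>n :: nat. closed_under G (X n)"
  shows "closed_under G (\<Union>n. X n)"
  unfolding closed_under_def
proof (intro allI impI)
  fix s assume "finite s \<and> s \<subseteq> (\<Union>n. X n)"
  then obtain n where "s \<subseteq> X n" using finite_subset_chain[OF assms(1)] by blast
  then have "G s \<subseteq> X n"
    using assms(2)[of n] \<open>finite s \<and> _\<close> unfolding closed_under_def by blast
  then show "G s \<subseteq> (\<Union>n. X n)" by blast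
qed

lemma Cl_chain:
  assumes "mono X"
  shows "Cl G (\<Union>n :: nat. X n) = (\<Union>n. Cl G (X n))"
proof
  have "mono (\<lambda>n. Cl G (X n))" by (intro monoI Cl_mono monoD[OF assms])
  then have "closed_under G (\<Union>n. Cl G (X n))" by (rule closed_under_chain[OF _ closed_under_Cl])
  then show "Cl G (\<Union>n. X n) \<subseteq> (\<Union>n. Cl G (X n))"
    by (rule Cl_least[OF UN_mono[OF order_refl Cl_subset]])
  show "(\<Union>n. Cl G (X n)) \<subseteq> Cl G (\<Union>n. X n)"
    by (intro UN_least Cl_mono UN_upper UNIV_I)
qed

lemma Cl_countable:
  assumes G: "\<And>s. finite s \<Longrightarrow> s \<subseteq> A \<Longrightarrow> countable (G s) \<and> G s \<subseteq> A"
    and X: "countable X" "X \<subseteq> A"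
  shows "countable (Cl G X) \<and> Cl G X \<subseteq> A"
proof -
  define F where "F Y = Y \<union> (\<Union>s \<in> {s. finite s \<and> s \<subseteq> Y}. G s)" for Y
  define Y where "Y n = (F ^^ n) X" for n
  have Y: "countable (Y n) \<and> Y n \<subseteq> A" for n
  proof (induction n)
    case (Suc n)
    have fin: "countable {s. finite s \<and> s \<subseteq> Y n}"
      using Suc by (intro countable_Collect_finite_subset) blast
    have Gs: "countable (G s)" "G s \<subseteq> A" if "s \<in> {s. finite s \<and> s \<subseteq> Y n}" for s
      using G[of s] that Suc by auto
    have "countable (F (Y n))"
      unfolding F_def using Suc by (intro countable_Un countable_UN[OF fin] Gs(1)) simp_all
    moreover have "F (Y n) \<subseteq> A"
      unfolding F_def using Suc by (intro Un_least UN_least Gs(2)) simp_all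
    ultimately show ?case by (simp add: Y_def)
  qed (use X in \<open>simp add: Y_def\<close>)
  have "Y n \<subseteq> Y (Suc n)" for n by (simp add: Y_def F_def)
  then have mono: "mono Y" by (simp add: mono_iff_le_Suc)
  have "closed_under G (\<Union>n. Y n)"
    unfolding closed_under_def
  proof (intro allI impI)
    fix s assume s: "finite s \<and> s \<subseteq> (\<Union>n. Y n)"
    then obtain n where "s \<subseteq> Y n" using finite_subset_chain[OF mono] by blast
    then have "G s \<subseteq> Y (Suc n)" using s by (auto simp: Y_def F_def)
    then show "G s \<subseteq> (\<Union>n. Y n)" by blast
  qed
  moreover have "X \<subseteq> (\<Union>n. Y n)" using UN_upper[of 0 UNIV Y] by (simp add: Y_def)
  ultimately have "Cl G X \<subseteq> (\<Union>n. Y n)" by (intro Cl_least)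
  moreover have "countable (\<Union>n. Y n)" "(\<Union>n. Y n) \<subseteq> A" using Y by blast+
  ultimately show ?thesis using countable_subset by blast
qed

section \<open>Clubs and their generating functions\<close>

lemma clubI:
  assumes "C \<subseteq> countable_subsets A"
    and "\<And>x. countable x \<Longrightarrow> x \<subseteq> A \<Longrightarrow> \<exists>y \<in> C. x \<subseteq> y"
    and "\<And>f :: nat \<Rightarrow> 'a set. mono f \<Longrightarrow> (\<And>n. f n \<in> C) \<Longrightarrow> (\<Union>n. f n) \<in> C"
  shows "club A (C :: 'a set set)"
  unfolding club_def
proof (intro conjI ballI allI impI)
  show "C \<subseteq> countable_subsets A" by (rule assms(1))
  show "\<exists>y \<in> C. x \<subseteq> y" if "x \<in> countable_subsets A" for x
    using that assms(2) unfolding countable_subsets_def by blast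
  show "\<Union> (range f) \<in> C" if "mono f \<and> range f \<subseteq> C" for f :: "nat \<Rightarrow> 'a set"
    using that assms(3)[of f] by blast
qed

lemma clubD:
  assumes "club A C"
  shows "x \<in> C \<Longrightarrow> countable x" "x \<in> C \<Longrightarrow> x \<subseteq> A"
    and "countable x \<Longrightarrow> x \<subseteq> A \<Longrightarrow> \<exists>y \<in> C. x \<subseteq> y"
    and "mono f \<Longrightarrow> (\<And>n :: nat. f n \<in> C) \<Longrightarrow> (\<Union>n. f n) \<in> C"
  using assms unfolding club_def countable_subsets_def by blast+

lemma club_closed_under:
  assumes "\<And>s. finite s \<Longrightarrow> s \<subseteq> A \<Longrightarrow> countable (G s) \<and> G s \<subseteq> A"
  shows "club A {x \<in> countable_subsets A. closed_under G x}"
proof (rule clubI)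
  show "\<exists>y \<in> {x \<in> countable_subsets A. closed_under G x}. x \<subseteq> y" if "countable x" "x \<subseteq> A" for x
    using Cl_countable[of A G x, OF assms that] closed_under_Cl[of G x] Cl_subset[of x G]
    by (intro bexI[of _ "Cl G x"]) (auto simp: countable_subsets_def)
  show "(\<Union>n. f n) \<in> {x \<in> countable_subsets A. closed_under G x}"
    if "mono f" "\<And>n. f n \<in> {x \<in> countable_subsets A. closed_under G x}" for f :: "nat \<Rightarrow> 'a set"
    using that closed_under_chain[of f G] by (auto simp: countable_subsets_def)
qed blast

text \<open>Each finite \<open>s\<close> is assigned a member \<open>K s\<close> of \<open>C\<close>
  that includes \<open>s\<close> and all \<open>K t\<close> for proper subsets \<open>t\<close>. A
  nonempty countable \<open>x\<close> closed under \<open>K\<close> is the union of the chain of the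
  \<open>K s\<close> along an enumeration of \<open>x\<close>, and so belongs to \<open>C\<close>.
  The inclusions between the values have to be arranged during the choice, hence the recursion along
  proper inclusion.\<close>

lemma club_generated:
  assumes "club A C"
  obtains G where "\<And>s. finite s \<Longrightarrow> s \<subseteq> A \<Longrightarrow> countable (G s) \<and> G s \<subseteq> A"
    and "\<And>x. countable x \<Longrightarrow> x \<subseteq> A \<Longrightarrow> closed_under G x \<Longrightarrow> x \<in> C"
proof -
  let ?P = "\<lambda>K s v. finite s \<and> s \<subseteq> A \<longrightarrow> v \<in> C \<and> s \<subseteq> v \<and> (\<forall>t. t \<subset> s \<longrightarrow> K t \<subseteq> v)"
  have "\<exists>K. \<forall>s. ?P K s (K s)"
  proof (rule dependent_wf_choice[OF wf_finite_psubset])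
    show "?P f s v = ?P g s v" if "\<And>z. (z, s) \<in> finite_psubset \<Longrightarrow> f z = g z" for f g s v
    proof (cases "finite s")
      case True
      then have "f t = g t" if "t \<subset> s" for t
        using \<open>\<And>z. (z, s) \<in> finite_psubset \<Longrightarrow> f z = g z\<close>[of t] that
        by (simp add: finite_psubset_def)
      then show ?thesis by (metis (no_types, lifting))
    qed simp
    show "\<exists>v. ?P K s v" if IH: "\<And>t. (t, s) \<in> finite_psubset \<Longrightarrow> ?P K t (K t)" for s K
    proof (cases "finite s \<and> s \<subseteq> A")
      case True
      have K: "K t \<in> C" if "t \<subset> s" for t
      proof -
        have "(t, s) \<in> finite_psubset" "finite t \<and> t \<subseteq> A"
          using True that finite_subset[of t s] by (auto simp: finite_psubset_def)
        then show ?thesis using IH[of t] by blast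
      qed
      have "finite {t. t \<subset> s}" using True finite_Pow_iff[of s] by (auto intro: rev_finite_subset)
      then have cnt: "countable (s \<union> (\<Union>t \<in> {t. t \<subset> s}. K t))"
        using True K clubD(1)[OF assms] by (intro countable_Un countable_UN) (auto intro: countable_finite)
      have "K t \<subseteq> A" if "t \<subset> s" for t
        using K[OF that] by (rule clubD(2)[OF assms])
      then have "s \<union> (\<Union>t \<in> {t. t \<subset> s}. K t) \<subseteq> A"
        using True by blast
      from clubD(3)[OF assms cnt this]
      obtain v where v: "v \<in> C" "s \<union> (\<Union>t \<in> {t. t \<subset> s}. K t) \<subseteq> v" ..
      then have "\<forall>t. t \<subset> s \<longrightarrow> K t \<subseteq> v" by blast
      with v show ?thesis by (intro exI[of _ v]) simp
    qed blast
  qed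
  then obtain K where "\<forall>s. ?P K s (K s)" ..
  then have K: "?P K s (K s)" for s by (rule spec)
  show thesis
  proof (rule that[of K])
    show "countable (K s) \<and> K s \<subseteq> A" if "finite s" "s \<subseteq> A" for s
      using K[of s] that clubD(1,2)[OF assms, of "K s"] by simp
    show "x \<in> C" if x: "countable x" "x \<subseteq> A" "closed_under K x" for x
    \<comment> \<open>The empty set has no enumeration. Being closed, it includes
      \<open>K {}\<close>, which is therefore empty and belongs to \<open>C\<close>.\<close>
    proof (cases "x = {}")
      case True
      then show ?thesis using K[of "{}"] x(3) unfolding closed_under_def by auto
    next
      case False
      define s where "s n = from_nat_into x ` {..n}" for n
      have s: "finite (s n)" "s n \<subseteq> x" for n
        using from_nat_into[OF False] unfolding s_def by auto
      have "mono (\<lambda>n. K (s n))"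
      proof (rule monoI)
        fix m n :: nat assume "m \<le> n"
        then have "s m \<subseteq> s n" unfolding s_def by auto
        then show "K (s m) \<subseteq> K (s n)" using K[of "s n"] s[of n] x(2) by (cases "s m = s n") auto
      qed
      moreover have "K (s n) \<in> C" for n using K[of "s n"] s[of n] x(2) by auto
      ultimately have "(\<Union>n. K (s n)) \<in> C" by (rule clubD(4)[OF assms])
      moreover have "(\<Union>n. K (s n)) = x"
      proof
        show "(\<Union>n. K (s n)) \<subseteq> x"
          using x(3) s unfolding closed_under_def by blast
        have "range (from_nat_into x) = (\<Union>n. s n)" unfolding s_def by auto
        then have "x = (\<Union>n. s n)" by (simp only: range_from_nat_into[OF False x(1)])
        also have "\<dots> \<subseteq> (\<Union>n. K (s n))"
        proof (intro UN_mono order_refl)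
          show "s n \<subseteq> K (s n)" for n using K[of "s n"] s[of n] x(2) by auto
        qed
        finally show "x \<subseteq> (\<Union>n. K (s n))" .
      qed
      ultimately show ?thesis by simp
    qed
  qed
qed

lemma club_Int:
  assumes "club A C" "club A D"
  shows "club A (C \<inter> D)"
proof (rule clubI)
  show "C \<inter> D \<subseteq> countable_subsets A" using assms unfolding club_def by blast
  show "(\<Union>n. f n) \<in> C \<inter> D" if "mono f" "\<And>n. f n \<in> C \<inter> D" for f :: "nat \<Rightarrow> 'a set"
    using that clubD(4)[OF assms(1), of f] clubD(4)[OF assms(2), of f] by blast
  obtain G where G: "\<And>s. finite s \<Longrightarrow> s \<subseteq> A \<Longrightarrow> countable (G s) \<and> G s \<subseteq> A"
    "\<And>x. countable x \<Longrightarrow> x \<subseteq> A \<Longrightarrow> closed_under G x \<Longrightarrow> x \<in> C"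
    using club_generated[OF assms(1)] by metis
  obtain L where L: "\<And>s. finite s \<Longrightarrow> s \<subseteq> A \<Longrightarrow> countable (L s) \<and> L s \<subseteq> A"
    "\<And>x. countable x \<Longrightarrow> x \<subseteq> A \<Longrightarrow> closed_under L x \<Longrightarrow> x \<in> D"
    using club_generated[OF assms(2)] by metis
  fix x assume x: "countable x" "x \<subseteq> A"
  let ?y = "Cl (\<lambda>s. G s \<union> L s) x"
  have y: "countable ?y \<and> ?y \<subseteq> A" using G(1) L(1) x by (intro Cl_countable) auto
  have "closed_under G ?y" "closed_under L ?y"
    using closed_under_Cl[of "\<lambda>s. G s \<union> L s" x] unfolding closed_under_def by auto
  then have "?y \<in> C \<inter> D" using y G(2) L(2) by blast
  then show "\<exists>y \<in> C \<inter> D. x \<subseteq> y" using Cl_subset[of x] by (rule bexI[rotated])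
qed

text \<open>The sets \<open>y\<close> to which closing under a generating function of
  \<open>C\<close> adds no further element of \<open>B\<close> form a club, and each is the trace of
  its own closure, a member of \<open>C\<close>.\<close>

lemma club_trace:
  assumes "club A C" "B \<subseteq> A"
  shows "\<exists>D. club B D \<and> (\<forall>y \<in> D. \<exists>z \<in> C. y = z \<inter> B)"
proof -
  obtain G where G: "\<And>s. finite s \<Longrightarrow> s \<subseteq> A \<Longrightarrow> countable (G s) \<and> G s \<subseteq> A"
    "\<And>x. countable x \<Longrightarrow> x \<subseteq> A \<Longrightarrow> closed_under G x \<Longrightarrow> x \<in> C"
    using club_generated[OF assms(1)] by metis
  define D where "D = {y \<in> countable_subsets B. Cl G y \<inter> B = y}"
  have Cl: "countable (Cl G x) \<and> Cl G x \<subseteq> A" if "countable x" "x \<subseteq> B" for x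
    using that assms(2) G(1) by (intro Cl_countable) auto
  have "club B D"
  proof (rule clubI)
    show "D \<subseteq> countable_subsets B" by (auto simp: D_def)
    show "\<exists>y \<in> D. x \<subseteq> y" if x: "countable x" "x \<subseteq> B" for x
    proof
      have "Cl G (Cl G x \<inter> B) \<subseteq> Cl G x"
        by (intro Cl_least closed_under_Cl) blast
      moreover have "Cl G x \<inter> B \<subseteq> Cl G (Cl G x \<inter> B)" by (rule Cl_subset)
      ultimately show "Cl G x \<inter> B \<in> D"
        using Cl[OF x] unfolding D_def countable_subsets_def by auto
      show "x \<subseteq> Cl G x \<inter> B" using x(2) Cl_subset[of x G] by blast
    qed
    show "(\<Union>n. f n) \<in> D" if f: "mono f" "\<And>n. f n \<in> D" for f :: "nat \<Rightarrow> 'a set"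
    proof -
      have "Cl G (\<Union>n. f n) \<inter> B = (\<Union>n. Cl G (f n) \<inter> B)"
        unfolding Cl_chain[OF f(1)] by blast
      also have "\<dots> = (\<Union>n. f n)" using f(2) by (simp add: D_def)
      finally show ?thesis using f(2) unfolding D_def countable_subsets_def by auto
    qed
  qed
  moreover have "\<exists>z \<in> C. y = z \<inter> B" if "y \<in> D" for y
    using that G(2)[of "Cl G y"] Cl[of y] closed_under_Cl[of G y]
    unfolding D_def countable_subsets_def by blast
  ultimately show ?thesis by blast
qed

lemma club_lift:
  assumes "club B D" "B \<subseteq> A"
  shows "club A {y \<in> countable_subsets A. y \<inter> B \<in> D}"
proof (rule clubI)
  show "\<exists>y \<in> {y \<in> countable_subsets A. y \<inter> B \<in> D}. x \<subseteq> y" if x: "countable x" "x \<subseteq> A" for x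
  proof -
    obtain d where d: "d \<in> D" "x \<inter> B \<subseteq> d" using clubD(3)[OF assms(1), of "x \<inter> B"] x by auto
    then have "(x - B \<union> d) \<inter> B = d" using clubD(2)[OF assms(1) d(1)] by blast
    moreover have "x - B \<union> d \<in> countable_subsets A"
      using clubD(1,2)[OF assms(1) d(1)] assms(2) x unfolding countable_subsets_def by blast
    ultimately show ?thesis using d by (intro bexI[of _ "x - B \<union> d"]) auto
  qed
  show "(\<Union>n. f n) \<in> {y \<in> countable_subsets A. y \<inter> B \<in> D}"
    if f: "mono f" "\<And>n. f n \<in> {y \<in> countable_subsets A. y \<inter> B \<in> D}" for f :: "nat \<Rightarrow> 'a set"
  proof -
    have "mono (\<lambda>n. f n \<inter> B)" using f(1) unfolding mono_def by blast
    then have "(\<Union>n. f n \<inter> B) \<in> D" using f(2) by (intro clubD(4)[OF assms(1)]) auto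
    moreover have "(\<Union>n. f n) \<inter> B = (\<Union>n. f n \<inter> B)" by blast
    ultimately have "(\<Union>n. f n) \<inter> B \<in> D" by (simp only:)
    moreover have "(\<Union>n. f n) \<in> countable_subsets A"
      using f(2) unfolding countable_subsets_def by blast
    ultimately show ?thesis by simp
  qed
qed blast

lemma club_image:
  assumes "club A C" "bij_betw h A B"
  shows "club B ((`) h ` C)"
proof (rule clubI)
  have hA: "h ` A = B" and inj: "inj_on h A" using assms(2) by (auto simp: bij_betw_def)
  show "(`) h ` C \<subseteq> countable_subsets B"
    using clubD(1,2)[OF assms(1)] hA unfolding countable_subsets_def by blast
  show "\<exists>y \<in> (`) h ` C. x \<subseteq> y" if x: "countable x" "x \<subseteq> B" for x
  proof -
    obtain x' where x': "x' \<subseteq> A" "countable x'" "x = h ` x'"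
      using x hA by (metis countable_subset_image)
    then obtain y where "y \<in> C" "x' \<subseteq> y" using clubD(3)[OF assms(1)] by blast
    then show ?thesis using x' by blast
  qed
  show "(\<Union>n. f n) \<in> (`) h ` C" if f: "mono f" "\<And>n. f n \<in> (`) h ` C" for f :: "nat \<Rightarrow> 'b set"
  proof -
    have "\<forall>n. \<exists>y. y \<in> C \<and> f n = h ` y" using f(2) by blast
    then obtain g where g: "\<And>n. g n \<in> C" "\<And>n. f n = h ` g n" by metis
    have "mono g"
    proof (rule monoI)
      fix m n :: nat assume "m \<le> n"
      then have "h ` g m \<subseteq> h ` g n" using f(1) g(2) by (metis monoD)
      then show "g m \<subseteq> g n"
        using inj_on_image_mem_iff[OF inj] clubD(2)[OF assms(1) g(1)[of m]]
          clubD(2)[OF assms(1) g(1)[of n]] by blast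
    qed
    then have "(\<Union>n. g n) \<in> C" using g(1) by (rule clubD(4)[OF assms(1)])
    moreover have "(\<Union>n. f n) = h ` (\<Union>n. g n)" using g(2) by auto
    ultimately show ?thesis by blast
  qed
qed

section \<open>Coding sequences into members of a club\<close>

text \<open>Enumerating \<open>\<alpha> \<union> {\<alpha>}\<close> instead of \<alpha> gives a
  nonempty range even for \<alpha> = 0, and it lets \<open>presaturated_bound\<close> treat the
  cases of a smaller and of an equal ordinal together.\<close>

definition enum :: "'v::set_universe \<Rightarrow> 'v \<Rightarrow> 'v" where
  "enum \<alpha> = (SOME e. e ` W1 = insert \<alpha> (elts \<alpha>))"

lemma enum_image:
  fixes \<alpha> :: "'v::set_universe"
  assumes "\<alpha> \<in> W2"
  shows "enum \<alpha> ` W1 = insert \<alpha> (elts \<alpha>)"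
proof -
  have "insert \<alpha> (elts \<alpha>) \<lesssim> (W1 :: 'v set)"
    using assms infinite_omega1 by (intro lepoll_insert) (auto simp: elts_omega2)
  then obtain g :: "'v \<Rightarrow> 'v" where g: "insert \<alpha> (elts \<alpha>) \<subseteq> g ` W1" unfolding lepoll_iff by blast
  let ?e = "\<lambda>i. if g i \<in> insert \<alpha> (elts \<alpha>) then g i else \<alpha>"
  have "?e ` W1 = insert \<alpha> (elts \<alpha>)"
  proof
    show "?e ` W1 \<subseteq> insert \<alpha> (elts \<alpha>)" by auto
    show "insert \<alpha> (elts \<alpha>) \<subseteq> ?e ` W1"
    proof
      fix x assume x: "x \<in> insert \<alpha> (elts \<alpha>)"
      then obtain i where "i \<in> W1" "x = g i" using g by blast
      then show "x \<in> ?e ` W1" using x by (intro image_eqI[of _ _ i]) simp_all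
    qed
  qed
  then show ?thesis unfolding enum_def by (rule someI[where P = "\<lambda>e. e ` W1 = insert \<alpha> (elts \<alpha>)"])
qed

lemma enum_in_omega2:
  assumes "\<alpha> \<in> W2" "i \<in> W1"
  shows "enum \<alpha> i \<in> W2"
proof -
  have "enum \<alpha> i \<in> insert \<alpha> (elts \<alpha>)"
    using assms(2) unfolding enum_image[OF assms(1), symmetric] by (rule imageI)
  then show ?thesis
  proof (rule insertE)
    show "enum \<alpha> i = \<alpha> \<Longrightarrow> ?thesis" using assms(1) by simp
    show "enum \<alpha> i \<in> elts \<alpha> \<Longrightarrow> ?thesis" by (rule subsetD[OF Ord_subset[OF Ord_omega2 assms(1)]])
  qed
qed

definition seg :: "'v::set_universe \<Rightarrow> 'v \<Rightarrow> 'v set" where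
  "seg \<gamma> \<alpha> = enum \<alpha> ` elts \<gamma> \<inter> elts \<alpha>"

lemma omega1_UN:
  assumes "countable A" "A \<subseteq> W1"
  shows "\<exists>\<gamma> \<in> W1. elts \<gamma> = \<Union> (elts ` A)"
proof -
  have A: "Ord \<alpha>" "countable (elts \<alpha>)" "elts \<alpha> \<subseteq> W1" if "\<alpha> \<in> A" for \<alpha>
  proof -
    have \<alpha>: "\<alpha> \<in> W1" using that assms(2) by blast
    then show "Ord \<alpha>" "countable (elts \<alpha>)" by (simp_all add: elts_omega1)
    show "elts \<alpha> \<subseteq> W1" using Ord_subset[OF Ord_omega1 \<alpha>] .
  qed
  have sm: "small (\<Union> (elts ` A))" using A(3) by (intro small_subset[OF small_elts[of omega1]]) blast
  moreover have "Ord (set_of (\<Union> (elts ` A)))"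
    using Ord_in[OF A(1)] Ord_subset[OF A(1)] by (intro Ord_set_of[OF sm]) blast+
  moreover have "countable (\<Union> (elts ` A))" using A(2) assms(1) by blast
  ultimately show ?thesis by (intro bexI[of _ "set_of (\<Union> (elts ` A))"]) (auto simp: elts_omega1)
qed

text \<open>This closure turns the set given by reflection into an ordinal, see
  \<open>reflecting_ordinal\<close>.\<close>

definition enum_closed :: "'v::set_universe set \<Rightarrow> bool" where
  "enum_closed x \<longleftrightarrow> (\<forall>\<alpha> \<in> x. \<forall>i \<in> x \<inter> W1. enum \<alpha> i \<in> x)"

text \<open>
  In the game, one player names ordinals below \<open>\<omega>\<^sub>2\<close>, and the other one answers with larger ordinals,
  whose list has to remain fine; \<open>lost\<close> says that the former player has a winning strategy.
\<close>

definition fine :: "('v::set_universe set \<Rightarrow> 'v set) \<Rightarrow> 'v \<Rightarrow> 'v list \<Rightarrow> bool" where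
  "fine G \<gamma> s \<longleftrightarrow> Cl G (set s \<union> elts \<gamma>) \<inter> W1 \<subseteq> elts \<gamma>"

definition play :: "('v::set_universe list \<Rightarrow> 'v) \<Rightarrow> 'v list \<Rightarrow> (nat \<Rightarrow> 'v) \<Rightarrow> bool" where
  "play \<sigma> s b \<longleftrightarrow> (\<forall>n. b n \<in> W2 \<and> \<sigma> (s @ map b [0..<n]) \<in> elts (b n))"

definition lost :: "('v::set_universe set \<Rightarrow> 'v set) \<Rightarrow> 'v \<Rightarrow> 'v list \<Rightarrow> bool" where
  "lost G \<gamma> s \<longleftrightarrow> (\<exists>\<sigma>. range \<sigma> \<subseteq> W2 \<and> (\<forall>b. play \<sigma> s b \<longrightarrow> (\<exists>n. \<not> fine G \<gamma> (s @ map b [0..<n]))))"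

lemma omega2_nonempty: "\<exists>\<beta> :: 'v::set_universe. \<beta> \<in> W2"
  using omega2_bounded[of "{} :: 'v set"] by auto

lemma fine_if_not_lost:
  assumes "\<not> lost G \<gamma> (s :: 'v::set_universe list)"
  shows "fine G \<gamma> s"
proof (rule ccontr)
  assume nf: "\<not> fine G \<gamma> s"
  obtain \<beta> :: 'v where "\<beta> \<in> W2" using omega2_nonempty by blast
  moreover have "\<exists>n. \<not> fine G \<gamma> (s @ map b [0..<n])" for b
    using nf by (intro exI[of _ 0]) simp
  ultimately have "lost G \<gamma> s"
    unfolding lost_def by (intro exI[of _ "\<lambda>_. \<beta>"]) auto
  then show False using assms by simp
qed

text \<open>If every answer above \<alpha> led to a lost position, then naming \<alpha> and
  continuing with the winning strategy for the position reached would win from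
  \<open>s\<close>.\<close>

lemma answer_if_not_lost:
  assumes "\<not> lost G \<gamma> (s :: 'v::set_universe list)" "\<alpha> \<in> W2"
  shows "\<exists>\<beta> \<in> W2. \<alpha> \<in> elts \<beta> \<and> \<not> lost G \<gamma> (s @ [\<beta>])"
proof (rule ccontr)
  assume "\<not> ?thesis"
  then have "\<forall>\<beta>. \<exists>\<sigma>. \<beta> \<in> W2 \<and> \<alpha> \<in> elts \<beta> \<longrightarrow> range \<sigma> \<subseteq> W2 \<and>
      (\<forall>b. play \<sigma> (s @ [\<beta>]) b \<longrightarrow> (\<exists>n. \<not> fine G \<gamma> ((s @ [\<beta>]) @ map b [0..<n])))"
    unfolding lost_def by blast
  from choice[OF this] obtain \<Sigma> where \<Sigma>: "\<forall>\<beta>. \<beta> \<in> W2 \<and> \<alpha> \<in> elts \<beta> \<longrightarrow> range (\<Sigma> \<beta>) \<subseteq> W2 \<and>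
      (\<forall>b. play (\<Sigma> \<beta>) (s @ [\<beta>]) b \<longrightarrow> (\<exists>n. \<not> fine G \<gamma> ((s @ [\<beta>]) @ map b [0..<n])))" ..
  \<comment> \<open>The value \<alpha> is the first move. It is also the default after an illegal
    answer, where no strategy is at hand, so that all values stay below omega2.\<close>
  define \<sigma> where "\<sigma> t = (if length t \<le> length s \<or> t ! length s \<notin> W2 \<or> \<alpha> \<notin> elts (t ! length s)
      then \<alpha> else \<Sigma> (t ! length s) t)" for t
  have "range \<sigma> \<subseteq> W2"
  proof (intro subsetI, elim rangeE)
    fix x t assume x: "x = \<sigma> t"
    show "x \<in> W2"
    proof (cases "length t \<le> length s \<or> t ! length s \<notin> W2 \<or> \<alpha> \<notin> elts (t ! length s)")
      case True
      then show ?thesis using assms(2) unfolding x \<sigma>_def by simp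
    next
      case False
      then have "range (\<Sigma> (t ! length s)) \<subseteq> W2" using \<Sigma> by blast
      then show ?thesis using False unfolding x \<sigma>_def by auto
    qed
  qed
  moreover have "\<exists>n. \<not> fine G \<gamma> (s @ map b [0..<n])" if "play \<sigma> s b" for b
  proof -
    have b0: "b 0 \<in> W2" "\<alpha> \<in> elts (b 0)"
      using spec[OF that[unfolded play_def], of 0] by (simp_all add: \<sigma>_def)
    have shift: "(s @ [b 0]) @ map (\<lambda>n. b (Suc n)) [0..<n] = s @ map b [0..<Suc n]" for n
      by (simp only: map_upt_Suc append_assoc append.simps)
    have "play (\<Sigma> (b 0)) (s @ [b 0]) (\<lambda>n. b (Suc n))"
      unfolding play_def shift
    proof
      fix n
      have "(s @ map b [0..<Suc n]) ! length s = b 0"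
        by (simp add: nth_append del: upt_Suc)
      then have "\<sigma> (s @ map b [0..<Suc n]) = \<Sigma> (b 0) (s @ map b [0..<Suc n])"
        using b0 by (simp add: \<sigma>_def del: upt_Suc)
      then show "b (Suc n) \<in> W2 \<and> \<Sigma> (b 0) (s @ map b [0..<Suc n]) \<in> elts (b (Suc n))"
        using spec[OF that[unfolded play_def], of "Suc n"] by simp
    qed
    then obtain n where "\<not> fine G \<gamma> ((s @ [b 0]) @ map (\<lambda>n. b (Suc n)) [0..<n])"
      using \<Sigma> b0 by blast
    then show ?thesis unfolding shift by blast
  qed
  ultimately have "lost G \<gamma> s" unfolding lost_def by blast
  then show False using assms(1) by simp
qed

text \<open>Suppose that for every \<gamma> some strategy wins. There are only omega1 of these
  strategies, so a single run \<open>b\<close> can beat the demands of all of them, its answers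
  being suprema below omega2. The run is countable, so closing off yields a \<gamma> for which it
  stays fine, against the strategy for this \<gamma>.\<close>

lemma ex_not_lost:
  fixes G :: "'v::set_universe set \<Rightarrow> 'v set"
  assumes G: "\<And>s. finite s \<Longrightarrow> s \<subseteq> W2 \<Longrightarrow> countable (G s) \<and> G s \<subseteq> W2"
  shows "\<exists>\<gamma> \<in> W1. \<not> lost G \<gamma> []"
proof (rule ccontr)
  assume "\<not> ?thesis"
  then have "\<forall>\<gamma>. \<exists>\<sigma>. \<gamma> \<in> W1 \<longrightarrow> range \<sigma> \<subseteq> W2 \<and> (\<forall>b. play \<sigma> [] b \<longrightarrow> (\<exists>n. \<not> fine G \<gamma> ([] @ map b [0..<n])))"
    unfolding lost_def by blast
  from choice[OF this] obtain \<Sigma> where \<Sigma>: "\<forall>\<gamma>. \<gamma> \<in> W1 \<longrightarrow> range (\<Sigma> \<gamma>) \<subseteq> W2 \<and>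
      (\<forall>b. play (\<Sigma> \<gamma>) [] b \<longrightarrow> (\<exists>n. \<not> fine G \<gamma> ([] @ map b [0..<n])))" ..
  have ex: "\<exists>\<beta>. \<beta> \<in> W2 \<and> (\<forall>\<gamma> \<in> W1. \<Sigma> \<gamma> t \<in> elts \<beta>)" for t
  proof -
    have "(\<lambda>\<gamma>. \<Sigma> \<gamma> t) ` W1 \<subseteq> W2" using \<Sigma> by blast
    moreover have "(\<lambda>\<gamma>. \<Sigma> \<gamma> t) ` W1 \<lesssim> (W1 :: 'v set)" by (rule image_lepoll)
    ultimately obtain \<beta> where "\<beta> \<in> W2" "(\<lambda>\<gamma>. \<Sigma> \<gamma> t) ` W1 \<subseteq> elts \<beta>"
      using omega2_bounded by blast
    then show ?thesis by blast
  qed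
  define B where "B t = (SOME \<beta>. \<beta> \<in> W2 \<and> (\<forall>\<gamma> \<in> W1. \<Sigma> \<gamma> t \<in> elts \<beta>))" for t
  have B: "B t \<in> W2" "\<gamma> \<in> W1 \<Longrightarrow> \<Sigma> \<gamma> t \<in> elts (B t)" for t \<gamma>
    using someI_ex[OF ex[of t]] unfolding B_def by blast+
  define T where "T n = ((\<lambda>t. t @ [B t]) ^^ n) []" for n
  define b where "b n = B (T n)" for n
  have T: "T n = map b [0..<n]" for n
    by (induction n) (simp_all add: T_def b_def)
  have play: "play (\<Sigma> \<gamma>) [] b" if "\<gamma> \<in> W1" for \<gamma>
    unfolding play_def using B that by (simp add: b_def flip: T)
  define x where "x = range b"
  have x: "countable x" "x \<subseteq> W2" using B(1) by (auto simp: x_def b_def)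
  have Cl: "countable (Cl G (x \<union> elts \<gamma>))" if "\<gamma> \<in> W1" for \<gamma>
  proof -
    have "countable (x \<union> elts \<gamma>)" using x(1) that by (auto simp: elts_omega1)
    moreover have "x \<union> elts \<gamma> \<subseteq> W2"
      using x(2) omega1_subset_omega2 Ord_subset[OF Ord_omega1 that] by blast
    ultimately show ?thesis using Cl_countable[of W2 G "x \<union> elts \<gamma>", OF G] by simp
  qed
  have "\<exists>\<gamma>'. \<gamma>' \<in> W1 \<and> Cl G (x \<union> elts \<gamma>) \<inter> W1 \<subseteq> elts \<gamma>'" if "\<gamma> \<in> W1" for \<gamma>
    using omega1_bounded[of "Cl G (x \<union> elts \<gamma>) \<inter> W1"] Cl[OF that] by auto
  then obtain N where N: "\<And>\<gamma>. \<gamma> \<in> W1 \<Longrightarrow> N \<gamma> \<in> W1 \<and> Cl G (x \<union> elts \<gamma>) \<inter> W1 \<subseteq> elts (N \<gamma>)"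
    by metis
  obtain \<gamma>0 :: 'v where \<gamma>0: "\<gamma>0 \<in> W1" using infinite_omega1 by (metis finite.emptyI ex_in_conv)
  \<comment> \<open>After omega rounds of closing off, the closure of
    \<open>x \<union> elts \<gamma>\<close> has no countable ordinals outside \<gamma>, because
    \<open>Cl\<close> commutes with unions of chains.\<close>
  define g where "g n = (N ^^ n) \<gamma>0" for n
  have g: "g n \<in> W1" for n
    by (induction n) (use \<gamma>0 N in \<open>auto simp: g_def\<close>)
  have g_Suc: "Cl G (x \<union> elts (g n)) \<inter> W1 \<subseteq> elts (g (Suc n))" for n
    using N[OF g[of n]] by (simp add: g_def)
  have "elts (g n) \<subseteq> elts (g (Suc n))" for n
  proof -
    have "elts (g n) \<subseteq> Cl G (x \<union> elts (g n)) \<inter> W1"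
      using Ord_subset[OF Ord_omega1 g[of n]] Cl_subset[of "x \<union> elts (g n)" G] by blast
    then show ?thesis using g_Suc[of n] by (rule order_trans)
  qed
  then have "mono (\<lambda>n. elts (g n))" by (simp add: mono_iff_le_Suc)
  then have mono: "mono (\<lambda>n. x \<union> elts (g n))" by (auto simp: mono_def)
  obtain \<gamma> where \<gamma>: "\<gamma> \<in> W1" "elts \<gamma> = \<Union> (elts ` range g)"
    using omega1_UN[of "range g"] g by blast
  have "x \<union> elts \<gamma> = (\<Union>n. x \<union> elts (g n))" using \<gamma>(2) by auto
  then have "Cl G (x \<union> elts \<gamma>) = (\<Union>n. Cl G (x \<union> elts (g n)))" by (simp only: Cl_chain[OF mono])
  then have "Cl G (x \<union> elts \<gamma>) \<inter> W1 = (\<Union>n. Cl G (x \<union> elts (g n)) \<inter> W1)" by (simp only: Int_UN_distrib2 UN_simps)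
  also have "\<dots> \<subseteq> elts \<gamma>" unfolding \<gamma>(2) using g_Suc by blast
  finally have "Cl G (x \<union> elts \<gamma>) \<inter> W1 \<subseteq> elts \<gamma>" .
  moreover have "Cl G (set (map b [0..<n]) \<union> elts \<gamma>) \<subseteq> Cl G (x \<union> elts \<gamma>)" for n
    by (rule Cl_mono) (auto simp: x_def)
  ultimately have "fine G \<gamma> ([] @ map b [0..<n])" for n
    unfolding fine_def append_Nil by blast
  then show False using \<Sigma> \<gamma>(1) play[OF \<gamma>(1)] by blast
qed

text \<open>
  Closed sets whose countable ordinals are those below \<open>\<gamma>\<close> are determined below each of their members
  \<open>\<beta>\<close>, where they agree with \<open>seg \<gamma> \<beta>\<close>. Were all answers \<open>\<beta>\<close> to meet \<open>[\<eta>, \<theta>)\<close> for some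
  \<open>\<theta>\<close> depending on \<open>\<eta>\<close>, then iterating \<open>\<omega>\<^sub>1\<close> times would make \<open>seg \<gamma> \<beta>\<close> uncountable.
\<close>

lemma ex_gap:
  fixes G :: "'v::set_universe set \<Rightarrow> 'v set"
  assumes nl: "\<not> lost G \<gamma> s" and \<gamma>: "\<gamma> \<in> W1"
  shows "\<exists>\<eta> \<in> W2. \<forall>\<theta> \<in> W2. \<exists>\<beta> \<in> W2. \<theta> \<in> elts \<beta> \<and> \<not> lost G \<gamma> (s @ [\<beta>]) \<and>
    seg \<gamma> \<beta> \<inter> (elts \<theta> - elts \<eta>) = {}"
proof (rule ccontr)
  assume "\<not> ?thesis"
  then have "\<forall>\<eta>. \<exists>\<theta>. \<eta> \<in> W2 \<longrightarrow> \<theta> \<in> W2 \<and> (\<forall>\<beta> \<in> W2. \<theta> \<in> elts \<beta> \<and> \<not> lost G \<gamma> (s @ [\<beta>]) \<longrightarrow>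
    seg \<gamma> \<beta> \<inter> (elts \<theta> - elts \<eta>) \<noteq> {})" by blast
  from choice[OF this] obtain \<Theta> where \<Theta>: "\<forall>\<eta>. \<eta> \<in> W2 \<longrightarrow> \<Theta> \<eta> \<in> W2 \<and>
    (\<forall>\<beta> \<in> W2. \<Theta> \<eta> \<in> elts \<beta> \<and> \<not> lost G \<gamma> (s @ [\<beta>]) \<longrightarrow> seg \<gamma> \<beta> \<inter> (elts (\<Theta> \<eta>) - elts \<eta>) \<noteq> {})" ..
  \<comment> \<open>Since \<open>h i\<close> exceeds \<open>\<Theta> (h j)\<close> for all
    \<open>j\<close> below \<open>i\<close>, the intervals from \<open>h i\<close> to
    \<open>\<Theta> (h i)\<close> are disjoint. An answer above all of them would have to meet every
    one.\<close>
  let ?P = "\<lambda>(h :: 'v \<Rightarrow> 'v) (i :: 'v) v. i \<in> W1 \<longrightarrow> v \<in> W2 \<and> (\<forall>j \<in> elts i. \<Theta> (h j) \<in> elts v)"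
  have "\<exists>h. \<forall>i. ?P h i (h i)"
  proof (rule dependent_wf_choice[OF foundation])
    show "?P f i v = ?P g i v" if "\<And>j. (j, i) \<in> {(x, y). x \<in> elts y} \<Longrightarrow> f j = g j" for f g i v
      using that by simp
    show "\<exists>v. ?P h i v" if IH: "\<And>j. (j, i) \<in> {(x, y). x \<in> elts y} \<Longrightarrow> ?P h j (h j)" for i h
    proof (cases "i \<in> W1")
      case True
      have "\<Theta> (h j) \<in> W2" if "j \<in> elts i" for j
        using IH[of j] that \<Theta> Ord_trans[OF Ord_omega1 True that] by simp
      then have "(\<lambda>j. \<Theta> (h j)) ` elts i \<subseteq> W2" by blast
      moreover have "countable ((\<lambda>j. \<Theta> (h j)) ` elts i)" using True by (simp add: elts_omega1)
      ultimately obtain v where "v \<in> W2" "(\<lambda>j. \<Theta> (h j)) ` elts i \<subseteq> elts v"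
        using omega2_bounded_countable by blast
      then show ?thesis by (intro exI[of _ v]) blast
    qed simp
  qed
  then obtain h where "\<forall>i. ?P h i (h i)" ..
  then have h: "h i \<in> W2" "\<And>j. j \<in> elts i \<Longrightarrow> \<Theta> (h j) \<in> elts (h i)" if "i \<in> W1" for i
    using that by blast+
  have "(\<lambda>i. \<Theta> (h i)) ` W1 \<subseteq> W2" using \<Theta> h(1) by blast
  moreover have "(\<lambda>i. \<Theta> (h i)) ` W1 \<lesssim> (W1 :: 'v set)" by (rule image_lepoll)
  ultimately obtain \<theta> where \<theta>: "\<theta> \<in> W2" "(\<lambda>i. \<Theta> (h i)) ` W1 \<subseteq> elts \<theta>"
    using omega2_bounded by blast
  obtain \<beta> where \<beta>: "\<beta> \<in> W2" "\<theta> \<in> elts \<beta>" "\<not> lost G \<gamma> (s @ [\<beta>])"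
    using answer_if_not_lost[OF nl \<theta>(1)] by blast
  have "\<exists>\<xi>. \<xi> \<in> seg \<gamma> \<beta> \<and> \<xi> \<in> elts (\<Theta> (h i)) \<and> \<xi> \<notin> elts (h i)" if "i \<in> W1" for i
  proof -
    have "\<Theta> (h i) \<in> elts \<beta>"
      using \<theta>(2) that Ord_subset[OF Ord_in[OF Ord_omega2 \<beta>(1)] \<beta>(2)] by blast
    then have "seg \<gamma> \<beta> \<inter> (elts (\<Theta> (h i)) - elts (h i)) \<noteq> {}" using \<Theta> h(1)[OF that] \<beta> by blast
    then show ?thesis by blast
  qed
  then obtain x where x: "\<And>i. i \<in> W1 \<Longrightarrow> x i \<in> seg \<gamma> \<beta> \<and> x i \<in> elts (\<Theta> (h i)) \<and> x i \<notin> elts (h i)"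
    by metis
  have less: "x j \<noteq> x i" if "i \<in> W1" "j \<in> elts i" for i j
  proof -
    have j: "j \<in> W1" using Ord_trans[OF Ord_omega1 that] .
    have "elts (\<Theta> (h j)) \<subseteq> elts (h i)"
      using Ord_subset[OF Ord_in[OF Ord_omega2 h(1)[OF that(1)]] h(2)[OF that]] .
    then show ?thesis using x[OF j] x[OF that(1)] by auto
  qed
  have "inj_on x W1"
  proof (rule inj_onI)
    fix i j assume ij: "i \<in> W1" "j \<in> W1" "x i = x j"
    show "i = j"
      using Ord_linear[of i j] Ord_in[OF Ord_omega1] less[OF ij(1), of j] less[OF ij(2), of i] ij by auto
  qed
  moreover have "x ` W1 \<subseteq> seg \<gamma> \<beta>" using x by blast
  moreover have "countable (seg \<gamma> \<beta>)" using \<gamma> by (auto simp: seg_def elts_omega1)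
  ultimately have "countable (W1 :: 'v set)" using countable_image_inj_on countable_subset by metis
  then show False using uncountable_omega1 by blast
qed

lemma closed_seg:
  assumes Ge: "\<And>\<alpha> i. \<alpha> \<in> x \<Longrightarrow> i \<in> x \<Longrightarrow> i \<in> W1 \<Longrightarrow> enum \<alpha> i \<in> x"
    and Gi: "\<And>\<alpha> \<xi>. \<alpha> \<in> x \<Longrightarrow> \<xi> \<in> x \<Longrightarrow> \<xi> \<in> elts \<alpha> \<Longrightarrow> \<exists>i \<in> x. i \<in> W1 \<and> enum \<alpha> i = \<xi>"
    and "x \<inter> W1 = elts \<gamma>" "\<alpha> \<in> x"
  shows "x \<inter> elts \<alpha> = seg \<gamma> \<alpha>"
proof
  show "x \<inter> elts \<alpha> \<subseteq> seg \<gamma> \<alpha>"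
  proof
    fix \<xi> assume \<xi>: "\<xi> \<in> x \<inter> elts \<alpha>"
    then obtain i where "i \<in> x" "i \<in> W1" "enum \<alpha> i = \<xi>" using Gi[OF assms(4), of \<xi>] by blast
    moreover have "i \<in> elts \<gamma>" using calculation assms(3) by blast
    ultimately show "\<xi> \<in> seg \<gamma> \<alpha>" using \<xi> unfolding seg_def by blast
  qed
  show "seg \<gamma> \<alpha> \<subseteq> x \<inter> elts \<alpha>"
    using Ge[OF assms(4)] assms(3) unfolding seg_def by blast
qed

text \<open>For each \<open>j\<close> a play of the game is kept alive, and \<pi> says whose turn it
  is. At its turn, \<open>j\<close> adds an answer \<beta> above the current \<zeta>, chosen by
  \<open>ex_gap\<close> so that \<open>seg \<gamma> \<beta>\<close> has nothing between the bound of
  what \<open>j\<close> has generated so far and \<zeta>. As the final set agrees with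
  \<open>seg \<gamma> \<beta>\<close> below \<beta>, it never acquires elements in the intervals
  passed while other indices were served.\<close>

theorem club_coding:
  fixes C :: "'v::set_universe set set" and \<pi> :: "nat \<Rightarrow> 'j"
  assumes C: "club W2 C" and \<pi>: "\<And>j n. \<exists>m \<ge> n. \<pi> m = j"
  shows "\<exists>A \<zeta>. (\<forall>j. A j \<in> C \<and> A j \<subseteq> (\<Union>n. elts (\<zeta> n))) \<and>
    (\<forall>n. \<zeta> n \<in> W2 \<and> \<zeta> n \<in> elts (\<zeta> (Suc n))) \<and>
    (\<forall>j n. A j \<inter> (elts (\<zeta> (Suc n)) - elts (\<zeta> n)) \<noteq> {} \<longleftrightarrow> \<pi> n = j)"
proof -
  obtain G0 where G0: "\<And>s. finite s \<Longrightarrow> s \<subseteq> W2 \<Longrightarrow> countable (G0 s) \<and> G0 s \<subseteq> W2"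
    "\<And>x. countable x \<Longrightarrow> x \<subseteq> W2 \<Longrightarrow> closed_under G0 x \<Longrightarrow> x \<in> C"
    using club_generated[OF C] by metis
  define num :: "'v \<Rightarrow> 'v \<Rightarrow> 'v" where "num \<alpha> \<xi> = (SOME i. i \<in> W1 \<and> enum \<alpha> i = \<xi>)" for \<alpha> \<xi>
  have num: "num \<alpha> \<xi> \<in> W1" "enum \<alpha> (num \<alpha> \<xi>) = \<xi>" if "\<alpha> \<in> W2" "\<xi> \<in> elts \<alpha>" for \<alpha> \<xi>
  proof -
    have "\<xi> \<in> enum \<alpha> ` W1" using that enum_image[of \<alpha>] by simp
    then have "\<exists>i. i \<in> W1 \<and> enum \<alpha> i = \<xi>" by blast
    from someI_ex[OF this] show "num \<alpha> \<xi> \<in> W1" "enum \<alpha> (num \<alpha> \<xi>) = \<xi>" unfolding num_def by blast+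
  qed
  \<comment> \<open>Besides \<open>G0\<close>, which leads into \<open>C\<close>, closure under the
    enumerations and under their inverses is imposed, as \<open>closed_seg\<close> demands.\<close>
  define G where "G s = G0 s \<union> (\<Union>\<alpha> \<in> s. enum \<alpha> ` (s \<inter> W1)) \<union> (\<Union>\<alpha> \<in> s. num \<alpha> ` (s \<inter> elts \<alpha>))" for s
  have G: "countable (G s) \<and> G s \<subseteq> W2" if s: "finite s" "s \<subseteq> W2" for s
  proof
    show "countable (G s)"
      unfolding G_def using G0(1)[OF s] s(1)
      by (intro countable_Un countable_UN countable_image countable_Int1) (auto intro: countable_finite)
    have "enum \<alpha> ` (s \<inter> W1) \<subseteq> W2" if "\<alpha> \<in> s" for \<alpha>
      using enum_in_omega2[of \<alpha>] that s(2) by blast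
    moreover have "num \<alpha> ` (s \<inter> elts \<alpha>) \<subseteq> W2" if "\<alpha> \<in> s" for \<alpha>
      using num(1)[of \<alpha>] that s(2) omega1_subset_omega2 by blast
    ultimately show "G s \<subseteq> W2" unfolding G_def using G0(1)[OF s] by blast
  qed
  have closed: "closed_under G0 x"
    "\<And>\<alpha> i. \<alpha> \<in> x \<Longrightarrow> i \<in> x \<Longrightarrow> i \<in> W1 \<Longrightarrow> enum \<alpha> i \<in> x"
    "\<And>\<alpha> \<xi>. \<alpha> \<in> x \<Longrightarrow> \<xi> \<in> x \<Longrightarrow> \<xi> \<in> elts \<alpha> \<Longrightarrow> \<exists>i \<in> x. i \<in> W1 \<and> enum \<alpha> i = \<xi>"
    if x: "closed_under G x" "x \<subseteq> W2" for x
  proof -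
    have Gs: "G s \<subseteq> x" if "finite s" "s \<subseteq> x" for s
      using x(1) that unfolding closed_under_def by simp
    then show "closed_under G0 x" unfolding closed_under_def G_def by simp
    show "enum \<alpha> i \<in> x" if "\<alpha> \<in> x" "i \<in> x" "i \<in> W1" for \<alpha> i
    proof -
      have "enum \<alpha> i \<in> G {\<alpha>, i}" using that unfolding G_def by simp
      then show ?thesis using Gs[of "{\<alpha>, i}"] that by auto
    qed
    show "\<exists>i \<in> x. i \<in> W1 \<and> enum \<alpha> i = \<xi>" if "\<alpha> \<in> x" "\<xi> \<in> x" "\<xi> \<in> elts \<alpha>" for \<alpha> \<xi>
    proof (rule bexI[of _ "num \<alpha> \<xi>"])
      show "num \<alpha> \<xi> \<in> W1 \<and> enum \<alpha> (num \<alpha> \<xi>) = \<xi>" using num[of \<alpha> \<xi>] that x(2) by blast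
      have "num \<alpha> \<xi> \<in> G {\<alpha>, \<xi>}" using that unfolding G_def by simp
      then show "num \<alpha> \<xi> \<in> x" using Gs[of "{\<alpha>, \<xi>}"] that by auto
    qed
  qed
  have "\<exists>\<gamma> \<in> W1. \<not> lost G \<gamma> []" by (rule ex_not_lost) (rule G)
  then obtain \<gamma> where \<gamma>: "\<gamma> \<in> W1" "\<not> lost G \<gamma> []" by blast
  let ?cl = "\<lambda>s. Cl G (set s \<union> elts \<gamma>)"
  have \<gamma>W1: "elts \<gamma> \<subseteq> W1" using Ord_subset[OF Ord_omega1 \<gamma>(1)] .
  have cl: "countable (?cl s)" "?cl s \<subseteq> W2" if "set s \<subseteq> W2" for s
  proof -
    have "countable (set s \<union> elts \<gamma>)" using \<gamma>(1) by (simp add: elts_omega1 countable_finite)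
    moreover have "set s \<union> elts \<gamma> \<subseteq> W2" using that \<gamma>W1 omega1_subset_omega2 by blast
    ultimately show "countable (?cl s)" "?cl s \<subseteq> W2"
      using Cl_countable[of W2 G "set s \<union> elts \<gamma>", OF G] by simp_all
  qed
  \<comment> \<open>The ordinal \<eta> bounds everything generated so far, and from \<eta> on
    arbitrarily long gaps are possible with the next answer.\<close>
  define ok where "ok s \<eta> \<longleftrightarrow> set s \<subseteq> W2 \<and> \<not> lost G \<gamma> s \<and> \<eta> \<in> W2 \<and> ?cl s \<subseteq> elts \<eta> \<and>
    (\<forall>\<theta> \<in> W2. \<exists>\<beta> \<in> W2. \<theta> \<in> elts \<beta> \<and> \<not> lost G \<gamma> (s @ [\<beta>]) \<and> seg \<gamma> \<beta> \<inter> (elts \<theta> - elts \<eta>) = {})" for s \<eta>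
  have ex_ok: "\<exists>\<eta>. ok s \<eta>" if s: "set s \<subseteq> W2" "\<not> lost G \<gamma> s" for s
  proof -
    obtain \<eta> where \<eta>: "\<eta> \<in> W2" "\<forall>\<theta> \<in> W2. \<exists>\<beta> \<in> W2. \<theta> \<in> elts \<beta> \<and> \<not> lost G \<gamma> (s @ [\<beta>]) \<and>
        seg \<gamma> \<beta> \<inter> (elts \<theta> - elts \<eta>) = {}"
      using ex_gap[OF s(2) \<gamma>(1)] by blast
    obtain \<eta>' where \<eta>': "\<eta>' \<in> W2" "insert \<eta> (?cl s) \<subseteq> elts \<eta>'"
      using omega2_bounded_countable[of "insert \<eta> (?cl s)"] cl[OF s(1)] \<eta>(1) by auto
    have "elts \<eta> \<subseteq> elts \<eta>'" using Ord_subset[OF Ord_in[OF Ord_omega2 \<eta>'(1)]] \<eta>'(2) by blast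
    then have "seg \<gamma> \<beta> \<inter> (elts \<theta> - elts \<eta>') = {}" if "seg \<gamma> \<beta> \<inter> (elts \<theta> - elts \<eta>) = {}" for \<beta> \<theta>
      using that by blast
    then have "\<forall>\<theta> \<in> W2. \<exists>\<beta> \<in> W2. \<theta> \<in> elts \<beta> \<and> \<not> lost G \<gamma> (s @ [\<beta>]) \<and>
        seg \<gamma> \<beta> \<inter> (elts \<theta> - elts \<eta>') = {}" using \<eta>(2) by meson
    then show ?thesis using s \<eta>' unfolding ok_def by (intro exI[of _ \<eta>']) simp
  qed
  have ok_step: "\<exists>\<beta> \<eta>'. ok (s @ [\<beta>]) \<eta>' \<and> \<zeta> \<in> elts \<beta> \<and> \<beta> \<in> elts \<eta>' \<and> seg \<gamma> \<beta> \<inter> (elts \<zeta> - elts \<eta>) = {}"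
    if ok: "ok s \<eta>" and \<zeta>: "\<zeta> \<in> W2" for s \<eta> \<zeta>
  proof -
    obtain \<beta> where \<beta>: "\<beta> \<in> W2" "\<zeta> \<in> elts \<beta>" "\<not> lost G \<gamma> (s @ [\<beta>])" "seg \<gamma> \<beta> \<inter> (elts \<zeta> - elts \<eta>) = {}"
      using ok \<zeta> unfolding ok_def by blast
    have "set (s @ [\<beta>]) \<subseteq> W2" using ok \<beta>(1) unfolding ok_def by simp
    then obtain \<eta>' where \<eta>': "ok (s @ [\<beta>]) \<eta>'" using ex_ok \<beta>(3) by blast
    have "\<beta> \<in> ?cl (s @ [\<beta>])" using Cl_subset[of "set (s @ [\<beta>]) \<union> elts \<gamma>" G] by auto
    then have "\<beta> \<in> elts \<eta>'" using \<eta>' unfolding ok_def by blast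
    then show ?thesis using \<beta> \<eta>' by blast
  qed
  obtain \<eta>0 where \<eta>0: "ok [] \<eta>0" using ex_ok[of "[]"] \<gamma>(2) by auto
  \<comment> \<open>A state consists of the answers and the gap ordinal for each index, and of the
    right end of the last interval.\<close>
  let ?inv = "\<lambda>n (st :: ('j \<Rightarrow> 'v list) \<times> ('j \<Rightarrow> 'v) \<times> 'v). case st of (S, E, \<zeta>) \<Rightarrow>
    \<zeta> \<in> W2 \<and> (\<forall>j. ok (S j) (E j) \<and> elts (E j) \<subseteq> elts \<zeta>)"
  let ?next = "\<lambda>n (st :: ('j \<Rightarrow> 'v list) \<times> ('j \<Rightarrow> 'v) \<times> 'v) st'. case st of (S, E, \<zeta>) \<Rightarrow> case st' of (S', E', \<zeta>') \<Rightarrow>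
    \<exists>\<beta>. S' = S(\<pi> n := S (\<pi> n) @ [\<beta>]) \<and> E' = E(\<pi> n := \<zeta>') \<and> \<zeta> \<in> elts \<beta> \<and> \<beta> \<in> elts \<zeta>' \<and>
      seg \<gamma> \<beta> \<inter> (elts \<zeta> - elts (E (\<pi> n))) = {}"
  have "\<exists>st. \<forall>n. ?inv n (st n) \<and> ?next n (st n) (st (Suc n))"
  proof (rule dependent_nat_choice)
    show "\<exists>st. ?inv 0 st"
      using \<eta>0 unfolding ok_def by (intro exI[of _ "(\<lambda>_. [], \<lambda>_. \<eta>0, \<eta>0)"]) simp
    show "\<exists>st'. ?inv (Suc n) st' \<and> ?next n st st'" if st: "?inv n st" for st n
    proof -
      obtain S E \<zeta> where st_eq: "st = (S, E, \<zeta>)" by (cases st)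
      then have \<zeta>: "\<zeta> \<in> W2" and okS: "\<And>j. ok (S j) (E j)" and E: "\<And>j. elts (E j) \<subseteq> elts \<zeta>"
        using st by simp_all
      obtain \<beta> \<eta>' where step: "ok (S (\<pi> n) @ [\<beta>]) \<eta>'" "\<zeta> \<in> elts \<beta>" "\<beta> \<in> elts \<eta>'"
          "seg \<gamma> \<beta> \<inter> (elts \<zeta> - elts (E (\<pi> n))) = {}"
        using ok_step[OF okS \<zeta>] by blast
      have \<eta>': "\<eta>' \<in> W2" using step(1) unfolding ok_def by blast
      then have "Ord \<eta>'" by (rule Ord_in[OF Ord_omega2])
      then have "elts \<zeta> \<subseteq> elts \<eta>'" using Ord_subset[of \<eta>'] Ord_trans[of \<eta>' \<beta> \<zeta>] step(2,3) by blast
      then have sub: "elts (E j) \<subseteq> elts \<eta>'" for j using E[of j] by blast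
      show ?thesis
        unfolding st_eq
        by (rule exI[of _ "(S(\<pi> n := S (\<pi> n) @ [\<beta>]), E(\<pi> n := \<eta>'), \<eta>')"])
          (use step \<eta>' sub okS in \<open>auto intro!: exI[of _ \<beta>]\<close>)
    qed
  qed
  then obtain st where st_all: "\<forall>n. ?inv n (st n) \<and> ?next n (st n) (st (Suc n))" ..
  have st: "?inv n (st n)" "?next n (st n) (st (Suc n))" for n
    by (rule conjunct1[OF spec[OF st_all]], rule conjunct2[OF spec[OF st_all]])
  define S E \<zeta> where "S n = fst (st n)" and "E n = fst (snd (st n))" and "\<zeta> n = snd (snd (st n))" for n
  have st_eq: "st n = (S n, E n, \<zeta> n)" for n by (simp add: S_def E_def \<zeta>_def)
  have \<zeta>: "\<zeta> n \<in> W2" and ok: "ok (S n j) (E n j)" and E: "elts (E n j) \<subseteq> elts (\<zeta> n)" for n j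
    using st(1)[of n] unfolding st_eq by simp_all
  have "\<exists>\<beta>. S (Suc n) = (S n)(\<pi> n := S n (\<pi> n) @ [\<beta>]) \<and> E (Suc n) = (E n)(\<pi> n := \<zeta> (Suc n)) \<and>
      \<zeta> n \<in> elts \<beta> \<and> \<beta> \<in> elts (\<zeta> (Suc n)) \<and> seg \<gamma> \<beta> \<inter> (elts (\<zeta> n) - elts (E n (\<pi> n))) = {}" for n
    using st(2)[of n] unfolding st_eq by simp
  then obtain b where b: "\<And>n. S (Suc n) = (S n)(\<pi> n := S n (\<pi> n) @ [b n])"
    "\<And>n. E (Suc n) = (E n)(\<pi> n := \<zeta> (Suc n))" "\<And>n. \<zeta> n \<in> elts (b n)" "\<And>n. b n \<in> elts (\<zeta> (Suc n))"
    "\<And>n. seg \<gamma> (b n) \<inter> (elts (\<zeta> n) - elts (E n (\<pi> n))) = {}" by metis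
  have Ord\<zeta>: "Ord (\<zeta> n)" for n using Ord_in[OF Ord_omega2 \<zeta>] .
  have \<zeta>_Suc: "\<zeta> n \<in> elts (\<zeta> (Suc n))" for n using Ord_trans[OF Ord\<zeta> b(4) b(3)] .
  have \<zeta>_mono: "elts (\<zeta> m) \<subseteq> elts (\<zeta> n)" if "m \<le> n" for m n
    using that by (rule lift_Suc_mono_le[of "\<lambda>n. elts (\<zeta> n)", rotated]) (rule Ord_subset[OF Ord\<zeta> \<zeta>_Suc])
  define A where "A j = (\<Union>n. ?cl (S n j))" for j
  have S_mono: "set (S m j) \<subseteq> set (S n j)" if "m \<le> n" for m n j
    using that by (rule lift_Suc_mono_le[of "\<lambda>n. set (S n j)", rotated]) (auto simp: b(1))
  have mono: "mono (\<lambda>n. ?cl (S n j))" for j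
    by (intro monoI Cl_mono Un_mono S_mono order_refl)
  have A_W2: "A j \<subseteq> W2" for j unfolding A_def using cl(2) ok unfolding ok_def by blast
  have A_countable: "countable (A j)" for j
    unfolding A_def using cl(1) ok unfolding ok_def by (intro countable_UN) simp_all
  have A_closed: "closed_under G (A j)" for j
    unfolding A_def by (rule closed_under_chain[OF mono closed_under_Cl])
  have A_\<gamma>: "A j \<inter> W1 = elts \<gamma>" for j
  proof
    have "?cl (S n j) \<inter> W1 \<subseteq> elts \<gamma>" for n
      using fine_if_not_lost ok[of n j] unfolding ok_def fine_def by blast
    then show "A j \<inter> W1 \<subseteq> elts \<gamma>" unfolding A_def by blast
    have "elts \<gamma> \<subseteq> ?cl (S 0 j)" using Cl_subset[of "set (S 0 j) \<union> elts \<gamma>" G] by simp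
    then show "elts \<gamma> \<subseteq> A j \<inter> W1" using \<gamma>W1 unfolding A_def by blast
  qed
  have A_seg: "A j \<inter> elts \<alpha> = seg \<gamma> \<alpha>" if "\<alpha> \<in> A j" for j \<alpha>
    using closed(2,3)[OF A_closed A_W2] A_\<gamma> that by (rule closed_seg)
  have bA: "b n \<in> A (\<pi> n)" for n
  proof -
    have "b n \<in> set (S (Suc n) (\<pi> n)) \<union> elts \<gamma>" by (simp add: b(1))
    then have "b n \<in> ?cl (S (Suc n) (\<pi> n))" by (rule subsetD[OF Cl_subset])
    then show ?thesis unfolding A_def by blast
  qed
  have "A j \<in> C" for j
    using closed(1)[OF A_closed A_W2] A_countable A_W2 G0(2) by blast
  moreover have "A j \<subseteq> (\<Union>n. elts (\<zeta> n))" for j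
  proof -
    have "?cl (S n j) \<subseteq> elts (\<zeta> n)" for n using ok[of n j] E[of n j] unfolding ok_def by blast
    then show ?thesis unfolding A_def by blast
  qed
  moreover have "A j \<inter> (elts (\<zeta> (Suc n)) - elts (\<zeta> n)) \<noteq> {} \<longleftrightarrow> \<pi> n = j" for j n
  proof
    assume j: "\<pi> n = j"
    have "b n \<notin> elts (\<zeta> n)" using elts_asym[OF b(3)] .
    then show "A j \<inter> (elts (\<zeta> (Suc n)) - elts (\<zeta> n)) \<noteq> {}" using bA[of n] b(4)[of n] j by blast
  next
    assume ne: "A j \<inter> (elts (\<zeta> (Suc n)) - elts (\<zeta> n)) \<noteq> {}"
    show "\<pi> n = j"
    proof (rule ccontr)
      assume nj: "\<pi> n \<noteq> j"
      \<comment> \<open>Let \<open>m\<close> be the next turn of \<open>j\<close>. Its gap ordinal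
        has not changed since stage \<open>n\<close>, so \<xi> lies in the gap left below the answer
        \<open>b m\<close>; but \<open>A j\<close> agrees with \<open>seg \<gamma> (b m)\<close>
        there.\<close>
      define m where "m = (LEAST m. n \<le> m \<and> \<pi> m = j)"
      have m: "n \<le> m \<and> \<pi> m = j"
        unfolding m_def using \<pi>[of n j] by (metis (mono_tags, lifting) LeastI)
      have before: "\<pi> k \<noteq> j" if "n \<le> k" "k < m" for k
        using not_less_Least[OF that(2)[unfolded m_def]] that(1) by blast
      have nm: "Suc n \<le> m" using m nj by (metis le_neq_implies_less Suc_leI)
      have "k \<le> m \<Longrightarrow> E k j = E n j" if "n \<le> k" for k
        using that
      proof (induction k rule: dec_induct)
        case (step k)
        then show ?case using before[of k] by (simp add: b(2))
      qed simp
      then have Em: "E m j = E n j" using m by blast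
      obtain \<xi> where \<xi>: "\<xi> \<in> A j" "\<xi> \<in> elts (\<zeta> (Suc n))" "\<xi> \<notin> elts (\<zeta> n)" using ne by blast
      have \<xi>m: "\<xi> \<in> elts (\<zeta> m)" using \<zeta>_mono[OF nm] \<xi>(2) by blast
      have "Ord (b m)" using Ord_in[OF Ord\<zeta> b(4)] .
      then have "\<xi> \<in> elts (b m)" using Ord_trans[OF _ b(3) \<xi>m] by blast
      then have "\<xi> \<in> seg \<gamma> (b m)" using A_seg[of "b m" j] bA[of m] m \<xi>(1) by blast
      moreover have "\<xi> \<notin> elts (E m j)" using E[of n j] \<xi>(3) unfolding Em by blast
      ultimately show False using b(5)[of m] \<xi>m m by blast
    qed
  qed
  ultimately show ?thesis using \<zeta> \<zeta>_Suc by (intro exI[of _ A] exI[of _ \<zeta>]) simp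
qed

section \<open>Elementary submodels of \<open>H\<^sub>\<theta>\<close>\<close>

primrec numeral_ord :: "nat \<Rightarrow> 'v::set_universe" where
  "numeral_ord 0 = set_of {}"
| "numeral_ord (Suc n) = set_of (insert (numeral_ord n) (elts (numeral_ord n)))"

lemma elts_numeral_ord: "elts (numeral_ord n :: 'v::set_universe) = numeral_ord ` {..<n}"
proof (induction n)
  case 0
  have "small ({} :: 'v set)" by (rule small_subset[OF small_elts]) blast
  then show ?case by simp
next
  case (Suc n)
  have "small (insert (numeral_ord n :: 'v) (elts (numeral_ord n)))" by (intro small_insert small_elts)
  then have "elts (numeral_ord (Suc n) :: 'v) = insert (numeral_ord n) (elts (numeral_ord n))" by simp
  also have "\<dots> = numeral_ord ` {..<Suc n}" unfolding Suc by (simp add: lessThan_Suc)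
  finally show ?case .
qed

lemma Ord_numeral_ord: "Ord (numeral_ord n)"
proof (induction n rule: less_induct)
  case (less n)
  show ?case
  proof (rule Ord_I)
    fix \<beta> :: 'a assume "\<beta> \<in> elts (numeral_ord n)"
    then obtain m where m: "m < n" "\<beta> = numeral_ord m" by (auto simp: elts_numeral_ord)
    then show "Ord \<beta>" using less by simp
    show "elts \<beta> \<subseteq> elts (numeral_ord n)" using m by (auto simp: elts_numeral_ord)
  qed
qed

lemma elts_omega_eq: "elts (omega :: 'v::set_universe) = range numeral_ord"
proof
  show sub: "range numeral_ord \<subseteq> elts (omega :: 'v)"
    using Ord_numeral_ord by (auto simp: elts_omega elts_numeral_ord)
  have sm: "small (range numeral_ord :: 'v set)" using small_subset[OF small_elts sub] .
  have Ord: "Ord (set_of (range numeral_ord) :: 'v)"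
    by (rule Ord_set_of[OF sm]) (auto simp: elts_numeral_ord Ord_numeral_ord)
  have "inj (numeral_ord :: nat \<Rightarrow> 'v)"
  proof (rule injI)
    fix m n :: nat assume eq: "numeral_ord m = (numeral_ord n :: 'v)"
    have "(numeral_ord i :: 'v) \<in> elts (numeral_ord j)" if "i < j" for i j
      using that by (simp add: elts_numeral_ord)
    then have "\<not> m < n" "\<not> n < m" using eq elts_irrefl by metis+
    then show "m = n" by simp
  qed
  then have "infinite (range numeral_ord :: 'v set)" using finite_imageD by blast
  then have "(set_of (range numeral_ord) :: 'v) \<notin> elts omega"
    using sm by (simp add: elts_omega)
  then show "elts (omega :: 'v) \<subseteq> range numeral_ord"
    using Ord_not_in_iff[OF Ord Ord_omega] sm by simp
qed

lemma countable_omega: "countable (elts (omega :: 'v::set_universe))"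
  unfolding elts_omega_eq by simp

lemma omega_in_uncountable:
  assumes "Ord \<theta>" "uncountable (elts \<theta>)"
  shows "omega \<in> elts \<theta>"
  using Ord_not_in_iff[OF Ord_omega assms(1)] countable_omega assms(2) countable_subset by blast

lemma H_subset:
  assumes "Ord \<theta>" "x \<in> H \<theta>" "elts y \<subseteq> elts x"
  shows "y \<in> H \<theta>"
proof -
  have "elts y \<subseteq> trcl x" using assms(3) elts_subset_trcl[of x] by (rule order_trans)
  then have "trcl y \<subseteq> trcl x" using trcl_transitive[of _ x] by (intro trcl_subset)
  then show ?thesis
    using size_less_subset[OF assms(1)] assms(2) unfolding H_def by simp
qed

text \<open>Bounds for the sizes of the transitive closures of the elements, listed along omega,
  stay below some \<beta> in \<theta> by regularity.\<close>

lemma set_of_H: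
  fixes \<theta> :: "'v::set_universe"
  assumes "regular \<theta>" "uncountable (elts \<theta>)" "A \<subseteq> H \<theta>" "countable A"
  shows "small A" "set_of A \<in> H \<theta>"
proof -
  have Ord: "Ord \<theta>" using assms(1) unfolding regular_def by simp
  have om: "omega \<in> elts \<theta>" using omega_in_uncountable[OF Ord assms(2)] .
  have "\<exists>\<beta>. \<beta> \<in> elts \<theta> \<and> trcl a \<lesssim> elts \<beta>" if "a \<in> A" for a
    using that assms(3) by (auto simp: H_def elim!: size_lessE)
  then obtain \<nu> where \<nu>: "\<And>a. a \<in> A \<Longrightarrow> \<nu> a \<in> elts \<theta> \<and> trcl a \<lesssim> elts (\<nu> a)" by metis
  have "A \<lesssim> elts (omega :: 'v)" using countable_lepoll_infinite[OF assms(4) infinite_omega] .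
  then obtain h :: "'v \<Rightarrow> 'v" where h: "A \<subseteq> h ` elts omega" unfolding lepoll_iff by blast
  define f where "f i = (if h i \<in> A then \<nu> (h i) else omega)" for i
  have "f ` elts omega \<subseteq> elts \<theta>" using \<nu> om unfolding f_def by auto
  then obtain \<beta> where \<beta>: "\<beta> \<in> elts \<theta>" "f ` elts omega \<subseteq> elts \<beta>"
    using assms(1) om unfolding regular_def by blast
  have Ord\<beta>: "Ord \<beta>" using Ord_in[OF Ord \<beta>(1)] .
  \<comment> \<open>The larger one of \<beta> and omega, since \<open>HB\<close> is well behaved
    only over infinite sets.\<close>
  obtain \<rho> where \<rho>: "\<rho> \<in> elts \<theta>" "elts \<beta> \<subseteq> elts \<rho>" "elts omega \<subseteq> elts \<rho>"
  proof (cases "elts omega \<subseteq> elts \<beta>")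
    case True
    then show ?thesis using \<beta>(1) that by blast
  next
    case False
    then have "elts \<beta> \<subseteq> elts omega"
      using Ord_not_in_iff[OF Ord\<beta> Ord_omega] Ord_subset[OF Ord_omega, of \<beta>] by blast
    then show ?thesis using om that by blast
  qed
  have inf: "infinite (elts \<rho>)" using infinite_omega \<rho>(3) finite_subset by blast
  have HB: "A \<subseteq> HB (elts \<rho>)"
  proof
    fix a assume a: "a \<in> A"
    then obtain i where "i \<in> elts omega" "a = h i" using h by blast
    then have "\<nu> a \<in> elts \<beta>" using \<beta>(2) a unfolding f_def by force
    then have "elts (\<nu> a) \<subseteq> elts \<rho>" using Ord_subset[OF Ord\<beta>] \<rho>(2) by blast
    then have "trcl a \<lesssim> elts \<rho>" using \<nu>[OF a] lepoll_trans subset_imp_lepoll by blast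
    then show "a \<in> HB (elts \<rho>)" by (simp add: HB_def)
  qed
  show "small A" using small_if_HB[OF inf HB] .
  have "set_of A \<in> HB (elts \<rho>)"
    using set_of_HB[OF inf HB countable_lepoll_infinite[OF assms(4) inf]] .
  then show "set_of A \<in> H \<theta>"
    using size_lessI[OF Ord \<rho>(1)] unfolding HB_def H_def by simp
qed

text \<open>This much closure makes the formula for ordered pairs absolute. It holds both for
  \<open>H \<theta>\<close> and for the collapse of a guessing set.\<close>

definition pair_closed :: "'v::set_universe set \<Rightarrow> bool" where
  "pair_closed N \<longleftrightarrow> (\<forall>x \<in> N. elts x \<subseteq> N) \<and> (\<forall>x \<in> N. \<forall>y \<in> N. set_of {x, y} \<in> N)"

lemma pair_closedD:
  assumes "pair_closed N"
  shows "x \<in> N \<Longrightarrow> y \<in> elts x \<Longrightarrow> y \<in> N" "x \<in> N \<Longrightarrow> y \<in> N \<Longrightarrow> set_of {x, y} \<in> N"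
  using assms unfolding pair_closed_def by blast+

lemma pair_closed_H:
  assumes "regular \<theta>" "uncountable (elts \<theta>)"
  shows "pair_closed (H \<theta>)"
proof -
  have Ord: "Ord \<theta>" using assms(1) unfolding regular_def by simp
  show ?thesis
    unfolding pair_closed_def using H_mem[OF Ord] set_of_H(2)[OF assms, of "{_, _}"] by auto
qed

lemma sat_Pair_fm':
  assumes N: "pair_closed N" and e: "e z \<in> N" "e x \<in> N" "e y \<in> N"
    and "z \<notin> {7, 8}" "x \<notin> {7, 8}" "y \<notin> {7, 8}"
  shows "sat N (Pair_fm z x y) e \<longleftrightarrow> e z = vpair (e x) (e y)"
proof -
  have eq: "u = set_of {a, b} \<longleftrightarrow> (\<forall>v \<in> N. v \<in> elts u \<longleftrightarrow> v = a \<or> v = b)"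
    if "u \<in> N" "a \<in> N" "b \<in> N" for u a b
  proof
    assume R: "\<forall>v \<in> N. v \<in> elts u \<longleftrightarrow> v = a \<or> v = b"
    have "elts u = {a, b}" using R that pair_closedD(1)[OF N that(1)] by blast
    then show "u = set_of {a, b}" by (metis set_of_elts)
  qed auto
  have eq1: "u = set_of {a} \<longleftrightarrow> (\<forall>v \<in> N. v \<in> elts u \<longleftrightarrow> v = a)" if "u \<in> N" "a \<in> N" for u a
    using eq[of u a a] that by simp
  have in_N: "set_of {e x} \<in> N" "set_of {e x, e y} \<in> N"
    using pair_closedD(2)[OF N e(2) e(2)] pair_closedD(2)[OF N e(2) e(3)] by simp_all
  have "sat N (Pair_fm z x y) e \<longleftrightarrow>
      (\<forall>u \<in> N. u \<in> elts (e z) \<longleftrightarrow> (\<forall>v \<in> N. v \<in> elts u \<longleftrightarrow> v = e x) \<or>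
        (\<forall>v \<in> N. v \<in> elts u \<longleftrightarrow> v = e x \<or> v = e y))"
    unfolding Pair_fm_def by (simp only: sat_connectives(1,2) sat.simps(5)) (use assms in simp)
  also have "\<dots> \<longleftrightarrow> (\<forall>u \<in> N. u \<in> elts (e z) \<longleftrightarrow> u = set_of {e x} \<or> u = set_of {e x, e y})"
    using eq eq1 e by simp
  also have "\<dots> \<longleftrightarrow> e z = vpair (e x) (e y)"
    unfolding vpair_def using eq[OF e(1) in_N] by simp
  finally show ?thesis .
qed

lemma vpair_in_pair_closed:
  assumes "pair_closed N" "x \<in> N" "y \<in> N"
  shows "vpair x y \<in> N"
  unfolding vpair_def
  using pair_closedD(2)[OF assms(1)] assms(2,3) pair_closedD(2)[OF assms(1) assms(2) assms(2)] by simp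

lemma sat_PairIn_fm':
  assumes N: "pair_closed N" and e: "e f \<in> N" "e x \<in> N" "e y \<in> N"
    and "f \<notin> {7, 8, 9}" "x \<notin> {7, 8, 9}" "y \<notin> {7, 8, 9}"
  shows "sat N (PairIn_fm x y f) e \<longleftrightarrow> vpair (e x) (e y) \<in> elts (e f)"
proof -
  have "sat N (PairIn_fm x y f) e \<longleftrightarrow> (\<exists>p \<in> N. p \<in> elts (e f) \<and> sat N (Pair_fm 9 x y) (e(9 := p)))"
    using assms unfolding PairIn_fm_def by simp
  also have "\<dots> \<longleftrightarrow> (\<exists>p \<in> N. p \<in> elts (e f) \<and> p = vpair (e x) (e y))"
  proof (rule bex_cong[OF refl])
    fix p assume "p \<in> N"
    then show "(p \<in> elts (e f) \<and> sat N (Pair_fm 9 x y) (e(9 := p))) \<longleftrightarrow>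
        (p \<in> elts (e f) \<and> p = vpair (e x) (e y))"
      using sat_Pair_fm'[OF N, of "e(9 := p)" 9 x y] assms by simp
  qed
  also have "\<dots> \<longleftrightarrow> vpair (e x) (e y) \<in> elts (e f)" using pair_closedD(1)[OF N e(1)] by blast
  finally show ?thesis .
qed

section \<open>Definable sets in elementary submodels\<close>

lemma elementary_ex:
  assumes "M \<prec>\<^sub>e N" "range e \<subseteq> M" "\<exists>x \<in> N. sat N \<phi> (e(i := x))"
  shows "\<exists>x \<in> M. sat N \<phi> (e(i := x))"
proof -
  have el: "sat M \<psi> e' \<longleftrightarrow> sat N \<psi> e'" if "range e' \<subseteq> M" for \<psi> e'
    using assms(1) that unfolding elementary_def by blast
  have "sat N (Exists i \<phi>) e" using assms(3) by (simp only: sat_connectives(4))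
  then have "sat M (Exists i \<phi>) e" by (rule iffD2[OF el[OF assms(2)]])
  then obtain x where x: "x \<in> M" "sat M \<phi> (e(i := x))" by (auto simp only: sat_connectives(4))
  have "range (e(i := x)) \<subseteq> M" using x(1) assms(2) by auto
  then have "sat N \<phi> (e(i := x))" using x(2) by (rule iffD1[OF el])
  then show ?thesis using x(1) by blast
qed

text \<open>The comprehension belongs to \<open>H \<theta>\<close> and satisfies a formula with
  parameters in \<open>M\<close>; a witness in \<open>M\<close> has the same elements because
  \<open>H \<theta>\<close> is transitive. Variable 0 is the set to be found, 1 runs over its
  elements, and 2 is the set from which they are separated.\<close>

lemma elementary_Collect:
  assumes M: "M \<prec>\<^sub>e H \<theta>" and Ord: "Ord \<theta>" and e: "range e \<subseteq> M"
    and \<phi>: "\<And>x y. x \<in> H \<theta> \<Longrightarrow> y \<in> H \<theta> \<Longrightarrow> sat (H \<theta>) \<phi> (e(0 := x, 1 := y)) \<longleftrightarrow> Q y"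
  shows "set_of {y \<in> elts (e 2). Q y} \<in> M"
proof -
  let ?b = "set_of {y \<in> elts (e 2). Q y}"
  have b: "elts ?b = {y \<in> elts (e 2). Q y}"
    by (rule elts_set_of_small, rule small_subset[OF small_elts[of "e 2"]]) blast
  have e2: "e 2 \<in> H \<theta>" using M e unfolding elementary_def by blast
  then have bH: "?b \<in> H \<theta>" by (rule H_subset[OF Ord]) (simp add: b)
  let ?\<psi> = "Forall 1 (Iff (Mem 1 0) (Conj (Mem 1 2) \<phi>))"
  have \<psi>: "sat (H \<theta>) ?\<psi> (e(0 := x)) \<longleftrightarrow> (\<forall>y \<in> H \<theta>. y \<in> elts x \<longleftrightarrow> y \<in> elts (e 2) \<and> Q y)"
    if "x \<in> H \<theta>" for x
  proof -
    have "sat (H \<theta>) ?\<psi> (e(0 := x)) \<longleftrightarrow>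
        (\<forall>y \<in> H \<theta>. y \<in> elts x \<longleftrightarrow> y \<in> elts (e 2) \<and> sat (H \<theta>) \<phi> (e(0 := x, 1 := y)))"
      by (simp only: sat_connectives(2) sat.simps(5)) simp
    then show ?thesis using \<phi>[OF that] by (simp cong: ball_cong)
  qed
  have "\<exists>x \<in> H \<theta>. sat (H \<theta>) ?\<psi> (e(0 := x))" using \<psi>[OF bH] b bH by blast
  then obtain x where x: "x \<in> M" "sat (H \<theta>) ?\<psi> (e(0 := x))" using elementary_ex[OF M e] by blast
  have xH: "x \<in> H \<theta>" using x(1) M unfolding elementary_def by blast
  have "elts x = elts ?b"
    using x(2) \<psi>[OF xH] H_mem[OF Ord xH] H_mem[OF Ord e2] unfolding b by blast
  then show ?thesis using x(1) extensionality[of x ?b] by simp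
qed

lemma elementary_Int:
  assumes M: "M \<prec>\<^sub>e H \<theta>" and Ord: "Ord \<theta>" and "a \<in> M" "b \<in> M"
  shows "set_of (elts a \<inter> elts b) \<in> M"
proof -
  have "set_of {y \<in> elts ((\<lambda>i. if i = 2 then a else b) (2::nat)). y \<in> elts b} \<in> M"
    by (rule elementary_Collect[OF M Ord, where \<phi> = "Mem 1 3"]) (use assms in auto)
  moreover have "{y \<in> elts a. y \<in> elts b} = elts a \<inter> elts b" by blast
  ultimately show ?thesis by simp
qed

text \<open>The image of \<open>u\<close> is definable from \<open>u\<close> and \<open>v\<close>,
  by the existence of a graph that satisfies the collapsing recursion on \<open>v\<close>. The graph
  lies in \<open>H \<theta>\<close> because \<open>v\<close> is countable.\<close>

lemma elementary_collapse:
  assumes M: "M \<prec>\<^sub>e H \<theta>" and \<theta>: "regular \<theta>" "uncountable (elts \<theta>)"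
    and "v \<in> M" "u \<in> M" "elts u \<subseteq> elts v" "countable (elts v)"
    and cH: "\<And>\<xi>. \<xi> \<in> elts v \<Longrightarrow> collapse (elts v) \<xi> \<in> H \<theta>"
  shows "set_of (collapse (elts v) ` elts u) \<in> M"
proof -
  let ?N = "H \<theta>" and ?h = "collapse (elts v)"
  have Ord: "Ord \<theta>" using \<theta>(1) unfolding regular_def by simp
  have N: "pair_closed ?N" using pair_closed_H[OF \<theta>] .
  have MN: "x \<in> ?N" if "x \<in> M" for x using M that unfolding elementary_def by blast
  have tr: "y \<in> ?N" if "x \<in> ?N" "y \<in> elts x" for x y using H_mem[OF Ord that] .
  have vN: "\<And>\<xi>. \<xi> \<in> elts v \<Longrightarrow> \<xi> \<in> ?N" using tr[OF MN[OF assms(4)]] .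
  let ?e = "\<lambda>i :: nat. if i = 10 then v else u"
  have e: "range ?e \<subseteq> M" using assms(4,5) by auto
  \<comment> \<open>Variable 0 is the image and 1 the graph. The parameters \<open>v\<close> and
    \<open>u\<close> are 10 and 11, out of the way of the variables 7 to 9 bound in
    \<open>PairIn_fm\<close>.\<close>
  let ?\<phi> = "Exists 1 (Conj (Conj
      (ForallIn 2 10 (Exists 3 (Conj (PairIn_fm 2 3 1)
        (Forall 4 (Iff (Mem 4 3) (ExistsIn 5 10 (Conj (Mem 5 2) (PairIn_fm 5 4 1))))))))
      (ForallIn 2 10 (Forall 3 (Forall 4 (Imp (Conj (PairIn_fm 2 3 1) (PairIn_fm 2 4 1)) (Eq 3 4))))))
      (Forall 3 (Iff (Mem 3 0) (ExistsIn 2 11 (PairIn_fm 2 3 1)))))"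
  define P where "P c G \<longleftrightarrow>
      (\<forall>\<xi> \<in> ?N. \<xi> \<in> elts v \<longrightarrow> (\<exists>w \<in> ?N. vpair \<xi> w \<in> elts G \<and>
        (\<forall>z \<in> ?N. z \<in> elts w \<longleftrightarrow> (\<exists>\<eta> \<in> ?N. \<eta> \<in> elts v \<and> \<eta> \<in> elts \<xi> \<and> vpair \<eta> z \<in> elts G)))) \<and>
      (\<forall>\<xi> \<in> ?N. \<xi> \<in> elts v \<longrightarrow> (\<forall>w \<in> ?N. \<forall>w' \<in> ?N. vpair \<xi> w \<in> elts G \<and> vpair \<xi> w' \<in> elts G \<longrightarrow> w = w')) \<and>
      (\<forall>z \<in> ?N. z \<in> elts c \<longleftrightarrow> (\<exists>\<xi> \<in> ?N. \<xi> \<in> elts u \<and> vpair \<xi> z \<in> elts G))" for c G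
  have sat: "sat ?N ?\<phi> (?e(0 := c)) \<longleftrightarrow> (\<exists>G \<in> ?N. P c G)" if "c \<in> ?N" for c
    unfolding P_def using that MN[OF assms(4)] MN[OF assms(5)]
    by (simp only: sat_connectives(3,4) sat.simps(1,2,4,5) iff_conv_conj_imp[symmetric])
      (simp add: sat_PairIn_fm'[OF N] cong: ball_cong bex_cong)
  define G where "G = set_of ((\<lambda>\<xi>. vpair \<xi> (?h \<xi>)) ` elts v)"
  have "(\<lambda>\<xi>. vpair \<xi> (?h \<xi>)) ` elts v \<subseteq> ?N"
    using vpair_in_pair_closed[OF N vN cH] by blast
  then have G: "elts G = (\<lambda>\<xi>. vpair \<xi> (?h \<xi>)) ` elts v" "G \<in> ?N"
    using set_of_H[OF \<theta>] assms(7) unfolding G_def by simp_all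
  define c where "c = set_of (?h ` elts u)"
  have "?h ` elts u \<subseteq> ?N" using cH assms(6) by blast
  moreover have "countable (?h ` elts u)" using assms(6,7) countable_subset by blast
  ultimately have c: "elts c = ?h ` elts u" "c \<in> ?N"
    using set_of_H[OF \<theta>] unfolding c_def by simp_all
  have "P c G"
    unfolding P_def
  proof (intro conjI ballI impI)
    fix \<xi> assume \<xi>: "\<xi> \<in> elts v"
    have "z \<in> elts (?h \<xi>) \<longleftrightarrow> (\<exists>\<eta> \<in> ?N. \<eta> \<in> elts v \<and> \<eta> \<in> elts \<xi> \<and> vpair \<eta> z \<in> elts G)" for z
      unfolding elts_collapse G(1) using vN by auto
    then show "\<exists>w \<in> ?N. vpair \<xi> w \<in> elts G \<and>
        (\<forall>z \<in> ?N. z \<in> elts w \<longleftrightarrow> (\<exists>\<eta> \<in> ?N. \<eta> \<in> elts v \<and> \<eta> \<in> elts \<xi> \<and> vpair \<eta> z \<in> elts G))"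
      using cH[OF \<xi>] \<xi> G(1) by (intro bexI[of _ "?h \<xi>"]) auto
  next
    fix z
    show "z \<in> elts c \<longleftrightarrow> (\<exists>\<xi> \<in> ?N. \<xi> \<in> elts u \<and> vpair \<xi> z \<in> elts G)"
      unfolding c(1) G(1) using vN assms(6) by auto
  qed (auto simp: G(1))
  then have "\<exists>c \<in> ?N. sat ?N ?\<phi> (?e(0 := c))" using sat[OF c(2)] G(2) c(2) by blast
  from elementary_ex[OF M e this] obtain c' where c': "c' \<in> M" "sat ?N ?\<phi> (?e(0 := c'))" ..
  then obtain G' where G': "G' \<in> ?N" "P c' G'" using sat[OF MN[OF c'(1)]] by blast
  note P = G'(2)[unfolded P_def]
  have P1: "\<exists>w. vpair \<xi> w \<in> elts G' \<and> w \<in> ?N \<and>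
      (\<forall>z \<in> ?N. z \<in> elts w \<longleftrightarrow> (\<exists>\<eta>. \<eta> \<in> elts v \<and> \<eta> \<in> elts \<xi> \<and> vpair \<eta> z \<in> elts G'))"
    if \<xi>: "\<xi> \<in> elts v" for \<xi>
  proof -
    obtain w where w: "w \<in> ?N" "vpair \<xi> w \<in> elts G'"
      "\<forall>z \<in> ?N. z \<in> elts w \<longleftrightarrow> (\<exists>\<eta> \<in> ?N. \<eta> \<in> elts v \<and> \<eta> \<in> elts \<xi> \<and> vpair \<eta> z \<in> elts G')"
      using conjunct1[OF P] vN[OF \<xi>] \<xi> by blast
    have "(\<exists>\<eta> \<in> ?N. \<eta> \<in> elts v \<and> \<eta> \<in> elts \<xi> \<and> vpair \<eta> z \<in> elts G') \<longleftrightarrow>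
        (\<exists>\<eta>. \<eta> \<in> elts v \<and> \<eta> \<in> elts \<xi> \<and> vpair \<eta> z \<in> elts G')" for z
      using vN by blast
    then show ?thesis using w by (intro exI[of _ w]) simp
  qed
  have P2: "w = w'" if "\<xi> \<in> elts v" "w \<in> ?N" "w' \<in> ?N" "vpair \<xi> w \<in> elts G'" "vpair \<xi> w' \<in> elts G'" for \<xi> w w'
    using conjunct1[OF conjunct2[OF P]] vN[OF that(1)] that by blast
  have P3: "z \<in> elts c' \<longleftrightarrow> (\<exists>\<xi>. \<xi> \<in> elts u \<and> vpair \<xi> z \<in> elts G')" if "z \<in> ?N" for z
    using conjunct2[OF conjunct2[OF P]] that vN assms(6) by blast
  \<comment> \<open>The recursion has only one solution on \<open>v\<close>, so whichever graph
    accompanies \<open>c'\<close> agrees there with the collapse.\<close>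
  have G'_eq: "\<xi> \<in> elts v \<Longrightarrow> vpair \<xi> z \<in> elts G' \<and> z \<in> ?N \<longleftrightarrow> z = ?h \<xi>" for \<xi> z
  proof (induction \<xi> arbitrary: z rule: elts_induct)
    case (step \<xi>)
    obtain w where w: "vpair \<xi> w \<in> elts G'" "w \<in> ?N"
      "\<forall>z \<in> ?N. z \<in> elts w \<longleftrightarrow> (\<exists>\<eta>. \<eta> \<in> elts v \<and> \<eta> \<in> elts \<xi> \<and> vpair \<eta> z \<in> elts G')"
      using P1[OF step.prems] by blast
    have "elts w = ?h ` (elts \<xi> \<inter> elts v)"
    proof (intro equalityI subsetI)
      fix z assume z: "z \<in> elts w"
      then have "z \<in> ?N" using tr[OF w(2)] by blast
      then obtain \<eta> where "\<eta> \<in> elts v" "\<eta> \<in> elts \<xi>" "vpair \<eta> z \<in> elts G'" using w(3) z by blast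
      then show "z \<in> ?h ` (elts \<xi> \<inter> elts v)" using step.IH[of \<eta> z] \<open>z \<in> ?N\<close> by blast
    next
      fix z assume "z \<in> ?h ` (elts \<xi> \<inter> elts v)"
      then obtain \<eta> where "\<eta> \<in> elts \<xi>" "\<eta> \<in> elts v" "z = ?h \<eta>" by blast
      then show "z \<in> elts w" using step.IH[of \<eta> z] w(3) by blast
    qed
    then have "w = ?h \<xi>" by (intro extensionality) (simp add: elts_collapse)
    then show ?case using w P2[OF step.prems w(2) _ w(1)] by blast
  qed
  have "elts c' = elts c"
  proof (intro equalityI subsetI)
    fix z assume z: "z \<in> elts c'"
    then have "z \<in> ?N" using tr[OF MN[OF c'(1)]] by blast
    then obtain \<xi> where \<xi>: "\<xi> \<in> elts u" "vpair \<xi> z \<in> elts G'" using P3 z by blast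
    then have "z = ?h \<xi>" using G'_eq[of \<xi> z] assms(6) \<open>z \<in> ?N\<close> by blast
    then show "z \<in> elts c" using \<xi> c(1) by blast
  next
    fix z assume "z \<in> elts c"
    then obtain \<xi> where \<xi>: "\<xi> \<in> elts u" "z = ?h \<xi>" using c(1) by blast
    then have "vpair \<xi> z \<in> elts G' \<and> z \<in> ?N" using G'_eq[of \<xi> z] assms(6) by blast
    then show "z \<in> elts c'" using P3 \<xi>(1) by blast
  qed
  then have "c' = c" by (rule extensionality)
  then show ?thesis using c'(1) unfolding c_def by simp
qed

lemma countable_collapse: "countable v \<Longrightarrow> countable (elts (collapse v x))"
  unfolding elts_collapse by (intro countable_image countable_Int2)

lemma collapse_in_omega1: "countable v \<Longrightarrow> Ord \<xi> \<Longrightarrow> collapse v \<xi> \<in> W1"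
  unfolding elts_omega1 by (intro CollectI conjI countable_collapse Ord_collapse)

lemma omega1_subset_H:
  fixes \<theta> :: "'v::set_universe"
  assumes "Ord \<theta>" "uncountable (elts \<theta>)"
  shows "W1 \<subseteq> H \<theta>"
proof
  fix \<alpha> :: 'v assume "\<alpha> \<in> W1"
  then have "trcl \<alpha> \<lesssim> elts (omega :: 'v)"
    by (intro countable_lepoll_infinite infinite_omega) (simp add: elts_omega1 trcl_Ord)
  then show "\<alpha> \<in> H \<theta>"
    unfolding H_def using size_lessI[OF assms(1) omega_in_uncountable[OF assms]] by simp
qed

text \<open>Let \<open>N\<close> be the collapse of \<open>M\<close>. If all reals were in
  \<open>M\<close>, they would be in \<open>N\<close>, and through an injection into omega so would
  all subsets of any \<open>z\<close> that is countable in \<open>N\<close>. Then every subset of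
  omega1 would be approximated in \<open>N\<close>, hence an element of \<open>N\<close>, contrary
  to Cantor's theorem, as \<open>N\<close> has size at most omega1.\<close>

lemma guessing_omits_real:
  fixes M :: "'v::set_universe set"
  assumes "M \<in> G_omega1"
  shows "\<exists>r \<subseteq> elts omega. set_of r \<notin> M"
proof (rule ccontr)
  assume "\<not> ?thesis"
  then have reals: "set_of r \<in> M" if "r \<subseteq> elts omega" for r using that by blast
  define N where "N = collapse M ` M"
  have M: "W1 \<subseteq> M" "M \<approx> (W1 :: 'v set)" and ap: "omega1_approximation_property N"
    using assms unfolding G_omega1_def omega1_guessing_def N_def by simp_all
  have tr: "\<forall>x \<in> N. elts x \<subseteq> N" and zf: "ZF_minus N" and o1: "omega1 \<in> N"
    and approx: "\<forall>\<eta> \<in> N. \<forall>A \<subseteq> elts \<eta>. (\<forall>z \<in> N. countable_in N z \<longrightarrow> set_of (elts z \<inter> A) \<in> N) \<longrightarrow> set_of A \<in> N"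
    using ap unfolding omega1_approximation_property_def by simp_all
  have omN: "elts omega \<subseteq> N" using tr o1 omega_subset_omega1 by blast
  have N: "pair_closed N"
    unfolding pair_closed_def
  proof (intro conjI ballI)
    show "elts x \<subseteq> N" if "x \<in> N" for x using tr that by blast
    fix x y assume xy: "x \<in> N" "y \<in> N"
    have "\<forall>x \<in> N. \<forall>y \<in> N. \<exists>z \<in> N. \<forall>w \<in> N. w \<in> elts z \<longleftrightarrow> w = x \<or> w = y"
      using zf unfolding ZF_minus_def by (elim conjE)
    then obtain z where z: "z \<in> N" "\<forall>w \<in> N. w \<in> elts z \<longleftrightarrow> w = x \<or> w = y" using xy by blast
    have "elts z = {x, y}" using z xy tr by blast
    then show "set_of {x, y} \<in> N" using z(1) by (metis set_of_elts)
  qed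
  have sep: "\<forall>\<phi> e. range e \<subseteq> N \<longrightarrow>
      (\<forall>a \<in> N. \<exists>b \<in> N. \<forall>x \<in> N. x \<in> elts b \<longleftrightarrow> x \<in> elts a \<and> sat N \<phi> (e(0 := x)))"
    using zf unfolding ZF_minus_def by (elim conjE)
  have "set_of (elts z \<inter> A) \<in> N" if z: "z \<in> N" "countable_in N z" for z A
  proof -
    obtain f where f: "inj_on f (elts z)" "f ` elts z \<subseteq> elts omega"
      "set_of ((\<lambda>x. vpair x (f x)) ` elts z) \<in> N"
      using z(2) unfolding countable_in_def by blast
    define g where "g = set_of ((\<lambda>x. vpair x (f x)) ` elts z)"
    have g: "elts g = (\<lambda>x. vpair x (f x)) ` elts z" "g \<in> N"
    proof -
      show "elts g = (\<lambda>x. vpair x (f x)) ` elts z"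
        using graph_exists[OF f(2)] unfolding g_def by (metis set_of_elts)
      show "g \<in> N" using f(3) unfolding g_def .
    qed
    \<comment> \<open>The real to which \<open>f\<close> maps the subset. Collapsing does not move
      it, and Separation in \<open>N\<close> recovers the subset from it and the graph
      \<open>g\<close>.\<close>
    define r where "r = f ` (elts z \<inter> A)"
    have r: "r \<subseteq> elts omega" using f(2) unfolding r_def by blast
    then have sr: "elts (set_of r) = r" by (intro elts_set_of_small small_subset[OF small_elts])
    have "collapse M (set_of r) = set_of r"
    proof (rule collapse_id_subset)
      show "elts z \<subseteq> elts omega" if "z \<in> elts omega" for z :: 'v
        using Ord_subset[OF Ord_omega that] .
      show "elts omega \<subseteq> M" using omega_subset_omega1 M(1) by (rule order_trans)
      show "elts (set_of r) \<subseteq> elts omega" using r sr by simp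
    qed
    then have rN: "set_of r \<in> N" using reals[OF r] unfolding N_def by (metis imageI)
    let ?e = "\<lambda>i :: nat. if i = 2 then set_of r else g"
    let ?\<phi> = "Exists 1 (Conj (Mem 1 2) (PairIn_fm 0 1 3))"
    have "range ?e \<subseteq> N" using rN g(2) by auto
    with sep z(1) obtain b where b: "b \<in> N" "\<forall>x \<in> N. x \<in> elts b \<longleftrightarrow> x \<in> elts z \<and> sat N ?\<phi> (?e(0 := x))"
      by blast
    have sat: "sat N ?\<phi> (?e(0 := x)) \<longleftrightarrow> (\<exists>y \<in> N. y \<in> r \<and> vpair x y \<in> elts g)" if "x \<in> N" for x
      using that g(2) by (simp only: sat_connectives(4) sat.simps(1,4))
        (simp add: sat_PairIn_fm'[OF N] sr cong: bex_cong)
    have "x \<in> elts b \<longleftrightarrow> x \<in> elts z \<inter> A" if x: "x \<in> N" for x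
    proof -
      have "(\<exists>y \<in> N. y \<in> r \<and> vpair x y \<in> elts g) \<longleftrightarrow> x \<in> A" if xz: "x \<in> elts z"
      proof
        assume "\<exists>y \<in> N. y \<in> r \<and> vpair x y \<in> elts g"
        then obtain x' where x': "x' \<in> elts z" "x' \<in> A" "vpair x (f x') \<in> elts g" unfolding r_def by blast
        then have "f x = f x'" unfolding g(1) by auto
        then have "x = x'" using inj_onD[OF f(1)] xz x'(1) by blast
        then show "x \<in> A" using x'(2) by simp
      next
        assume "x \<in> A"
        then have "f x \<in> r" "vpair x (f x) \<in> elts g" using xz unfolding r_def g(1) by blast+
        then show "\<exists>y \<in> N. y \<in> r \<and> vpair x y \<in> elts g" using r omN by blast
      qed
      then show ?thesis using b(2) sat[OF x] x by blast
    qed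
    moreover have "elts b \<subseteq> N" "elts z \<subseteq> N" using tr b(1) z(1) by blast+
    ultimately have "elts b = elts z \<inter> A" by blast
    then show ?thesis using b(1) by (metis set_of_elts)
  qed
  then have all: "set_of A \<in> N" if "A \<subseteq> W1" for A using approx o1 that by blast
  have "inj_on set_of (Pow (W1 :: 'v set))"
  proof (rule inj_onI)
    fix A B :: "'v set" assume AB: "A \<in> Pow W1" "B \<in> Pow W1" "set_of A = set_of B"
    then have "small A" "small B" using small_subset[OF small_elts] by blast+
    then show "A = B" using AB(3) set_of_inject_small by blast
  qed
  then have "Pow (W1 :: 'v set) \<lesssim> N" using all unfolding lepoll_def by blast
  also have "N \<lesssim> M" unfolding N_def by (rule image_lepoll)
  also have "M \<approx> (W1 :: 'v set)" by (rule M(2))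
  finally show False using lesspoll_Pow_self[of "W1 :: 'v set"] unfolding lesspoll_iff_not_lepoll by blast
qed

section \<open>The stationary set of sets not coded in a guessing model\<close>

text \<open>Here omega2 has the role of \<delta>, and \<open>M\<close> that of the ground model. The
  codes are countable sets of countable ordinals; so they lie in \<open>H \<nu>\<close> for every
  \<nu> above omega1, and codes found in a larger \<open>M'\<close> survive the intersection with
  \<open>H \<nu>\<close>.\<close>

definition coded_in :: "'v::set_universe set \<Rightarrow> 'v set set" where
  "coded_in M = {x \<in> countable_subsets W2.
     \<exists>D. club W2 D \<and> (\<forall>y \<in> D. x \<subseteq> y \<longrightarrow> set_of (collapse y ` x) \<in> M)}"

definition uncoded :: "'v::set_universe set \<Rightarrow> 'v set set" where
  "uncoded M = {x \<in> countable_subsets W2. enum_closed x \<and> x \<notin> coded_in M}"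

lemma club_enum_closed: "club (W2 :: 'v::set_universe set) {x \<in> countable_subsets W2. enum_closed x}"
proof -
  define G :: "'v set \<Rightarrow> 'v set" where "G s = (\<Union>\<alpha> \<in> s. enum \<alpha> ` (s \<inter> W1))" for s
  have "club (W2 :: 'v set) {x \<in> countable_subsets W2. closed_under G x}"
  proof (rule club_closed_under)
    fix s :: "'v set" assume s: "finite s" "s \<subseteq> W2"
    have "countable (G s)"
      unfolding G_def using s(1)
      by (intro countable_UN countable_image countable_Int1) (auto intro: countable_finite)
    moreover have "G s \<subseteq> W2" unfolding G_def using s(2) enum_in_omega2 by blast
    ultimately show "countable (G s) \<and> G s \<subseteq> W2" ..
  qed
  moreover have "closed_under G x \<longleftrightarrow> enum_closed x" for x
  proof
    assume cl: "closed_under G x"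
    show "enum_closed x"
      unfolding enum_closed_def
    proof (intro ballI)
      fix \<alpha> i assume "\<alpha> \<in> x" "i \<in> x \<inter> W1"
      then have "enum \<alpha> i \<in> G {\<alpha>, i}" "{\<alpha>, i} \<subseteq> x" unfolding G_def by auto
      moreover have "G {\<alpha>, i} \<subseteq> x" using cl \<open>{\<alpha>, i} \<subseteq> x\<close> unfolding closed_under_def by simp
      ultimately show "enum \<alpha> i \<in> x" by blast
    qed
  next
    assume "enum_closed x"
    then show "closed_under G x" unfolding enum_closed_def closed_under_def G_def by blast
  qed
  ultimately show ?thesis by simp
qed

text \<open>
  Decoding: \<open>a\<close> meets the intervals \<open>[\<zeta> (3 n), \<zeta> (3 n + 1))\<close>, and of the two intervals following
  it one is met by \<open>b\<close> and the other one by \<open>c\<close>. The elements of \<open>a\<close> beginning a new interval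
  have order type \<open>\<omega>\<close>, and the \<open>n\<close>-th of them tells from the relative order of \<open>b\<close> and \<open>c\<close> whether
  \<open>n \<in> R\<close>.
\<close>

definition marks :: "'v::set_universe \<Rightarrow> 'v set \<Rightarrow> 'v set \<Rightarrow> 'v set" where
  "marks z a b = {\<xi> \<in> a. \<xi> \<notin> elts z \<and>
     \<not> (\<exists>\<eta> \<in> a. \<eta> \<notin> elts z \<and> \<eta> \<in> elts \<xi> \<and> \<not> (\<exists>\<chi> \<in> b. \<eta> \<in> elts \<chi> \<and> \<chi> \<in> elts \<xi>))}"

definition marked :: "'v::set_universe \<Rightarrow> 'v set \<Rightarrow> 'v set \<Rightarrow> 'v set \<Rightarrow> 'v set" where
  "marked z a b c = {\<xi> \<in> marks z a b. \<exists>\<chi> \<in> c. \<xi> \<in> elts \<chi> \<and> \<not> (\<exists>\<chi>' \<in> b. \<xi> \<in> elts \<chi>' \<and> \<chi>' \<in> elts \<chi>)}"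

text \<open>In the \<open>n\<close>-th block of three stages, the first one serves \<open>a\<close>,
  the second one serves \<open>c\<close> if \<open>n\<close> is in \<open>R\<close> and
  \<open>b\<close> otherwise, and the third one serves the remaining set. Thus \<open>n\<close> is
  in \<open>R\<close> iff \<open>c\<close> comes before \<open>b\<close>. As \<open>b\<close> occurs
  in every block, it separates the parts of \<open>a\<close> in different blocks. What the sets
  contain below \<open>\<zeta> 0\<close> is not controlled and has to be cut off.\<close>

lemma decode:
  fixes A :: "bool option \<Rightarrow> 'v::set_universe set" and R :: "nat set"
  defines "\<pi> \<equiv> (\<lambda>k :: nat. if k mod 3 = 0 then None else Some ((k div 3 \<in> R) \<longleftrightarrow> k mod 3 = 1))"
  assumes A: "\<And>j. A j \<subseteq> (\<Union>n. elts (\<zeta> n))"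
    and \<zeta>: "\<And>n. \<zeta> n \<in> W2" "\<And>n. \<zeta> n \<in> elts (\<zeta> (Suc n))"
    and meets: "\<And>j n. A j \<inter> (elts (\<zeta> (Suc n)) - elts (\<zeta> n)) \<noteq> {} \<longleftrightarrow> \<pi> n = j"
  shows "\<exists>p. (\<forall>m n. p m \<in> elts (p n) \<longleftrightarrow> m < n) \<and>
    marks (\<zeta> 0) (A None) (A (Some False)) = range p \<and>
    marked (\<zeta> 0) (A None) (A (Some False)) (A (Some True)) = p ` R"
proof -
  define J where "J n = elts (\<zeta> (Suc n)) - elts (\<zeta> n)" for n
  have Ord\<zeta>: "Ord (\<zeta> n)" for n using Ord_in[OF Ord_omega2 \<zeta>(1)] .
  have mono: "elts (\<zeta> m) \<subseteq> elts (\<zeta> n)" if "m \<le> n" for m n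
    using that by (rule lift_Suc_mono_le[of "\<lambda>n. elts (\<zeta> n)", rotated]) (rule Ord_subset[OF Ord\<zeta> \<zeta>(2)])
  have J_Ord: "Ord \<xi>" if "\<xi> \<in> J n" for \<xi> n using that Ord_in[OF Ord\<zeta>] unfolding J_def by blast
  have J_less: "\<xi> \<in> elts \<chi>" if "\<xi> \<in> J k" "\<chi> \<in> J l" "k < l" for \<xi> \<chi> k l
  proof -
    have "\<xi> \<in> elts (\<zeta> l)" using that(1) mono[of "Suc k" l] that(3) unfolding J_def by auto
    moreover have "elts (\<zeta> l) \<subseteq> elts \<chi>"
      using Ord_not_in_iff[OF J_Ord[OF that(2)] Ord\<zeta>] that(2) unfolding J_def by blast
    ultimately show ?thesis by blast
  qed
  have J_le: "k \<le> l" if "\<xi> \<in> J k" "\<chi> \<in> J l" "\<xi> \<in> elts \<chi>" for \<xi> \<chi> k l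
    using J_less[OF that(2,1)] elts_asym[OF that(3)] by (meson not_le)
  have J_ex: "\<exists>n. \<xi> \<in> J n \<and> \<pi> n = j" if \<xi>: "\<xi> \<in> A j" "\<xi> \<notin> elts (\<zeta> 0)" for \<xi> j
  proof -
    have ex: "\<exists>n. \<xi> \<in> elts (\<zeta> n)" using A[of j] \<xi>(1) by blast
    define n where "n = (LEAST n. \<xi> \<in> elts (\<zeta> n))"
    have n: "\<xi> \<in> elts (\<zeta> n)" unfolding n_def using ex by (rule LeastI_ex)
    then obtain m where m: "n = Suc m" using \<xi>(2) by (cases n) auto
    have "\<xi> \<notin> elts (\<zeta> m)" using not_less_Least[of m "\<lambda>n. \<xi> \<in> elts (\<zeta> n)"] m unfolding n_def by simp
    then have "\<xi> \<in> J m" using n m unfolding J_def by simp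
    then show ?thesis using meets[of j m] \<xi>(1) unfolding J_def by blast
  qed
  have J_0: "\<xi> \<notin> elts (\<zeta> 0)" if "\<xi> \<in> J n" for \<xi> n
    using that mono[of 0 n] unfolding J_def by blast
  have above_0: "\<chi> \<notin> elts (\<zeta> 0)" if "\<xi> \<in> J n" "\<xi> \<in> elts \<chi>" for \<xi> \<chi> n
    using J_0[OF that(1)] Ord_trans[OF Ord\<zeta>[of 0]] that(2) by blast
  have \<pi>: "\<pi> (3 * n) = None" "\<pi> (3 * n + 1) = Some (n \<in> R)" "\<pi> (3 * n + 2) = Some (n \<notin> R)" for n
  proof -
    have "(3 * n + 1) div 3 = n" "(3 * n + 1) mod 3 = 1" "(3 * n + 2) div 3 = n" "(3 * n + 2) mod 3 = 2"
      by presburger+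
    then show "\<pi> (3 * n) = None" "\<pi> (3 * n + 1) = Some (n \<in> R)" "\<pi> (3 * n + 2) = Some (n \<notin> R)"
      unfolding \<pi>_def by simp_all
  qed
  have \<pi>_None: "\<exists>n. k = 3 * n" if "\<pi> k = None" for k
    using that unfolding \<pi>_def by (intro exI[of _ "k div 3"]) (auto split: if_splits)
  have ne: "\<exists>\<xi>. \<xi> \<in> A j \<and> \<xi> \<in> J n" if "\<pi> n = j" for j n
    using meets[of j n] that unfolding J_def by blast
  let ?a = "A None" and ?b = "A (Some False)" and ?c = "A (Some True)"
  have "\<exists>\<xi>. \<xi> \<in> ?a \<inter> J (3 * n) \<and> (\<forall>\<eta> \<in> ?a \<inter> J (3 * n). \<eta> \<notin> elts \<xi>)" for n
  proof -
    have "?a \<inter> J (3 * n) \<noteq> {}" using ne[OF \<pi>(1)] by blast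
    moreover have "?a \<inter> J (3 * n) \<subseteq> elts (\<zeta> (Suc (3 * n)))" unfolding J_def by blast
    ultimately show ?thesis using elts_least[OF Ord\<zeta>] by blast
  qed
  then obtain p where p: "\<And>n. p n \<in> ?a" "\<And>n. p n \<in> J (3 * n)"
    "\<And>n \<eta>. \<eta> \<in> ?a \<Longrightarrow> \<eta> \<in> J (3 * n) \<Longrightarrow> \<eta> \<notin> elts (p n)" by (metis IntD1 IntD2 IntI)
  have p_less: "p m \<in> elts (p n) \<longleftrightarrow> m < n" for m n
  proof
    assume "p m \<in> elts (p n)"
    then have "m \<le> n" "m \<noteq> n" using J_le[OF p(2) p(2), of m n] by auto
    then show "m < n" by simp
  next
    assume "m < n"
    then show "p m \<in> elts (p n)" using J_less[OF p(2) p(2), of m n] by simp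
  qed
  have marks: "marks (\<zeta> 0) ?a ?b = range p"
  proof (intro equalityI subsetI)
    fix \<xi> assume "\<xi> \<in> marks (\<zeta> 0) ?a ?b"
    then have \<xi>: "\<xi> \<in> ?a" "\<xi> \<notin> elts (\<zeta> 0)"
      "\<And>\<eta>. \<eta> \<in> ?a \<Longrightarrow> \<eta> \<notin> elts (\<zeta> 0) \<Longrightarrow> \<eta> \<in> elts \<xi> \<Longrightarrow> \<exists>\<chi> \<in> ?b. \<eta> \<in> elts \<chi> \<and> \<chi> \<in> elts \<xi>"
      unfolding marks_def by blast+
    obtain k where k: "\<xi> \<in> J k" "\<pi> k = None" using J_ex[OF \<xi>(1,2)] by blast
    then obtain n where n: "k = 3 * n" using \<pi>_None by blast
    have "\<xi> = p n"
    proof (rule ccontr)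
      assume "\<xi> \<noteq> p n"
      moreover have "\<xi> \<notin> elts (p n)" using p(3)[OF \<xi>(1)] k(1) n by blast
      ultimately have pn: "p n \<in> elts \<xi>"
        using Ord_linear[OF J_Ord[OF k(1)] J_Ord[OF p(2)]] by blast
      then obtain \<chi> where \<chi>: "\<chi> \<in> ?b" "p n \<in> elts \<chi>" "\<chi> \<in> elts \<xi>"
        using \<xi>(3)[OF p(1) J_0[OF p(2)]] by blast
      obtain l where l: "\<chi> \<in> J l" "\<pi> l = Some False"
        using J_ex[OF \<chi>(1) above_0[OF p(2) \<chi>(2)]] by blast
      \<comment> \<open>A point of \<open>b\<close> between two points of one interval lies in that
        interval, which is reserved for \<open>a\<close>.\<close>
      have "l = 3 * n"
        using J_le[OF p(2) l(1) \<chi>(2)] J_le[OF l(1) k(1) \<chi>(3)] n by simp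
      then show False using l(2) \<pi>(1) by simp
    qed
    then show "\<xi> \<in> range p" by blast
  next
    fix \<xi> assume "\<xi> \<in> range p"
    then obtain n where n: "\<xi> = p n" by blast
    have "\<exists>\<chi> \<in> ?b. \<eta> \<in> elts \<chi> \<and> \<chi> \<in> elts (p n)"
      if \<eta>: "\<eta> \<in> ?a" "\<eta> \<notin> elts (\<zeta> 0)" "\<eta> \<in> elts (p n)" for \<eta>
    proof -
      obtain k where k: "\<eta> \<in> J k" "\<pi> k = None" using J_ex[OF \<eta>(1,2)] by blast
      then obtain m where m: "k = 3 * m" using \<pi>_None by blast
      have "m \<noteq> n" using p(3)[OF \<eta>(1), of n] k(1) m \<eta>(3) by blast
      then have "m < n" using J_le[OF k(1) p(2) \<eta>(3)] m by simp
      obtain l where l: "\<pi> l = Some False" "3 * m < l" "l < 3 * m + 3"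
      proof (cases "m \<in> R")
        case True
        then show ?thesis using that[of "3 * m + 2"] \<pi>(3)[of m] by simp
      next
        case False
        then show ?thesis using that[of "3 * m + 1"] \<pi>(2)[of m] by simp
      qed
      obtain \<chi> where \<chi>: "\<chi> \<in> ?b" "\<chi> \<in> J l" using ne[OF l(1)] by blast
      have "\<eta> \<in> elts \<chi>" using J_less[OF k(1) \<chi>(2)] l(2) m by simp
      moreover have "\<chi> \<in> elts (p n)" using J_less[OF \<chi>(2) p(2)] l(3) \<open>m < n\<close> by simp
      ultimately show ?thesis using \<chi>(1) by blast
    qed
    then show "\<xi> \<in> marks (\<zeta> 0) ?a ?b"
      unfolding marks_def n using p(1)[of n] J_0[OF p(2)[of n]] by blast
  qed
  have "(\<exists>\<chi> \<in> ?c. p n \<in> elts \<chi> \<and> \<not> (\<exists>\<chi>' \<in> ?b. p n \<in> elts \<chi>' \<and> \<chi>' \<in> elts \<chi>)) \<longleftrightarrow> n \<in> R" for n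
  proof
    assume R: "n \<in> R"
    then obtain \<chi> where \<chi>: "\<chi> \<in> ?c" "\<chi> \<in> J (3 * n + 1)" using ne[OF \<pi>(2)[of n]] by auto
    have "\<not> (p n \<in> elts \<chi>' \<and> \<chi>' \<in> elts \<chi>)" if \<chi>': "\<chi>' \<in> ?b" for \<chi>'
    proof
      assume *: "p n \<in> elts \<chi>' \<and> \<chi>' \<in> elts \<chi>"
      then obtain l where l: "\<chi>' \<in> J l" "\<pi> l = Some False"
        using J_ex[OF \<chi>' above_0[OF p(2)]] by blast
      have "3 * n \<le> l" "l \<le> 3 * n + 1"
        using J_le[OF p(2) l(1)] J_le[OF l(1) \<chi>(2)] * by blast+
      then have "l = 3 * n \<or> l = 3 * n + 1" by linarith
      then show False using l(2) \<pi>(1,2)[of n] R by auto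
    qed
    moreover have "p n \<in> elts \<chi>" using J_less[OF p(2) \<chi>(2)] by simp
    ultimately show "\<exists>\<chi> \<in> ?c. p n \<in> elts \<chi> \<and> \<not> (\<exists>\<chi>' \<in> ?b. p n \<in> elts \<chi>' \<and> \<chi>' \<in> elts \<chi>)"
      using \<chi>(1) by blast
  next
    assume "\<exists>\<chi> \<in> ?c. p n \<in> elts \<chi> \<and> \<not> (\<exists>\<chi>' \<in> ?b. p n \<in> elts \<chi>' \<and> \<chi>' \<in> elts \<chi>)"
    then obtain \<chi> where \<chi>: "\<chi> \<in> ?c" "p n \<in> elts \<chi>" "\<And>\<chi>'. \<chi>' \<in> ?b \<Longrightarrow> p n \<in> elts \<chi>' \<Longrightarrow> \<chi>' \<notin> elts \<chi>"
      by blast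
    show "n \<in> R"
    proof (rule ccontr)
      assume R: "n \<notin> R"
      obtain l where l: "\<chi> \<in> J l" "\<pi> l = Some True"
        using J_ex[OF \<chi>(1) above_0[OF p(2) \<chi>(2)]] by blast
      have "3 * n \<le> l" using J_le[OF p(2) l(1) \<chi>(2)] .
      moreover have "l \<noteq> 3 * n" "l \<noteq> 3 * n + 1" using l(2) \<pi>(1,2)[of n] R by auto
      ultimately have l2: "3 * n + 1 < l" by linarith
      obtain \<chi>' where \<chi>': "\<chi>' \<in> ?b" "\<chi>' \<in> J (3 * n + 1)" using ne[OF \<pi>(2)[of n]] R by auto
      have "p n \<in> elts \<chi>'" using J_less[OF p(2) \<chi>'(2)] by simp
      moreover have "\<chi>' \<in> elts \<chi>" using J_less[OF \<chi>'(2) l(1) l2] .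
      ultimately show False using \<chi>(3) \<chi>'(1) by blast
    qed
  qed
  then have "marked (\<zeta> 0) ?a ?b ?c = p ` R"
    unfolding marked_def marks by blast
  with p_less marks show ?thesis by (intro exI[of _ p]) simp
qed

text \<open>Only the relative order of the points enters into \<open>marks\<close>, and
  \<open>collapse y\<close> preserves it on \<open>y\<close>, also in comparison with
  \<open>z\<close>.\<close>

lemma marks_collapse:
  assumes "a \<subseteq> y" "b \<subseteq> y" "y \<subseteq> W2" "z \<in> W2"
  shows "marks (collapse y z) (collapse y ` a) (collapse y ` b) = collapse y ` marks z a b"
proof -
  have Ord: "Ord \<xi>" if "\<xi> \<in> W2" for \<xi> :: 'a using Ord_in[OF Ord_omega2 that] .
  have iff: "collapse y \<xi> \<in> elts (collapse y \<eta>) \<longleftrightarrow> \<xi> \<in> elts \<eta>" if "\<xi> \<in> y" "\<eta> \<in> W2" for \<xi> \<eta>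
    using collapse_mem_iff[of \<xi> \<eta> y] that Ord assms(3) by blast
  have "collapse y \<xi> \<in> marks (collapse y z) (collapse y ` a) (collapse y ` b) \<longleftrightarrow> \<xi> \<in> marks z a b"
    if "\<xi> \<in> a" for \<xi>
  proof -
    have inj: "collapse y \<eta> = collapse y \<eta>' \<longleftrightarrow> \<eta> = \<eta>'" if "\<eta> \<in> y" "\<eta>' \<in> y" for \<eta> \<eta>'
      using collapse_inj[of \<eta> \<eta>' y] that Ord assms(3) by blast
    have "collapse y \<xi> \<in> collapse y ` a" using that by blast
    moreover have "(\<exists>\<eta> \<in> collapse y ` a. \<eta> \<notin> elts (collapse y z) \<and> \<eta> \<in> elts (collapse y \<xi>) \<and>
          \<not> (\<exists>\<chi> \<in> collapse y ` b. \<eta> \<in> elts \<chi> \<and> \<chi> \<in> elts (collapse y \<xi>))) \<longleftrightarrow>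
        (\<exists>\<eta> \<in> a. \<eta> \<notin> elts z \<and> \<eta> \<in> elts \<xi> \<and> \<not> (\<exists>\<chi> \<in> b. \<eta> \<in> elts \<chi> \<and> \<chi> \<in> elts \<xi>))"
    proof -
      have in_y: "\<eta> \<in> a \<Longrightarrow> \<eta> \<in> y" "\<eta> \<in> b \<Longrightarrow> \<eta> \<in> y" "\<eta> \<in> y \<Longrightarrow> \<eta> \<in> W2" for \<eta>
        using assms by blast+
      show ?thesis
        unfolding bex_simps using that assms(4)
        by (simp add: iff in_y cong: bex_cong)
    qed
    moreover have "collapse y \<xi> \<in> elts (collapse y z) \<longleftrightarrow> \<xi> \<in> elts z"
      using iff[of \<xi> z] that assms(1,4) by blast
    ultimately show ?thesis unfolding marks_def mem_Collect_eq using that by simp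
  qed
  moreover have "marks (collapse y z) (collapse y ` a) (collapse y ` b) \<subseteq> collapse y ` a"
    "marks z a b \<subseteq> a" unfolding marks_def by blast+
  ultimately show ?thesis by blast
qed

lemma marked_collapse:
  assumes "a \<subseteq> y" "b \<subseteq> y" "c \<subseteq> y" "y \<subseteq> W2" "z \<in> W2"
  shows "marked (collapse y z) (collapse y ` a) (collapse y ` b) (collapse y ` c) =
    collapse y ` marked z a b c"
proof -
  have Ord: "Ord \<xi>" if "\<xi> \<in> W2" for \<xi> :: 'a using Ord_in[OF Ord_omega2 that] .
  have iff: "collapse y \<xi> \<in> elts (collapse y \<eta>) \<longleftrightarrow> \<xi> \<in> elts \<eta>" if "\<xi> \<in> y" "\<eta> \<in> W2" for \<xi> \<eta>
    using collapse_mem_iff[of \<xi> \<eta> y] that Ord assms(4) by blast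
  have in_y: "\<eta> \<in> a \<Longrightarrow> \<eta> \<in> y" "\<eta> \<in> b \<Longrightarrow> \<eta> \<in> y" "\<eta> \<in> c \<Longrightarrow> \<eta> \<in> y" "\<eta> \<in> y \<Longrightarrow> \<eta> \<in> W2" for \<eta>
    using assms by blast+
  have sub: "marks z a b \<subseteq> a" unfolding marks_def by blast
  have *: "(\<exists>\<chi> \<in> collapse y ` c. collapse y \<xi> \<in> elts \<chi> \<and>
        \<not> (\<exists>\<chi>' \<in> collapse y ` b. collapse y \<xi> \<in> elts \<chi>' \<and> \<chi>' \<in> elts \<chi>)) \<longleftrightarrow>
      (\<exists>\<chi> \<in> c. \<xi> \<in> elts \<chi> \<and> \<not> (\<exists>\<chi>' \<in> b. \<xi> \<in> elts \<chi>' \<and> \<chi>' \<in> elts \<chi>))" if "\<xi> \<in> a" for \<xi>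
    unfolding bex_simps using that by (simp add: iff in_y cong: bex_cong)
  have image: "{x \<in> f ` m. P x} = f ` {\<xi> \<in> m. P (f \<xi>)}" for f :: "'a \<Rightarrow> 'a" and m P by blast
  show ?thesis
    unfolding marked_def marks_collapse[OF assms(1,2,4,5)] image
    using * sub by (intro arg_cong[where f = "image (collapse y)"] Collect_cong conj_cong refl) blast
qed

lemma numeral_ord_collapse:
  assumes q: "\<And>m n. q m \<in> elts (q n) \<longleftrightarrow> m < (n :: nat)"
  shows "collapse (range q) (q n) = numeral_ord n"
proof (induction n rule: less_induct)
  case (less n)
  have "elts (q n) \<inter> range q = q ` {..<n}" using q by blast
  then have "elts (collapse (range q) (q n)) = (\<lambda>m. collapse (range q) (q m)) ` {..<n}"
    by (simp only: elts_collapse image_image)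
  also have "\<dots> = numeral_ord ` {..<n}" using less by (intro image_cong) simp_all
  finally show ?case by (intro extensionality) (simp add: elts_numeral_ord)
qed

text \<open>The marked points are definable in \<open>H \<theta>\<close> from parameters in
  \<open>M\<close>, so \<open>M\<close> contains the set \<open>B\<close> of all marks and its
  subset \<open>t\<close>. Collapsing \<open>B\<close>, which has order type omega, sends
  \<open>t\<close> to the real.\<close>

lemma elementary_decode:
  fixes M :: "'v::set_universe set"
  assumes M: "M \<prec>\<^sub>e H \<theta>" and \<theta>: "regular \<theta>" "uncountable (elts \<theta>)"
    and in_M: "a \<in> M" "b \<in> M" "c \<in> M" "z \<in> M"
    and q: "\<And>m n. q m \<in> elts (q n) \<longleftrightarrow> m < (n :: nat)"
    and marks: "marks z (elts a) (elts b) = range q"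
    and marked: "marked z (elts a) (elts b) (elts c) = q ` R"
  shows "set_of (numeral_ord ` R) \<in> M"
proof -
  have Ord: "Ord \<theta>" using \<theta>(1) unfolding regular_def by simp
  have MH: "x \<in> H \<theta>" if "x \<in> M" for x using M that unfolding elementary_def by blast
  have ball: "(\<forall>x \<in> H \<theta>. x \<in> elts d \<longrightarrow> P x) \<longleftrightarrow> (\<forall>x \<in> elts d. P x)" if "d \<in> M" for d P
    using H_mem[OF Ord MH[OF that]] by blast
  define B where "B = set_of (marks z (elts a) (elts b))"
  \<comment> \<open>The variables 2 to 5 are the set to be separated from, \<open>b\<close>,
    \<open>z\<close> and \<open>c\<close>. The default value \<open>c\<close> serves as variable 5
    in the second formula.\<close>
  let ?e = "\<lambda>d i :: nat. if i = 2 then d else if i = 3 then b else if i = 4 then z else c"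
  let ?\<phi> = "Conj (Neg (Mem 1 4)) (Neg (ExistsIn 6 2
      (Conj (Neg (Mem 6 4)) (Conj (Mem 6 1) (Neg (ExistsIn 7 3 (Conj (Mem 6 7) (Mem 7 1))))))))"
  have "sat (H \<theta>) ?\<phi> ((?e a)(0 := x, 1 := \<xi>)) \<longleftrightarrow>
      \<xi> \<notin> elts z \<and> \<not> (\<exists>\<eta> \<in> elts a. \<eta> \<notin> elts z \<and> \<eta> \<in> elts \<xi> \<and>
      \<not> (\<exists>\<chi> \<in> elts b. \<eta> \<in> elts \<chi> \<and> \<chi> \<in> elts \<xi>))" for x \<xi>
    by (simp add: ball[OF in_M(1)] ball[OF in_M(2)])
  then have "set_of {\<xi> \<in> elts (?e a 2). \<xi> \<notin> elts z \<and> \<not> (\<exists>\<eta> \<in> elts a. \<eta> \<notin> elts z \<and> \<eta> \<in> elts \<xi> \<and>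
      \<not> (\<exists>\<chi> \<in> elts b. \<eta> \<in> elts \<chi> \<and> \<chi> \<in> elts \<xi>))} \<in> M"
    by (rule elementary_Collect[OF M Ord, rotated]) (use in_M in auto)
  then have BM: "B \<in> M" unfolding B_def marks_def by simp
  have elB: "elts B = range q"
    unfolding B_def marks
    by (rule elts_set_of_small, rule small_subset[OF small_elts[of a]]) (use marks in \<open>auto simp: marks_def\<close>)
  define t where "t = set_of (marked z (elts a) (elts b) (elts c))"
  let ?\<phi>' = "ExistsIn 6 5 (Conj (Mem 1 6) (Neg (ExistsIn 7 3 (Conj (Mem 1 7) (Mem 7 6)))))"
  have "sat (H \<theta>) ?\<phi>' ((?e B)(0 := x, 1 := \<xi>)) \<longleftrightarrow>
      (\<exists>\<chi> \<in> elts c. \<xi> \<in> elts \<chi> \<and> \<not> (\<exists>\<chi>' \<in> elts b. \<xi> \<in> elts \<chi>' \<and> \<chi>' \<in> elts \<chi>))" for x \<xi>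
    using H_mem[OF Ord MH[OF in_M(3)]] by (simp add: ball[OF in_M(2)]) blast
  then have "set_of {\<xi> \<in> elts (?e B 2). \<exists>\<chi> \<in> elts c. \<xi> \<in> elts \<chi> \<and> \<not> (\<exists>\<chi>' \<in> elts b. \<xi> \<in> elts \<chi>' \<and> \<chi>' \<in> elts \<chi>)} \<in> M"
    by (rule elementary_Collect[OF M Ord, rotated]) (use in_M BM in auto)
  then have tM: "t \<in> M" unfolding t_def marked_def marks using elB by simp
  have elt: "elts t = q ` R"
    unfolding t_def marked by (rule elts_set_of_small, rule small_subset[OF small_elts[of B]]) (use elB in blast)
  have "set_of (collapse (elts B) ` elts t) \<in> M"
  proof (rule elementary_collapse[OF M \<theta> BM tM])
    show "elts t \<subseteq> elts B" "countable (elts B)" unfolding elt elB by auto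
    fix \<xi> assume "\<xi> \<in> elts B"
    then obtain n where "\<xi> = q n" unfolding elB by blast
    then have "collapse (elts B) \<xi> \<in> elts omega"
      unfolding elB elts_omega_eq by (simp add: numeral_ord_collapse[OF q])
    then show "collapse (elts B) \<xi> \<in> H \<theta>"
      using omega_subset_omega1 omega1_subset_H[OF Ord \<theta>(2)] by blast
  qed
  moreover have "collapse (elts B) ` elts t = numeral_ord ` R"
    unfolding elt elB image_image by (simp add: numeral_ord_collapse[OF q])
  ultimately show ?thesis by simp
qed

text \<open>Gitik's theorem in this setting. If a club had only coded members among its
  \<open>enum_closed\<close> ones, then three of those members, built by \<open>club_coding\<close>
  so as to spell a real outside \<open>M\<close>, would have codes in \<open>M\<close>. The codes
  have the order relations of the sets themselves, so decoding them would give the real in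
  \<open>M\<close>.\<close>

theorem stationary_uncoded:
  fixes M :: "'v::set_universe set"
  assumes MG: "M \<in> G_omega1"
  shows "stationary W2 (uncoded M)"
  unfolding stationary_def
proof (intro conjI allI impI)
  show "uncoded M \<subseteq> countable_subsets W2" unfolding uncoded_def by blast
  fix C :: "'v set set" assume "club W2 C"
  \<comment> \<open>Within this smaller club, a set fails to be in \<open>uncoded M\<close> only by
    being coded.\<close>
  from club_Int[OF this club_enum_closed]
  have C': "club (W2 :: 'v set) (C \<inter> {x \<in> countable_subsets W2. enum_closed x})" .
  obtain \<theta> :: 'v where \<theta>: "regular \<theta>" "uncountable (elts \<theta>)" "M \<prec>\<^sub>e H \<theta>"
    using MG unfolding G_omega1_def omega1_guessing_def by blast
  have W1M: "W1 \<subseteq> M" using MG unfolding G_omega1_def by blast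
  obtain r where r: "r \<subseteq> elts omega" "set_of r \<notin> M" using guessing_omits_real[OF MG] by blast
  define R where "R = {n. numeral_ord n \<in> r}"
  have rR: "r = numeral_ord ` R" using r(1) unfolding R_def elts_omega_eq by blast
  show "uncoded M \<inter> C \<noteq> {}"
  proof
    assume none: "uncoded M \<inter> C = {}"
    define \<pi> where "\<pi> = (\<lambda>k :: nat. if k mod 3 = 0 then None else Some ((k div 3 \<in> R) \<longleftrightarrow> k mod 3 = 1))"
    have often: "\<exists>m \<ge> n. \<pi> m = j" for j n
    proof (cases j)
      case None
      then show ?thesis by (intro exI[of _ "3 * n"]) (simp add: \<pi>_def)
    next
      case (Some q)
      have "(3 * n + 1) div 3 = n" "(3 * n + 1) mod 3 = 1" "(3 * n + 2) div 3 = n" "(3 * n + 2) mod 3 = 2"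
        by presburger+
      then have "\<pi> (3 * n + 1) = Some (n \<in> R)" "\<pi> (3 * n + 2) = Some (n \<notin> R)" unfolding \<pi>_def by simp_all
      then have "\<pi> (if (n \<in> R) = q then 3 * n + 1 else 3 * n + 2) = j" using Some by auto
      moreover have "n \<le> (if (n \<in> R) = q then 3 * n + 1 else 3 * n + 2)" by simp
      ultimately show ?thesis by blast
    qed
    have "\<exists>A \<zeta>. (\<forall>j. A j \<in> C \<inter> {x \<in> countable_subsets W2. enum_closed x} \<and> A j \<subseteq> (\<Union>n. elts (\<zeta> n))) \<and>
        (\<forall>n. \<zeta> n \<in> W2 \<and> \<zeta> n \<in> elts (\<zeta> (Suc n))) \<and>
        (\<forall>j n. A j \<inter> (elts (\<zeta> (Suc n)) - elts (\<zeta> n)) \<noteq> {} \<longleftrightarrow> \<pi> n = j)"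
      using C' often by (rule club_coding)
    then obtain A \<zeta> where all: "\<forall>j. A j \<in> C \<inter> {x \<in> countable_subsets W2. enum_closed x} \<and> A j \<subseteq> (\<Union>n. elts (\<zeta> n))"
        "\<forall>n. \<zeta> n \<in> W2 \<and> \<zeta> n \<in> elts (\<zeta> (Suc n))"
        "\<forall>j n. A j \<inter> (elts (\<zeta> (Suc n)) - elts (\<zeta> n)) \<noteq> {} \<longleftrightarrow> \<pi> n = j"
      by (elim exE conjE)
    have A: "A j \<in> C \<inter> {x \<in> countable_subsets W2. enum_closed x}" "A j \<subseteq> (\<Union>n. elts (\<zeta> n))" for j
      using spec[OF all(1), of j] by simp_all
    have \<zeta>: "\<zeta> n \<in> W2" "\<zeta> n \<in> elts (\<zeta> (Suc n))" for n using spec[OF all(2), of n] by simp_all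
    have meets: "A j \<inter> (elts (\<zeta> (Suc n)) - elts (\<zeta> n)) \<noteq> {} \<longleftrightarrow> \<pi> n = j" for j n
      using spec[OF spec[OF all(3), of j], of n] .
    from decode[OF A(2) \<zeta> meets[unfolded \<pi>_def]]
    obtain p where p: "\<forall>m n. p m \<in> elts (p n) \<longleftrightarrow> m < n"
      "marks (\<zeta> 0) (A None) (A (Some False)) = range p"
      "marked (\<zeta> 0) (A None) (A (Some False)) (A (Some True)) = p ` R"
      by (elim exE conjE)
    have "A j \<in> coded_in M" for j using A(1)[of j] none unfolding uncoded_def by blast
    then have "\<exists>D. club W2 D \<and> (\<forall>y \<in> D. A j \<subseteq> y \<longrightarrow> set_of (collapse y ` A j) \<in> M)" for j
      unfolding coded_in_def by blast
    then have "\<forall>j. \<exists>D. club W2 D \<and> (\<forall>y \<in> D. A j \<subseteq> y \<longrightarrow> set_of (collapse y ` A j) \<in> M)" ..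
    from choice[OF this] obtain D where
      allD: "\<forall>j. club W2 (D j) \<and> (\<forall>y \<in> D j. A j \<subseteq> y \<longrightarrow> set_of (collapse y ` A j) \<in> M)" ..
    have D: "club W2 (D j)" "\<And>y. y \<in> D j \<Longrightarrow> A j \<subseteq> y \<Longrightarrow> set_of (collapse y ` A j) \<in> M" for j
      using spec[OF allD, of j] by simp_all
    \<comment> \<open>The three sets must be collapsed by the same \<open>y\<close>, since collapses
      by different ones would lose their relative order.\<close>
    have clD: "club W2 (D None \<inter> (D (Some False) \<inter> D (Some True)))" by (intro club_Int D(1))
    have cA: "countable (A None \<union> (A (Some False) \<union> A (Some True)))"
      "A None \<union> (A (Some False) \<union> A (Some True)) \<subseteq> W2"
      using A(1) unfolding countable_subsets_def by auto
    from clubD(3)[OF clD cA] obtain y where y: "y \<in> D None \<inter> (D (Some False) \<inter> D (Some True))"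
      "A None \<union> (A (Some False) \<union> A (Some True)) \<subseteq> y" ..
    have yW2: "countable y" "y \<subseteq> W2" using clubD(1,2)[OF clD y(1)] .
    have Aj: "set_of (collapse y ` A j) \<in> M" "A j \<subseteq> y" for j
    proof -
      have "y \<in> D j \<and> A j \<subseteq> y" 
      proof (cases j)
        case (Some q)
        then show ?thesis using y by (cases q) auto
      qed (use y in auto)
      then show "set_of (collapse y ` A j) \<in> M" "A j \<subseteq> y" using D(2) by blast+
    qed
    have Ord: "Ord \<xi>" if "\<xi> \<in> W2" for \<xi> :: 'v using Ord_in[OF Ord_omega2 that] .
    have elA: "elts (set_of (collapse y ` A j)) = collapse y ` A j" for j
    proof (rule elts_set_of_small, rule small_subset[OF small_elts[of omega1]])
      show "collapse y ` A j \<subseteq> W1" using collapse_in_omega1[OF yW2(1) Ord] Aj(2)[of j] yW2(2) by blast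
    qed
    have pa: "p n \<in> y" for n using p(2) Aj(2)[of None] unfolding marks_def by blast
    have q: "collapse y (p m) \<in> elts (collapse y (p n)) \<longleftrightarrow> m < n" for m n
      using collapse_mem_iff[OF Ord Ord pa] pa yW2(2) p(1) by blast
    have "set_of (numeral_ord ` R) \<in> M"
    proof (rule elementary_decode[OF \<theta>(3,1,2) Aj(1)[of None] Aj(1)[of "Some False"] Aj(1)[of "Some True"], where q = "\<lambda>n. collapse y (p n)"])
      show "collapse y (\<zeta> 0) \<in> M" using collapse_in_omega1[OF yW2(1) Ord[OF \<zeta>(1)]] W1M by blast
      show "marks (collapse y (\<zeta> 0)) (elts (set_of (collapse y ` A None)))
          (elts (set_of (collapse y ` A (Some False)))) = range (\<lambda>n. collapse y (p n))"
        unfolding elA marks_collapse[OF Aj(2) Aj(2) yW2(2) \<zeta>(1)] p(2) by (simp add: image_image)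
      show "marked (collapse y (\<zeta> 0)) (elts (set_of (collapse y ` A None)))
          (elts (set_of (collapse y ` A (Some False)))) (elts (set_of (collapse y ` A (Some True)))) =
          (\<lambda>n. collapse y (p n)) ` R"
        unfolding elA marked_collapse[OF Aj(2) Aj(2) Aj(2) yW2(2) \<zeta>(1)] p(3) by (simp add: image_image)
    qed (rule q)
    then show False using r(2) rR by simp
  qed
qed

section \<open>Internal clubness and the coded sets\<close>

lemma collapse_collapse:
  assumes B: "\<And>\<xi>. \<xi> \<in> B \<Longrightarrow> Ord \<xi> \<and> \<xi> \<in> M" and v: "v \<subseteq> B"
  shows "\<xi> \<in> B \<Longrightarrow> collapse (collapse M ` v) (collapse M \<xi>) = collapse v \<xi>"
proof (induction \<xi> rule: elts_induct)
  case (step \<xi>)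
  have "elts (collapse M \<xi>) \<inter> collapse M ` v = collapse M ` (elts \<xi> \<inter> v)"
  proof (intro equalityI subsetI)
    fix x assume "x \<in> elts (collapse M \<xi>) \<inter> collapse M ` v"
    then obtain \<eta> where \<eta>: "\<eta> \<in> v" "x = collapse M \<eta>" "collapse M \<eta> \<in> elts (collapse M \<xi>)" by blast
    then have "\<eta> \<in> elts \<xi>" using collapse_mem_iff[of \<eta> \<xi> M] B[of \<eta>] B[OF step.prems] v by blast
    then show "x \<in> collapse M ` (elts \<xi> \<inter> v)" using \<eta> by blast
  next
    fix x assume "x \<in> collapse M ` (elts \<xi> \<inter> v)"
    then show "x \<in> elts (collapse M \<xi>) \<inter> collapse M ` v"
      using collapse_mem[of _ M \<xi>] B v by blast
  qed
  then have "elts (collapse (collapse M ` v) (collapse M \<xi>)) =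
      (\<lambda>\<eta>. collapse (collapse M ` v) (collapse M \<eta>)) ` (elts \<xi> \<inter> v)"
    by (simp only: elts_collapse[of "collapse M ` v"] image_image)
  also have "\<dots> = collapse v ` (elts \<xi> \<inter> v)" using step.IH v by (intro image_cong) auto
  finally show ?case by (intro extensionality) (simp only: elts_collapse[of v])
qed

text \<open>Intersecting the members of the internal club with \<xi> gives a club of countable
  subsets of \<open>M' \<inter> elts \<xi>\<close> that are elements of \<open>M'\<close>. For two
  of them, \<open>u \<subseteq> v\<close>, the image of \<open>u\<close> under the collapse of
  \<open>v\<close> is computed in \<open>M'\<close>. Collapsing \<open>M'\<close> carries this club
  to the ordinal \<open>collapse M' \<xi>\<close> without changing these codes.\<close>

theorem club_coded:
  fixes M M' :: "'v::set_universe set"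
  assumes IC: "club M' C" "\<And>x. x \<in> C \<Longrightarrow> set_of x \<in> M'"
    and M': "M' \<prec>\<^sub>e H \<theta>" and \<theta>: "regular \<theta>" "uncountable (elts \<theta>)"
    and \<xi>: "\<xi> \<in> M'" "Ord \<xi>" and \<beta>: "collapse M' \<xi> \<in> W2"
    and M: "M' \<inter> H \<nu> \<subseteq> M" "Ord \<nu>" "omega1 \<in> elts \<nu>"
  shows "\<exists>D. club (elts (collapse M' \<xi>)) D \<and> D \<subseteq> coded_in M"
proof -
  let ?h = "collapse M'" and ?X = "elts (collapse M' \<xi>)"
  define B where "B = M' \<inter> elts \<xi>"
  have Ord: "Ord \<theta>" using \<theta>(1) unfolding regular_def by simp
  have MH: "M' \<subseteq> H \<theta>" using M' unfolding elementary_def by blast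
  have B: "\<eta> \<in> B \<Longrightarrow> Ord \<eta> \<and> \<eta> \<in> M'" for \<eta> unfolding B_def using Ord_in[OF \<xi>(2)] by blast
  have X: "?X = ?h ` B" unfolding elts_collapse B_def by (simp only: Int_commute)
  have XW2: "?X \<subseteq> W2" using Ord_subset[OF Ord_omega2 \<beta>] .
  have inj: "inj_on ?h B" using collapse_inj[of _ _ M'] B by (intro inj_onI) blast
  obtain D0 where D0: "club B D0" "\<And>y. y \<in> D0 \<Longrightarrow> \<exists>z \<in> C. y = z \<inter> B"
    using club_trace[OF IC(1), of B] unfolding B_def by blast
  have D: "club ?X ((`) ?h ` D0)"
    using D0(1) by (rule club_image) (use inj X in \<open>simp add: bij_betw_def\<close>)
  have code: "set_of u \<in> M' \<and> elts (set_of u) = u \<and> countable u \<and> u \<subseteq> B" if u: "u \<in> D0" for u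
  proof -
    obtain z where z: "z \<in> C" "u = z \<inter> B" using D0(2)[OF u] by blast
    have zM: "z \<subseteq> M'" "countable z" using clubD(1,2)[OF IC(1) z(1)] by blast+
    have "small z" using set_of_H(1)[OF \<theta>] zM MH by blast
    then have "elts (set_of z) = z" by simp
    then have "elts (set_of z) \<inter> elts \<xi> = u" using z(2) zM(1) unfolding B_def by blast
    then have "set_of u \<in> M'" using elementary_Int[OF M' Ord IC(2)[OF z(1)] \<xi>(1)] by simp
    moreover have "small u" using small_subset[OF \<open>small z\<close>] z(2) by blast
    ultimately show ?thesis using zM(2) z(2) by auto
  qed
  have "?h ` u \<in> coded_in M" if u: "u \<in> D0" for u
    unfolding coded_in_def
  proof (intro CollectI conjI exI ballI impI)
    show "?h ` u \<in> countable_subsets W2"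
      using code[OF u] X XW2 unfolding countable_subsets_def by blast
    \<comment> \<open>The club witnessing that the image of \<open>u\<close> is coded: if the part
      of \<open>y\<close> below the ordinal is the image of \<open>v\<close>, then \<open>y\<close>
      collapses the image of \<open>u\<close> just as \<open>v\<close> collapses
      \<open>u\<close>.\<close>
    show "club W2 {y \<in> countable_subsets W2. y \<inter> ?X \<in> (`) ?h ` D0}"
      using D XW2 by (rule club_lift)
    fix y assume y: "y \<in> {y \<in> countable_subsets W2. y \<inter> ?X \<in> (`) ?h ` D0}" "?h ` u \<subseteq> y"
    then obtain v where v: "v \<in> D0" "y \<inter> ?X = ?h ` v" by blast
    have uB: "u \<subseteq> B" and vB: "v \<subseteq> B" using code[OF u] code[OF v(1)] by blast+
    have "?h ` u \<subseteq> ?h ` v" using y(2) v(2) X uB by blast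
    then have uv: "u \<subseteq> v" using inj_on_image_mem_iff[OF inj] uB vB by blast
    have "collapse y (?h \<eta>) = collapse v \<eta>" if \<eta>: "\<eta> \<in> u" for \<eta>
    proof -
      have "collapse y (?h \<eta>) = collapse (?h ` v) (?h \<eta>)"
      proof (rule collapse_cong[of ?X])
        show "elts x \<subseteq> ?X" if "x \<in> ?X" for x using Ord_subset[OF Ord_collapse[OF \<xi>(2)] that] .
        show "y \<inter> ?X = ?h ` v \<inter> ?X" using v(2) by blast
        show "?h \<eta> \<in> ?X" unfolding X using \<eta> uB by blast
      qed
      also have "\<dots> = collapse v \<eta>" using collapse_collapse[OF B vB] \<eta> uB by blast
      finally show ?thesis .
    qed
    then have eq: "collapse y ` ?h ` u = collapse v ` u" unfolding image_image by (intro image_cong) simp_all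
    have W1: "collapse v \<eta> \<in> W1" if "\<eta> \<in> v" for \<eta>
      using collapse_in_omega1 code[OF v(1)] B that by blast
    have "set_of (collapse (elts (set_of v)) ` elts (set_of u)) \<in> M'"
    proof (rule elementary_collapse[OF M' \<theta>])
      show "set_of v \<in> M'" "set_of u \<in> M'" "elts (set_of u) \<subseteq> elts (set_of v)" "countable (elts (set_of v))"
        using code[OF u] code[OF v(1)] uv by simp_all
      show "collapse (elts (set_of v)) \<eta> \<in> H \<theta>" if "\<eta> \<in> elts (set_of v)" for \<eta>
        using W1[of \<eta>] that code[OF v(1)] omega1_subset_H[OF Ord \<theta>(2)] by auto
    qed
    then have cM: "set_of (collapse v ` u) \<in> M'" using code[OF u] code[OF v(1)] by simp
    have sub: "collapse v ` u \<subseteq> W1" using W1 uv by blast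
    then have el: "elts (set_of (collapse v ` u)) = collapse v ` u"
      by (intro elts_set_of_small small_subset[OF small_elts])
    \<comment> \<open>The code has a transitive closure of size at most omega1, so it belongs to
      \<open>H \<nu>\<close> and thereby to \<open>M\<close>.\<close>
    have "trcl (set_of (collapse v ` u)) \<subseteq> W1"
      using sub el Ord_subset[OF Ord_omega1] by (intro trcl_subset) blast+
    then have "set_of (collapse v ` u) \<in> H \<nu>"
      unfolding H_def using size_lessI[OF M(2,3)] subset_imp_lepoll by blast
    then show "set_of (collapse y ` ?h ` u) \<in> M" unfolding eq using cM M(1) by blast
  qed
  then show ?thesis using D by (intro exI[of _ "(`) ?h ` D0"]) blast
qed

text \<open>For \<alpha> in \<open>X\<close> and a countable ordinal \<open>i\<close>, stationarity
  gives an \<open>x\<close> in \<open>S\<close> that contains both. As \<open>x\<close> is closed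
  under the enumerations, \<open>enum \<alpha> i\<close> is in \<open>X\<close>. So \<open>X\<close>
  includes each of its elements and is an ordinal.\<close>

lemma reflecting_ordinal:
  fixes X :: "'v::set_universe set"
  assumes "X \<subseteq> W2" "W1 \<subseteq> X" "X \<approx> (W1 :: 'v set)"
    and stat: "stationary X S" and closed: "\<And>x. x \<in> S \<Longrightarrow> enum_closed x"
  obtains \<beta> where "\<beta> \<in> W2" "X = elts \<beta>"
proof -
  have "elts \<alpha> \<subseteq> X" if \<alpha>: "\<alpha> \<in> X" for \<alpha>
  proof
    fix \<xi> assume \<xi>: "\<xi> \<in> elts \<alpha>"
    have "\<alpha> \<in> W2" using \<alpha> assms(1) by blast
    then have "\<xi> \<in> enum \<alpha> ` W1" using enum_image[of \<alpha>] \<xi> by simp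
    then obtain i where i: "i \<in> W1" "\<xi> = enum \<alpha> i" by blast
    \<comment> \<open>Closure under a constant function, applied to the empty set, expresses that
      \<alpha> and \<open>i\<close> are members.\<close>
    have "club X {x \<in> countable_subsets X. closed_under (\<lambda>_. {\<alpha>, i}) x}"
      using \<alpha> i(1) assms(2) by (intro club_closed_under) auto
    then obtain x where x: "x \<in> S" "x \<in> countable_subsets X" "closed_under (\<lambda>_. {\<alpha>, i}) x"
      using stat unfolding stationary_def by blast
    have "{\<alpha>, i} \<subseteq> x" using x(3) unfolding closed_under_def by (metis empty_subsetI finite.emptyI)
    then have "\<xi> \<in> x" using closed[OF x(1)] i unfolding enum_closed_def by blast
    then show "\<xi> \<in> X" using x(2) unfolding countable_subsets_def by blast
  qed
  moreover have Ord: "Ord \<alpha>" if "\<alpha> \<in> X" for \<alpha> using that assms(1) Ord_in[OF Ord_omega2] by blast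
  moreover have sm: "small X" using assms(1) by (rule small_subset[OF small_elts])
  ultimately have "Ord (set_of X)" by (intro Ord_set_of)
  moreover have "X \<lesssim> (W1 :: 'v set)" using assms(3) by (rule eqpoll_imp_lepoll)
  ultimately have "set_of X \<in> W2" using sm by (simp add: elts_omega2)
  then show thesis using sm by (intro that[of "set_of X"]) simp_all
qed

section \<open>Forcing\<close>

lemma name_induct [case_names step]:
  assumes "\<And>x. (\<And>z s. vpair z s \<in> elts x \<Longrightarrow> Q z) \<Longrightarrow> Q x"
  shows "Q (x :: 'v::set_universe)"
  using wf_trancl[OF foundation]
  by (rule wf_induct_rule) (use assms fst_in_trancl_vpair in blast)

locale forcing =
  fixes P :: "'v::set_universe set" and le :: "'v \<Rightarrow> 'v \<Rightarrow> bool"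
  assumes small_P: "small P"
    and le_refl: "p \<in> P \<Longrightarrow> le p p"
    and le_trans: "le p q \<Longrightarrow> le q r \<Longrightarrow> le p r"
    and le_in: "le p q \<Longrightarrow> p \<in> P \<and> q \<in> P"
begin

abbreviation "feq \<equiv> forces_eq P le"
abbreviation "fmem \<equiv> forces_mem P le"
abbreviation "frc \<equiv> forces P le"
abbreviation "chk \<equiv> check_name P"

section \<open>Density and the forcing relation\<close>

definition dense_below :: "'v \<Rightarrow> ('v \<Rightarrow> bool) \<Rightarrow> bool" where
  "dense_below p Q \<longleftrightarrow> (\<forall>q. le q p \<longrightarrow> (\<exists>r. le r q \<and> Q r))"

lemma dense_belowD: "dense_below p Q \<Longrightarrow> le q p \<Longrightarrow> \<exists>r. le r q \<and> Q r"
  unfolding dense_below_def by blast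

lemma dense_belowI: "(\<And>q. le q p \<Longrightarrow> \<exists>r. le r q \<and> Q r) \<Longrightarrow> dense_below p Q"
  unfolding dense_below_def by blast

lemma dense_below_mono: "dense_below p Q \<Longrightarrow> le q p \<Longrightarrow> dense_below q Q"
  unfolding dense_below_def using le_trans by blast

lemma dense_below_imp: "dense_below p Q \<Longrightarrow> (\<And>r. le r p \<Longrightarrow> Q r \<Longrightarrow> Q' r) \<Longrightarrow> dense_below p Q'"
  unfolding dense_below_def using le_trans by blast

lemma dense_below_self:
  assumes "\<And>r. le r p \<Longrightarrow> Q r"
  shows "dense_below p Q"
  unfolding dense_below_def
proof (intro allI impI)
  fix q assume "le q p"
  then show "\<exists>r. le r q \<and> Q r" using assms le_refl le_in by blast
qed

lemma dense_below_dense: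
  assumes "dense_below p (\<lambda>q. dense_below q Q)"
  shows "dense_below p Q"
  unfolding dense_below_def
proof (intro allI impI)
  fix q assume "le q p"
  then obtain r where r: "le r q" "dense_below r Q" using assms unfolding dense_below_def by blast
  then obtain r' where "le r' r" "Q r'" using le_refl le_in unfolding dense_below_def by blast
  then show "\<exists>r. le r q \<and> Q r" using r(1) le_trans by blast
qed

text \<open>It hides the attached condition \<open>s\<close> that the clauses for forced equality
  and membership quantify over, and unlike bare attachment it passes to stronger conditions.\<close>

definition puts :: "'v \<Rightarrow> 'v \<Rightarrow> 'v \<Rightarrow> bool" where
  "puts q z x \<longleftrightarrow> (\<exists>s. vpair z s \<in> elts x \<and> le q s)"

lemma puts_mono: "puts q z x \<Longrightarrow> le r q \<Longrightarrow> puts r z x"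
  unfolding puts_def using le_trans by blast

lemma fmem_iff: "fmem p x y \<longleftrightarrow> dense_below p (\<lambda>r. \<exists>w. puts r w y \<and> feq r x w)"
  unfolding forces_mem_def dense_below_def puts_def using le_in by blast

lemma feq_iff: "feq p x y \<longleftrightarrow>
  (\<forall>z q. puts q z x \<and> le q p \<longrightarrow> (\<exists>r. le r q \<and> (\<exists>w. puts r w y \<and> feq r z w))) \<and>
  (\<forall>w q. puts q w y \<and> le q p \<longrightarrow> (\<exists>r. le r q \<and> (\<exists>z. puts r z x \<and> feq r z w)))"
  by (subst forces_eq.simps) (unfold puts_def, use le_in in blast)

lemma name_induct' [case_names step]:
  assumes "\<And>x. (\<And>z q. puts q z x \<Longrightarrow> Q z) \<Longrightarrow> Q x"
  shows "Q x"
proof (induction x rule: name_induct)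
  case (step x)
  then show ?case using assms[of x] unfolding puts_def by blast
qed

lemma feq_mono:
  assumes "feq p x y" "le q p"
  shows "feq q x y"
  using assms le_trans[OF _ assms(2)] unfolding feq_iff[of p] feq_iff[of q] by blast

lemma feq_refl: "feq p x x"
proof (induction x arbitrary: p rule: name_induct')
  case (step x)
  have "\<exists>r. le r q \<and> (\<exists>w. puts r w x \<and> feq r z w)" "\<exists>r. le r q \<and> (\<exists>w. puts r w x \<and> feq r w z)"
    if "puts q z x" "le q p" for z q
    using step[OF that(1)] that le_refl le_in by blast+
  then show ?case unfolding feq_iff[of p] by blast
qed

lemma feq_sym: "feq p x y \<Longrightarrow> feq p y x"
proof (induction x arbitrary: p y rule: name_induct')
  case (step x)
  have "\<exists>r. le r q \<and> (\<exists>w. puts r w x \<and> feq r z w)" if "puts q z y" "le q p" for z q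
    using conjunct2[OF step.prems[unfolded feq_iff[of p]]] that step.IH by blast
  moreover have "\<exists>r. le r q \<and> (\<exists>z. puts r z y \<and> feq r z w)" if "puts q w x" "le q p" for w q
    using conjunct1[OF step.prems[unfolded feq_iff[of p]]] that step.IH[OF that(1)] by blast
  ultimately show ?case unfolding feq_iff[of p y] by blast
qed

lemma feqD:
  assumes "feq p x y" "puts q z x" "le q p"
  shows "\<exists>r w. le r q \<and> puts r w y \<and> feq r z w"
  using conjunct1[OF assms(1)[unfolded feq_iff[of p]]] assms(2,3) by blast

lemma feqI:
  assumes "\<And>z q. puts q z x \<Longrightarrow> le q p \<Longrightarrow> \<exists>r w. le r q \<and> puts r w y \<and> feq r z w"
    and "\<And>w q. puts q w y \<Longrightarrow> le q p \<Longrightarrow> \<exists>r z. le r q \<and> puts r z x \<and> feq r w z"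
  shows "feq p x y"
proof -
  have "\<exists>r. le r q \<and> (\<exists>z. puts r z x \<and> feq r z w)" if "puts q w y" "le q p" for w q
    using assms(2)[OF that] feq_sym by blast
  then show ?thesis unfolding feq_iff[of p] using assms(1) by blast
qed

lemma feq_trans: "feq p x y \<Longrightarrow> feq p y z \<Longrightarrow> feq p x z"
proof (induction x arbitrary: p y z rule: name_induct')
  case (step x)
  show ?case
  proof (rule feqI)
    fix x' q assume x': "puts q x' x" "le q p"
    obtain r y' where r: "le r q" "puts r y' y" "feq r x' y'" using feqD[OF step.prems(1) x'] by blast
    obtain r' z' where r': "le r' r" "puts r' z' z" "feq r' y' z'"
      using feqD[OF step.prems(2) r(2) le_trans[OF r(1) x'(2)]] by blast
    have "feq r' x' z'" using step.IH[OF x'(1) feq_mono[OF r(3) r'(1)] r'(3)] .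
    then show "\<exists>r w. le r q \<and> puts r w z \<and> feq r x' w" using r' le_trans[OF r'(1) r(1)] by blast
  next
    fix z' q assume z': "puts q z' z" "le q p"
    obtain r y' where r: "le r q" "puts r y' y" "feq r z' y'"
      using feqD[OF feq_sym[OF step.prems(2)] z'] by blast
    obtain r' x' where r': "le r' r" "puts r' x' x" "feq r' y' x'"
      using feqD[OF feq_sym[OF step.prems(1)] r(2) le_trans[OF r(1) z'(2)]] by blast
    \<comment> \<open>The induction hypothesis concerns elements of \<open>x\<close> only, so the
      path from \<open>z'\<close> through \<open>y'\<close> to \<open>x'\<close> is traversed in
      reverse.\<close>
    have "feq r' x' z'"
      using step.IH[OF r'(2) feq_sym[OF r'(3)] feq_sym[OF feq_mono[OF r(3) r'(1)]]] .
    then show "\<exists>r x'. le r q \<and> puts r x' x \<and> feq r z' x'"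
      using r' le_trans[OF r'(1) r(1)] feq_sym by blast
  qed
qed

lemma feq_dense:
  assumes "dense_below p (\<lambda>q. feq q x y)"
  shows "feq p x y"
proof (rule feqI)
  fix z q assume z: "puts q z x" "le q p"
  obtain r where r: "le r q" "feq r x y" using dense_belowD[OF assms z(2)] by blast
  have "le r r" using r(1) le_refl le_in by blast
  then obtain r' w where "le r' r" "puts r' w y" "feq r' z w"
    using feqD[OF r(2) puts_mono[OF z(1) r(1)]] by blast
  then show "\<exists>r w. le r q \<and> puts r w y \<and> feq r z w" using le_trans[OF _ r(1)] by blast
next
  fix z q assume z: "puts q z y" "le q p"
  obtain r where r: "le r q" "feq r x y" using dense_belowD[OF assms z(2)] by blast
  have "le r r" using r(1) le_refl le_in by blast
  then obtain r' w where "le r' r" "puts r' w x" "feq r' z w"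
    using feqD[OF feq_sym[OF r(2)] puts_mono[OF z(1) r(1)]] by blast
  then show "\<exists>r w. le r q \<and> puts r w x \<and> feq r z w" using le_trans[OF _ r(1)] by blast
qed

lemma fmem_mono: "fmem p x y \<Longrightarrow> le q p \<Longrightarrow> fmem q x y"
  unfolding fmem_iff by (rule dense_below_mono)

lemma fmem_dense: "dense_below p (\<lambda>q. fmem q x y) \<Longrightarrow> fmem p x y"
  unfolding fmem_iff by (rule dense_below_dense)

lemma fmem_puts: "puts p z x \<Longrightarrow> fmem p z x"
  unfolding fmem_iff using puts_mono feq_refl by (intro dense_below_self) blast

lemma fmem_cong:
  assumes "fmem p x y" "feq p x x'" "feq p y y'"
  shows "fmem p x' y'"
  unfolding fmem_iff
proof (rule dense_belowI)
  fix q assume q: "le q p"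
  obtain r w where r: "le r q" "puts r w y" "feq r x w"
    using dense_belowD[OF assms(1)[unfolded fmem_iff] q] by blast
  have rp: "le r p" using le_trans[OF r(1) q] .
  obtain r' w' where r': "le r' r" "puts r' w' y'" "feq r' w w'"
    using feqD[OF assms(3) r(2) rp] by blast
  have "feq r' x' w'"
    using feq_trans[OF feq_sym[OF feq_mono[OF assms(2) le_trans[OF r'(1) rp]]]
      feq_trans[OF feq_mono[OF r(3) r'(1)] r'(3)]] .
  then show "\<exists>r. le r q \<and> (\<exists>w. puts r w y' \<and> feq r x' w)"
    using r' le_trans[OF r'(1) r(1)] by blast
qed

lemma frc_mono: "frc p \<phi> e \<Longrightarrow> le q p \<Longrightarrow> frc q \<phi> e"
proof (induction \<phi> arbitrary: p q e)
  case (Neg \<phi>)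
  then show ?case using le_trans[OF _ Neg.prems(2)] by simp
qed (use fmem_mono feq_mono in \<open>auto\<close>)

lemma frc_dense: "dense_below p (\<lambda>q. frc q \<phi> e) \<Longrightarrow> frc p \<phi> e"
proof (induction \<phi> arbitrary: e)
  case (Mem i j)
  then show ?case using fmem_dense by simp
next
  case (Eq i j)
  then show ?case using feq_dense by simp
next
  case (Neg \<phi>)
  show ?case
    unfolding forces.simps
  proof (intro ballI impI notI)
    fix q assume q: "le q p" "frc q \<phi> e"
    obtain r where r: "le r q" "frc r (Neg \<phi>) e" using dense_belowD[OF Neg.prems q(1)] by blast
    have "frc r \<phi> e" using frc_mono[OF q(2) r(1)] .
    moreover have "r \<in> P" "le r r" using r(1) le_in le_refl by blast+
    ultimately show False using r(2) by simp
  qed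
next
  case (Conj \<phi> \<psi>)
  have "dense_below p (\<lambda>q. frc q \<phi> e)" "dense_below p (\<lambda>q. frc q \<psi> e)"
    using Conj.prems by (auto elim: dense_below_imp)
  then show ?case using Conj.IH by simp
next
  case (Forall i \<phi>)
  have "frc p \<phi> (e(i := x))" if "is_name P x" for x
    by (rule Forall.IH, rule dense_below_imp[OF Forall.prems]) (unfold forces.simps, use that in blast)
  then show ?case by simp
qed

lemma frc_cong: "frc p \<phi> e \<Longrightarrow> (\<And>i. feq p (e i) (e' i)) \<Longrightarrow> frc p \<phi> e'"
proof (induction \<phi> arbitrary: p e e')
  case (Mem i j)
  then show ?case using fmem_cong by simp
next
  case (Eq i j)
  then have "feq p (e i) (e j)" by simp
  then show ?case
    using feq_trans[OF feq_trans[OF feq_sym[OF Eq.prems(2)[of i]]] Eq.prems(2)[of j]] by simp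
next
  case (Neg \<phi>)
  show ?case
    unfolding forces.simps
  proof (intro ballI impI notI)
    fix q assume q: "q \<in> P" "le q p" "frc q \<phi> e'"
    have "frc q \<phi> e" using q(3) feq_sym[OF feq_mono[OF Neg.prems(2) q(2)]] by (rule Neg.IH)
    then show False using Neg.prems(1) q by simp
  qed
next
  case (Conj \<phi> \<psi>)
  show ?case using Conj.IH(1)[OF _ Conj.prems(2)] Conj.IH(2)[OF _ Conj.prems(2)] Conj.prems(1) by simp
next
  case (Forall i \<phi>)
  have "frc p \<phi> (e'(i := x))" if "is_name P x" for x
  proof (rule Forall.IH)
    show "frc p \<phi> (e(i := x))" using Forall.prems(1) that by simp
    show "feq p ((e(i := x)) j) ((e'(i := x)) j)" for j using Forall.prems(2) feq_refl by simp
  qed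
  then show ?case by simp
qed

lemma frc_Imp: "frc p (Imp \<phi> \<psi>) e \<longleftrightarrow> (\<forall>q. le q p \<longrightarrow> frc q \<phi> e \<longrightarrow> frc q \<psi> e)"
proof
  assume L: "frc p (Imp \<phi> \<psi>) e"
  show "\<forall>q. le q p \<longrightarrow> frc q \<phi> e \<longrightarrow> frc q \<psi> e"
  proof (intro allI impI frc_dense dense_belowI)
    fix q r assume q: "le q p" "frc q \<phi> e" and r: "le r q"
    have "frc r \<phi> e" "le r p" "r \<in> P" using frc_mono[OF q(2) r] le_trans[OF r q(1)] le_in[OF r] by blast+
    then show "\<exists>r'. le r' r \<and> frc r' \<psi> e" using L by auto
  qed
next
  assume R: "\<forall>q. le q p \<longrightarrow> frc q \<phi> e \<longrightarrow> frc q \<psi> e"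
  show "frc p (Imp \<phi> \<psi>) e"
    unfolding forces.simps
  proof (intro ballI impI notI)
    fix q assume q: "q \<in> P" "le q p" "frc q \<phi> e \<and> (\<forall>r \<in> P. le r q \<longrightarrow> \<not> frc r \<psi> e)"
    then show False using R le_refl by blast
  qed
qed

lemma frc_Iff: "frc p (Iff \<phi> \<psi>) e \<longleftrightarrow> (\<forall>q. le q p \<longrightarrow> (frc q \<phi> e \<longleftrightarrow> frc q \<psi> e))"
  unfolding forces.simps(4)[of _ _ _ "Imp \<phi> \<psi>"] frc_Imp by blast

lemma frc_Disj: "frc p (Disj \<phi> \<psi>) e \<longleftrightarrow> dense_below p (\<lambda>q. frc q \<phi> e \<or> frc q \<psi> e)"
proof
  assume L: "frc p (Disj \<phi> \<psi>) e"
  show "dense_below p (\<lambda>q. frc q \<phi> e \<or> frc q \<psi> e)"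
  proof (rule dense_belowI)
    fix q assume "le q p"
    then show "\<exists>r. le r q \<and> (frc r \<phi> e \<or> frc r \<psi> e)" using L le_in by auto
  qed
next
  assume R: "dense_below p (\<lambda>q. frc q \<phi> e \<or> frc q \<psi> e)"
  show "frc p (Disj \<phi> \<psi>) e"
    unfolding forces.simps using dense_belowD[OF R] le_in by blast
qed

lemma frc_Exists: "frc p (Exists i \<phi>) e \<longleftrightarrow> dense_below p (\<lambda>q. \<exists>x. is_name P x \<and> frc q \<phi> (e(i := x)))"
proof
  assume L: "frc p (Exists i \<phi>) e"
  show "dense_below p (\<lambda>q. \<exists>x. is_name P x \<and> frc q \<phi> (e(i := x)))"
  proof (rule dense_belowI)
    fix q assume "le q p"
    then show "\<exists>r. le r q \<and> (\<exists>x. is_name P x \<and> frc r \<phi> (e(i := x)))"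
      using L[unfolded forces.simps] le_in[of q p] by blast
  qed
next
  assume R: "dense_below p (\<lambda>q. \<exists>x. is_name P x \<and> frc q \<phi> (e(i := x)))"
  show "frc p (Exists i \<phi>) e"
    unfolding forces.simps using dense_belowD[OF R] le_in by blast
qed

lemma frc_ExistsI: "is_name P x \<Longrightarrow> frc p \<phi> (e(i := x)) \<Longrightarrow> frc p (Exists i \<phi>) e"
  unfolding frc_Exists using frc_mono by (intro dense_below_self) blast

lemma is_name_puts: "is_name P x \<Longrightarrow> puts q z x \<Longrightarrow> is_name P z"
proof -
  assume "is_name P x" "puts q z x"
  then obtain s where "vpair z s \<in> elts x" unfolding puts_def by blast
  then have "\<exists>z' s'. vpair z s = vpair z' s' \<and> s' \<in> P \<and> is_name P z'"
    using is_name.cases[OF \<open>is_name P x\<close>] by blast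
  then show "is_name P z" by auto
qed

lemma feq_ext:
  assumes "is_name P u" "is_name P v"
    and "\<And>w q. is_name P w \<Longrightarrow> le q p \<Longrightarrow> fmem q w u \<longleftrightarrow> fmem q w v"
  shows "feq p u v"
proof -
  have *: "\<exists>r w. le r q \<and> puts r w v \<and> feq r z w" if "fmem q z v" "q \<in> P" for q z v
    using dense_belowD[OF that(1)[unfolded fmem_iff] le_refl[OF that(2)]] by blast
  show ?thesis
  proof (rule feqI)
    show "\<exists>r w. le r q \<and> puts r w v \<and> feq r z w" if "puts q z u" "le q p" for z q
      using *[of q z v] assms(3)[OF is_name_puts[OF assms(1) that(1)] that(2)] fmem_puts[OF that(1)]
        le_in[OF that(2)] by blast
    show "\<exists>r w. le r q \<and> puts r w u \<and> feq r z w" if "puts q z v" "le q p" for z q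
      using *[of q z u] assms(3)[OF is_name_puts[OF assms(2) that(1)] that(2)] fmem_puts[OF that(1)]
        le_in[OF that(2)] by blast
  qed
qed

subsection \<open>Check names and pairs\<close>

lemma puts_chk: "puts q z (chk a) \<longleftrightarrow> q \<in> P \<and> (\<exists>y \<in> elts a. z = chk y)"
proof
  assume "puts q z (chk a)"
  then obtain s where "vpair z s \<in> elts (chk a)" "le q s" unfolding puts_def by blast
  then show "q \<in> P \<and> (\<exists>y \<in> elts a. z = chk y)"
    using le_in unfolding elts_check_name[OF small_P] by auto
next
  assume "q \<in> P \<and> (\<exists>y \<in> elts a. z = chk y)"
  then show "puts q z (chk a)"
    using le_refl[of q] unfolding puts_def elts_check_name[OF small_P] by blast
qed

lemma is_name_chk: "is_name P (chk a)"
proof (induction a rule: elts_induct)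
  case (step a)
  show ?case
    by (rule is_name.intros) (use step in \<open>auto simp: elts_check_name[OF small_P]\<close>)
qed

lemma fmem_chk: "fmem p x (chk a) \<longleftrightarrow> dense_below p (\<lambda>r. \<exists>y \<in> elts a. feq r x (chk y))"
proof
  assume "fmem p x (chk a)"
  then show "dense_below p (\<lambda>r. \<exists>y \<in> elts a. feq r x (chk y))"
    unfolding fmem_iff puts_chk by (rule dense_below_imp) blast
next
  assume "dense_below p (\<lambda>r. \<exists>y \<in> elts a. feq r x (chk y))"
  then show "fmem p x (chk a)"
    unfolding fmem_iff puts_chk by (rule dense_below_imp) (use le_in in blast)
qed

lemma fmem_chk_chk: "y \<in> elts a \<Longrightarrow> fmem p (chk y) (chk a)"
  unfolding fmem_chk using feq_refl by (intro dense_below_self) blast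

lemma feq_chk_eq: "p \<in> P \<Longrightarrow> feq p (chk x) (chk y) \<Longrightarrow> x = y"
proof (induction x arbitrary: p y rule: elts_induct)
  case (step x)
  have "z \<in> elts y" if z: "z \<in> elts x" for z
  proof -
    have "puts p (chk z) (chk x)" using z step.prems(1) puts_chk by blast
    then obtain r w where r: "le r p" "puts r w (chk y)" "feq r (chk z) w"
      using feqD[OF step.prems(2) _ le_refl[OF step.prems(1)]] by blast
    then obtain y' where "y' \<in> elts y" "w = chk y'" "r \<in> P" unfolding puts_chk by blast
    then show ?thesis using step.IH[OF z \<open>r \<in> P\<close>] r(3) by blast
  qed
  moreover have "w \<in> elts x" if w: "w \<in> elts y" for w
  proof -
    have "puts p (chk w) (chk y)" using w step.prems(1) puts_chk by blast
    then obtain r z where r: "le r p" "puts r z (chk x)" "feq r (chk w) z"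
      using feqD[OF feq_sym[OF step.prems(2)] _ le_refl[OF step.prems(1)]] by blast
    then obtain z' where "z' \<in> elts x" "z = chk z'" "r \<in> P" unfolding puts_chk by blast
    then show ?thesis using step.IH[OF \<open>z' \<in> elts x\<close> \<open>r \<in> P\<close>] feq_sym[OF r(3)] by blast
  qed
  ultimately show ?case by (intro extensionality) blast
qed

lemma fmem_chk_mem:
  assumes "p \<in> P" "fmem p (chk x) (chk y)"
  shows "x \<in> elts y"
proof -
  obtain r z where "le r p" "z \<in> elts y" "feq r (chk x) (chk z)"
    using dense_belowD[OF assms(2)[unfolded fmem_chk] le_refl[OF assms(1)]] by blast
  then show ?thesis using feq_chk_eq[of r x z] le_in by blast
qed

definition up :: "'v \<Rightarrow> 'v \<Rightarrow> 'v" where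
  "up x y = set_of (case_prod vpair ` ({x, y} \<times> P))"

definition pr :: "'v \<Rightarrow> 'v \<Rightarrow> 'v" where
  "pr x y = up (up x x) (up x y)"

lemma elts_up: "elts (up x y) = case_prod vpair ` ({x, y} \<times> P)"
  unfolding up_def by (intro elts_set_of_small small_times small_doubleton small_P)

lemma puts_up: "puts q z (up x y) \<longleftrightarrow> q \<in> P \<and> (z = x \<or> z = y)"
proof
  assume "puts q z (up x y)"
  then show "q \<in> P \<and> (z = x \<or> z = y)" using le_in unfolding puts_def elts_up by auto
next
  assume "q \<in> P \<and> (z = x \<or> z = y)"
  then have "vpair z q \<in> elts (up x y)" unfolding elts_up by force
  then show "puts q z (up x y)" unfolding puts_def using le_refl \<open>q \<in> P \<and> _\<close> by blast
qed

lemma is_name_up: "is_name P x \<Longrightarrow> is_name P y \<Longrightarrow> is_name P (up x y)"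
  by (rule is_name.intros) (auto simp: elts_up)

lemma is_name_pr: "is_name P x \<Longrightarrow> is_name P y \<Longrightarrow> is_name P (pr x y)"
  unfolding pr_def by (intro is_name_up)

lemma fmem_up: "fmem p v (up x y) \<longleftrightarrow> dense_below p (\<lambda>r. feq r v x \<or> feq r v y)"
proof
  assume "fmem p v (up x y)"
  then show "dense_below p (\<lambda>r. feq r v x \<or> feq r v y)"
    unfolding fmem_iff puts_up by (rule dense_below_imp) blast
next
  assume "dense_below p (\<lambda>r. feq r v x \<or> feq r v y)"
  then show "fmem p v (up x y)"
    unfolding fmem_iff puts_up by (rule dense_below_imp) (use le_in in blast)
qed

text \<open>The right side is what the subformulas of \<open>Pair_fm\<close> unfold to under
  \<open>frc_Iff\<close> and \<open>frc_Disj\<close>.\<close>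

lemma up_char:
  assumes "is_name P v" "is_name P x" "is_name P y"
  shows "feq p v (up x y) \<longleftrightarrow>
    (\<forall>w. is_name P w \<longrightarrow> (\<forall>q. le q p \<longrightarrow> (fmem q w v \<longleftrightarrow> dense_below q (\<lambda>r. feq r w x \<or> feq r w y))))"
proof
  assume eq: "feq p v (up x y)"
  show "\<forall>w. is_name P w \<longrightarrow> (\<forall>q. le q p \<longrightarrow> (fmem q w v \<longleftrightarrow> dense_below q (\<lambda>r. feq r w x \<or> feq r w y)))"
  proof (intro allI impI)
    fix w q assume q: "le q p"
    have "fmem q w v \<longleftrightarrow> fmem q w (up x y)"
      using fmem_cong[OF _ feq_refl feq_mono[OF eq q]] fmem_cong[OF _ feq_refl feq_sym[OF feq_mono[OF eq q]]]
      by blast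
    then show "fmem q w v \<longleftrightarrow> dense_below q (\<lambda>r. feq r w x \<or> feq r w y)" unfolding fmem_up .
  qed
next
  assume "\<forall>w. is_name P w \<longrightarrow> (\<forall>q. le q p \<longrightarrow> (fmem q w v \<longleftrightarrow> dense_below q (\<lambda>r. feq r w x \<or> feq r w y)))"
  then show "feq p v (up x y)"
    using assms is_name_up by (intro feq_ext) (simp_all add: fmem_up)
qed

lemma feq_dense_iff: "dense_below q (\<lambda>r. feq r w x) \<longleftrightarrow> feq q w x"
  using feq_dense[of q w x] feq_mono[of q w x] dense_below_self[of q "\<lambda>r. feq r w x"] by blast

lemma frc_Pair:
  assumes "is_name P (e z)" "is_name P (e x)" "is_name P (e y)"
    and "z \<notin> {7, 8}" "x \<notin> {7, 8}" "y \<notin> {7, 8}"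
  shows "frc p (Pair_fm z x y) e \<longleftrightarrow> feq p (e z) (pr (e x) (e y))"
proof -
  have sg: "frc q (Forall 8 (Iff (Mem 8 7) (Eq 8 x))) (e(7 := v)) \<longleftrightarrow> feq q v (up (e x) (e x))"
    if "is_name P v" for q v
    unfolding forces.simps(5) frc_Iff up_char[OF that assms(2,2)] using assms(5) by (simp add: feq_dense_iff)
  have up: "frc q (Forall 8 (Iff (Mem 8 7) (Disj (Eq 8 x) (Eq 8 y)))) (e(7 := v)) \<longleftrightarrow> feq q v (up (e x) (e y))"
    if "is_name P v" for q v
    unfolding forces.simps(5) frc_Iff frc_Disj up_char[OF that assms(2,3)] using assms(5,6) by simp
  have "frc p (Pair_fm z x y) e \<longleftrightarrow> (\<forall>v. is_name P v \<longrightarrow> (\<forall>q. le q p \<longrightarrow>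
      (fmem q v (e z) \<longleftrightarrow> dense_below q (\<lambda>r. feq r v (up (e x) (e x)) \<or> feq r v (up (e x) (e y))))))"
    unfolding Pair_fm_def forces.simps(5)[of _ _ _ 7] frc_Iff[of _ "Mem 7 z"] frc_Disj[of _ "Forall 8 _"]
    using assms(4) by (simp only: sg up cong: imp_cong) simp
  also have "\<dots> \<longleftrightarrow> feq p (e z) (pr (e x) (e y))"
    unfolding pr_def using assms by (intro up_char[symmetric] is_name_up)
  finally show ?thesis .
qed

lemma frc_PairIn:
  assumes "is_name P (e f)" "is_name P (e x)" "is_name P (e y)"
    and "f \<notin> {7, 8, 9}" "x \<notin> {7, 8, 9}" "y \<notin> {7, 8, 9}"
  shows "frc p (PairIn_fm x y f) e \<longleftrightarrow> fmem p (pr (e x) (e y)) (e f)"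
proof -
  have Pair: "frc q (Pair_fm 9 x y) (e(9 := u)) \<longleftrightarrow> feq q u (pr (e x) (e y))" if "is_name P u" for q u
    using frc_Pair[of "e(9 := u)" 9 x y q] assms that by simp
  have "frc p (PairIn_fm x y f) e \<longleftrightarrow>
      dense_below p (\<lambda>q. \<exists>u. is_name P u \<and> fmem q u (e f) \<and> frc q (Pair_fm 9 x y) (e(9 := u)))"
    unfolding PairIn_fm_def frc_Exists using assms(4) by simp
  also have "\<dots> \<longleftrightarrow> fmem p (pr (e x) (e y)) (e f)"
  proof
    assume "dense_below p (\<lambda>q. \<exists>u. is_name P u \<and> fmem q u (e f) \<and> frc q (Pair_fm 9 x y) (e(9 := u)))"
    then have "dense_below p (\<lambda>q. fmem q (pr (e x) (e y)) (e f))"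
      by (rule dense_below_imp) (use Pair fmem_cong feq_refl in blast)
    then show "fmem p (pr (e x) (e y)) (e f)" by (rule fmem_dense)
  next
    assume m: "fmem p (pr (e x) (e y)) (e f)"
    have "is_name P (pr (e x) (e y))" using assms by (intro is_name_pr)
    then show "dense_below p (\<lambda>q. \<exists>u. is_name P u \<and> fmem q u (e f) \<and> frc q (Pair_fm 9 x y) (e(9 := u)))"
      using Pair fmem_mono[OF m] feq_refl by (intro dense_below_self) blast
  qed
  finally show ?thesis .
qed

lemma feq_up_right:
  assumes eq: "feq p (up x y) (up x' y')" and x: "feq p x x'"
  shows "feq p y y'"
proof (rule feq_dense, rule dense_belowI)
  fix q assume q: "le q p"
  have qP: "q \<in> P" using le_in[OF q] by blast
  have "fmem q y (up x y)" "fmem q y' (up x' y')" using qP by (auto intro!: fmem_puts simp: puts_up)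
  then have m: "fmem q y (up x' y')" "fmem q y' (up x y)"
    using fmem_cong[OF _ feq_refl feq_mono[OF eq q]] fmem_cong[OF _ feq_refl feq_sym[OF feq_mono[OF eq q]]] by blast+
  obtain r where r: "le r q" "feq r y x' \<or> feq r y y'"
    using dense_belowD[OF m(1)[unfolded fmem_up] le_refl[OF qP]] by blast
  obtain r' where r': "le r' r" "feq r' y' x \<or> feq r' y' y"
    using dense_belowD[OF m(2)[unfolded fmem_up] r(1)] by blast
  have "feq r' x x'" using feq_mono[OF x le_trans[OF r'(1) le_trans[OF r(1) q]]] .
  moreover have "feq r' y x' \<or> feq r' y y'" using r(2) feq_mono[OF _ r'(1)] by blast
  ultimately have "feq r' y y'" using r'(2) feq_trans feq_sym by blast
  then show "\<exists>r. le r q \<and> feq r y y'" using le_trans[OF r'(1) r(1)] by blast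
qed

lemma feq_up_left:
  assumes eq: "feq p (up x x) (up x' y')"
  shows "feq p x x'"
proof (rule feq_dense, rule dense_belowI)
  fix q assume q: "le q p"
  have qP: "q \<in> P" using le_in[OF q] by blast
  have "fmem q x' (up x' y')" using qP by (auto intro!: fmem_puts simp: puts_up)
  then have "fmem q x' (up x x)" using fmem_cong[OF _ feq_refl feq_sym[OF feq_mono[OF eq q]]] by blast
  from dense_belowD[OF this[unfolded fmem_up] le_refl[OF qP]]
  show "\<exists>r. le r q \<and> feq r x x'" using feq_sym by blast
qed

text \<open>The usual argument for Kuratowski pairs, with each case distinction decided by passing
  to a stronger condition.\<close>

lemma feq_pr:
  assumes eq: "feq p (pr x y) (pr x' y')" and p: "p \<in> P"
  shows "feq p x x'" "feq p y y'"
proof -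
  have parts: "fmem p (up x x) (up (up x' x') (up x' y'))" "fmem p (up x y) (up (up x' x') (up x' y'))"
    "fmem p (up x' y') (up (up x x) (up x y))"
  proof -
    have "fmem p (up x x) (up (up x x) (up x y))" "fmem p (up x y) (up (up x x) (up x y))"
      "fmem p (up x' y') (up (up x' x') (up x' y'))"
      by (auto intro!: fmem_puts simp: puts_up p)
    then show "fmem p (up x x) (up (up x' x') (up x' y'))" "fmem p (up x y) (up (up x' x') (up x' y'))"
      "fmem p (up x' y') (up (up x x) (up x y))"
      using fmem_cong[OF _ feq_refl eq[unfolded pr_def]] fmem_cong[OF _ feq_refl feq_sym[OF eq[unfolded pr_def]]]
      by blast+
  qed
  have "dense_below p (\<lambda>r. feq r x x')"
    using parts(1) unfolding fmem_up by (rule dense_below_imp) (use feq_up_left in blast)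
  then show x: "feq p x x'" by (rule feq_dense)
  show "feq p y y'"
  proof (rule feq_dense, rule dense_belowI)
    fix q assume q: "le q p"
    obtain r where r: "le r q" "feq r (up x y) (up x' x') \<or> feq r (up x y) (up x' y')"
      using dense_belowD[OF parts(2)[unfolded fmem_up] q] by blast
    obtain r' where r': "le r' r" "feq r' (up x' y') (up x x) \<or> feq r' (up x' y') (up x y)"
      using dense_belowD[OF parts(3)[unfolded fmem_up] le_trans[OF r(1) q]] by blast
    have x': "feq r' x x'" using feq_mono[OF x le_trans[OF r'(1) le_trans[OF r(1) q]]] .
    have "feq r' y x' \<or> feq r' y y'"
      using r(2) feq_mono[OF _ r'(1)] feq_up_right[OF _ x'] by blast
    moreover have "feq r' y' x \<or> feq r' y' y"
      using r'(2) feq_up_right[OF _ feq_sym[OF x']] by blast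
    ultimately have "feq r' y y'" using x' feq_trans feq_sym by blast
    then show "\<exists>r. le r q \<and> feq r y y'" using le_trans[OF r'(1) r(1)] by blast
  qed
qed

subsection \<open>Forcing a regular cardinal to remain regular\<close>

text \<open>As soon as there is a condition, each check name occurs in a pair belonging to
  \<open>chk a\<close>, so the check names can be extracted by unions.\<close>

lemma small_chk:
  assumes "P \<noteq> {}"
  shows "small (chk ` elts a)"
proof -
  obtain p where p: "p \<in> P" using assms by blast
  let ?S = "\<Union> (elts ` \<Union> (elts ` elts (chk a)))"
  have "small ?S" by (intro small_Union small_elts)
  moreover have "chk ` elts a \<subseteq> ?S"
  proof
    fix x assume "x \<in> chk ` elts a"
    then obtain y where "y \<in> elts a" "x = chk y" by blast
    then have "vpair x p \<in> elts (chk a)" unfolding elts_check_name[OF small_P] using p by blast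
    moreover have "set_of {x} \<in> elts (vpair x p)" by (simp add: elts_vpair)
    moreover have "x \<in> elts (set_of {x})" by simp
    ultimately show "x \<in> ?S" by blast
  qed
  ultimately show ?thesis by (rule small_subset)
qed

lemma small_up:
  assumes "small X" "small Y"
  shows "small (case_prod up ` (X \<times> Y))"
proof (rule small_subset)
  show "small {z. elts z \<subseteq> case_prod vpair ` ((X \<union> Y) \<times> P)}"
    by (intro small_Pow small_times small_Un assms small_P)
  show "case_prod up ` (X \<times> Y) \<subseteq> {z. elts z \<subseteq> case_prod vpair ` ((X \<union> Y) \<times> P)}"
    by (auto simp: elts_up)
qed

text \<open>A relation \<open>decides i \<alpha> q\<close> with these properties amounts to a name
  \<open>F\<close> for a function from \<mu> to \<delta>, in which the pair of \<open>i\<close> and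
  \<alpha> is attached to the conditions deciding it. Forced regularity yields a name for a bound of
  its range, and a stronger condition determines the bound to be some \<beta>. All use of the
  forcing relation for towers is reduced to this statement.\<close>

theorem forced_regular_bounded:
  assumes p: "p \<in> P" and reg: "frc p Regular_fm (\<lambda>_. chk \<delta>)" and \<mu>: "\<mu> \<in> elts \<delta>"
    and mono: "\<And>i \<alpha> q q'. decides i \<alpha> q \<Longrightarrow> le q' q \<Longrightarrow> decides i \<alpha> q'"
    and func: "\<And>i \<alpha> \<alpha>' q. decides i \<alpha> q \<Longrightarrow> decides i \<alpha>' q \<Longrightarrow> q \<in> P \<Longrightarrow> \<alpha> \<in> elts \<delta> \<Longrightarrow> \<alpha>' \<in> elts \<delta> \<Longrightarrow> \<alpha> = \<alpha>'"
    and total: "\<And>i q. i \<in> elts \<mu> \<Longrightarrow> q \<in> P \<Longrightarrow> \<exists>r \<alpha>. le r q \<and> \<alpha> \<in> elts \<delta> \<and> decides i \<alpha> r"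
  shows "\<exists>q \<beta>. le q p \<and> \<beta> \<in> elts \<delta> \<and>
    (\<forall>r i \<alpha>. le r q \<and> i \<in> elts \<mu> \<and> \<alpha> \<in> elts \<delta> \<and> decides i \<alpha> r \<longrightarrow> \<alpha> \<in> elts \<beta>)"
proof -
  define F where "F = set_of {vpair (pr (chk i) (chk \<alpha>)) q | i \<alpha> q.
      i \<in> elts \<mu> \<and> \<alpha> \<in> elts \<delta> \<and> q \<in> P \<and> decides i \<alpha> q}"
  have elts_F: "elts F = {vpair (pr (chk i) (chk \<alpha>)) q | i \<alpha> q.
      i \<in> elts \<mu> \<and> \<alpha> \<in> elts \<delta> \<and> q \<in> P \<and> decides i \<alpha> q}"
    unfolding F_def
  proof (rule elts_set_of_small, rule small_subset)
    let ?X = "chk ` elts \<mu>" and ?Y = "chk ` elts \<delta>"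
    let ?PR = "case_prod up ` (case_prod up ` (?X \<times> ?X) \<times> case_prod up ` (?X \<times> ?Y))"
    have "P \<noteq> {}" using p by blast
    then show "small (case_prod vpair ` (?PR \<times> P))"
      by (intro small_times small_up small_chk small_P)
    have PR: "pr (chk i) (chk \<alpha>) \<in> ?PR" if "i \<in> elts \<mu>" "\<alpha> \<in> elts \<delta>" for i \<alpha>
    proof -
      have "up (chk i) (chk i) \<in> case_prod up ` (?X \<times> ?X)" "up (chk i) (chk \<alpha>) \<in> case_prod up ` (?X \<times> ?Y)"
        using that by force+
      then show ?thesis unfolding pr_def by force
    qed
    have "vpair (pr (chk i) (chk \<alpha>)) q \<in> case_prod vpair ` (?PR \<times> P)"
      if "i \<in> elts \<mu>" "\<alpha> \<in> elts \<delta>" "q \<in> P" for i \<alpha> q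
    proof (rule image_eqI)
      show "vpair (pr (chk i) (chk \<alpha>)) q = case_prod vpair (pr (chk i) (chk \<alpha>), q)" by simp
      show "(pr (chk i) (chk \<alpha>), q) \<in> ?PR \<times> P" using PR[OF that(1,2)] that(3) by (rule SigmaI)
    qed
    then show "{vpair (pr (chk i) (chk \<alpha>)) q | i \<alpha> q.
        i \<in> elts \<mu> \<and> \<alpha> \<in> elts \<delta> \<and> q \<in> P \<and> decides i \<alpha> q} \<subseteq> case_prod vpair ` (?PR \<times> P)"
      by blast
  qed
  have name_pr: "is_name P (pr (chk i) (chk \<alpha>))" for i \<alpha> by (intro is_name_pr is_name_chk)
  have name_F: "is_name P F"
    by (rule is_name.intros) (use name_pr in \<open>auto simp: elts_F\<close>)
  have puts_F: "puts q z F \<longleftrightarrow> (\<exists>i \<alpha>. i \<in> elts \<mu> \<and> \<alpha> \<in> elts \<delta> \<and> q \<in> P \<and> decides i \<alpha> q \<and> z = pr (chk i) (chk \<alpha>))" for q z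
  proof
    assume "puts q z F"
    then obtain s where s: "vpair z s \<in> elts F" "le q s" unfolding puts_def by blast
    then obtain i \<alpha> where "i \<in> elts \<mu>" "\<alpha> \<in> elts \<delta>" "decides i \<alpha> s" "z = pr (chk i) (chk \<alpha>)"
      unfolding elts_F by auto
    then show "\<exists>i \<alpha>. i \<in> elts \<mu> \<and> \<alpha> \<in> elts \<delta> \<and> q \<in> P \<and> decides i \<alpha> q \<and> z = pr (chk i) (chk \<alpha>)"
      using mono[OF _ s(2)] le_in[OF s(2)] by blast
  next
    assume "\<exists>i \<alpha>. i \<in> elts \<mu> \<and> \<alpha> \<in> elts \<delta> \<and> q \<in> P \<and> decides i \<alpha> q \<and> z = pr (chk i) (chk \<alpha>)"
    then have "vpair z q \<in> elts F" "q \<in> P" unfolding elts_F by blast+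
    then show "puts q z F" unfolding puts_def using le_refl by blast
  qed
  have in_F: "fmem q (pr (chk i) (chk \<alpha>)) F" if "i \<in> elts \<mu>" "\<alpha> \<in> elts \<delta>" "decides i \<alpha> q" "q \<in> P" for q i \<alpha>
    using that puts_F by (intro fmem_puts) blast
  have F_D: "dense_below q (\<lambda>r. \<exists>i \<alpha>. i \<in> elts \<mu> \<and> \<alpha> \<in> elts \<delta> \<and> r \<in> P \<and> decides i \<alpha> r \<and> feq r n (pr (chk i) (chk \<alpha>)))"
    if "fmem q n F" for q n
    using that[unfolded fmem_iff] by (rule dense_below_imp) (unfold puts_F, blast)
  \<comment> \<open>The numbering follows \<open>Regular_fm\<close>, where 0 is the cardinal, 1 the
    domain and 2 the function.\<close>
  let ?e = "(\<lambda>_ :: nat. chk \<delta>)(1 := chk \<mu>, 2 := F)"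
  have name_e: "is_name P (?e i)" for i using name_F is_name_chk by simp
  have Function: "frc q Function_fm ?e" if qP: "q \<in> P" for q
    unfolding Function_fm_def forces.simps(4)[of _ _ _ "ForallIn 3 2 _"] forces.simps(5)[of _ _ _ 3] forces.simps(5)[of _ _ _ 4]
  proof (intro conjI allI impI)
    fix n assume n: "is_name P n"
    show "frc q (Imp (Mem 3 2) (ExistsIn 4 1 (ExistsIn 5 0 (Pair_fm 3 4 5)))) (?e(3 := n))"
      unfolding frc_Imp
    proof (intro allI impI frc_dense)
      fix q' assume "le q' q" "frc q' (Mem 3 2) (?e(3 := n))"
      then have "fmem q' n F" by simp
      then show "dense_below q' (\<lambda>r. frc r (ExistsIn 4 1 (ExistsIn 5 0 (Pair_fm 3 4 5))) (?e(3 := n)))"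
      proof (rule dense_below_imp[OF F_D], elim exE conjE)
        fix r i \<alpha> assume r: "i \<in> elts \<mu>" "\<alpha> \<in> elts \<delta>" "r \<in> P" "feq r n (pr (chk i) (chk \<alpha>))"
        have "frc r (Pair_fm 3 4 5) (?e(3 := n, 4 := chk i, 5 := chk \<alpha>))"
          by (subst frc_Pair) (use n is_name_chk r(4) in simp_all)
        then have "frc r (Conj (Mem 5 0) (Pair_fm 3 4 5)) (?e(3 := n, 4 := chk i, 5 := chk \<alpha>))"
          using fmem_chk_chk[OF r(2)] by simp
        from frc_ExistsI[OF is_name_chk this]
        have "frc r (Conj (Mem 4 1) (ExistsIn 5 0 (Pair_fm 3 4 5))) (?e(3 := n, 4 := chk i))"
          using fmem_chk_chk[OF r(1)] by (subst forces.simps(4)) simp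
        from frc_ExistsI[OF is_name_chk this]
        show "frc r (ExistsIn 4 1 (ExistsIn 5 0 (Pair_fm 3 4 5))) (?e(3 := n))" .
      qed
    qed
  next
    fix n assume n: "is_name P n"
    let ?\<psi> = "Forall 6 (Imp (PairIn_fm 4 6 2) (Eq 6 5))"
    show "frc q (Imp (Mem 4 1) (ExistsIn 5 0 (Conj (PairIn_fm 4 5 2) ?\<psi>))) (?e(4 := n))"
      unfolding frc_Imp
    proof (intro allI impI frc_dense)
      fix q' assume "le q' q" "frc q' (Mem 4 1) (?e(4 := n))"
      then have "fmem q' n (chk \<mu>)" by simp
      then have "dense_below q' (\<lambda>r. \<exists>i \<in> elts \<mu>. feq r n (chk i))" unfolding fmem_chk .
      then have "dense_below q' (\<lambda>r. \<exists>i \<alpha>. i \<in> elts \<mu> \<and> \<alpha> \<in> elts \<delta> \<and> decides i \<alpha> r \<and> feq r n (chk i))"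
      proof (intro dense_belowI)
        fix q'' assume "le q'' q'"
        then obtain r i where r: "le r q''" "i \<in> elts \<mu>" "feq r n (chk i)"
          using dense_belowD[OF \<open>dense_below q' _\<close>] by blast
        obtain r' \<alpha> where r': "le r' r" "\<alpha> \<in> elts \<delta>" "decides i \<alpha> r'"
          using total[OF r(2)] le_in[OF r(1)] by blast
        show "\<exists>r. le r q'' \<and> (\<exists>i \<alpha>. i \<in> elts \<mu> \<and> \<alpha> \<in> elts \<delta> \<and> decides i \<alpha> r \<and> feq r n (chk i))"
          using le_trans[OF r'(1) r(1)] r' r(2) feq_mono[OF r(3) r'(1)] by blast
      qed
      then show "dense_below q' (\<lambda>r. frc r (ExistsIn 5 0 (Conj (PairIn_fm 4 5 2) ?\<psi>)) (?e(4 := n)))"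
      proof (rule dense_below_imp, elim exE conjE)
        fix r i \<alpha> assume rq: "le r q'"
          and r: "i \<in> elts \<mu>" "\<alpha> \<in> elts \<delta>" "decides i \<alpha> r" "feq r n (chk i)"
        have rP: "r \<in> P" using le_in[OF rq] by blast
        let ?e' = "?e(4 := n, 5 := chk \<alpha>)"
        \<comment> \<open>That pairing respects forced equality is read off from
          \<open>frc_cong\<close> for the pairing formula.\<close>
        have pr_eq: "feq r (pr (chk i) (chk \<alpha>)) (pr n (chk \<alpha>))"
        proof -
          have "frc r (Pair_fm 3 4 5) (?e(3 := pr (chk i) (chk \<alpha>), 4 := chk i, 5 := chk \<alpha>))"
            by (subst frc_Pair) (use name_pr is_name_chk feq_refl in simp_all)
          then have "frc r (Pair_fm 3 4 5) (?e(3 := pr (chk i) (chk \<alpha>), 4 := n, 5 := chk \<alpha>))"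
            by (rule frc_cong) (use feq_sym[OF r(4)] feq_refl in simp)
          then show ?thesis
            by (subst (asm) frc_Pair) (use name_pr is_name_chk n in simp_all)
        qed
        have "frc r (PairIn_fm 4 5 2) ?e'"
          by (subst frc_PairIn)
            (use n is_name_chk name_F fmem_cong[OF in_F[OF r(1,2,3) rP] pr_eq feq_refl] in simp_all)
        moreover have "frc r ?\<psi> ?e'"
          unfolding forces.simps(5) frc_Imp
        proof (intro allI impI)
          fix y q1 assume y: "is_name P y" and q1: "le q1 r" "frc q1 (PairIn_fm 4 6 2) (?e'(6 := y))"
          have m: "fmem q1 (pr n y) F"
            using q1(2) by (subst (asm) frc_PairIn) (use n y name_F in simp_all)
          have "dense_below q1 (\<lambda>r1. feq r1 y (chk \<alpha>))"
            using F_D[OF m]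
          proof (rule dense_below_imp, elim exE conjE)
            fix r1 j \<beta> assume r1q: "le r1 q1"
              and r1: "j \<in> elts \<mu>" "\<beta> \<in> elts \<delta>" "r1 \<in> P" "decides j \<beta> r1" "feq r1 (pr n y) (pr (chk j) (chk \<beta>))"
            have r1r: "le r1 r" using le_trans[OF r1q q1(1)] .
            have "feq r1 (chk i) (chk j)"
              using feq_trans[OF feq_sym[OF feq_mono[OF r(4) r1r]] feq_pr(1)[OF r1(5,3)]] .
            then have "i = j" using feq_chk_eq[OF r1(3)] by blast
            then have "\<beta> = \<alpha>" using func[OF r1(4) _ r1(3,2) r(2)] mono[OF r(3) r1r] by blast
            then show "feq r1 y (chk \<alpha>)" using feq_pr(2)[OF r1(5,3)] by simp
          qed
          then show "frc q1 (Eq 6 5) (?e'(6 := y))" using feq_dense by simp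
        qed
        moreover have "fmem r (chk \<alpha>) (chk \<delta>)" using fmem_chk_chk[OF r(2)] .
        ultimately have "frc r (Conj (Mem 5 0) (Conj (PairIn_fm 4 5 2) ?\<psi>)) ?e'"
          by (simp only: forces.simps(1,4)) simp
        from frc_ExistsI[OF is_name_chk this]
        show "frc r (ExistsIn 5 0 (Conj (PairIn_fm 4 5 2) ?\<psi>)) (?e(4 := n))" .
      qed
    qed
  qed
  let ?\<chi> = "ForallIn 4 1 (Forall 5 (Imp (PairIn_fm 4 5 2) (Mem 5 3)))"
  have "frc p (ForallIn 1 0 (Forall 2 (Imp Function_fm (ExistsIn 3 0 ?\<chi>)))) (\<lambda>_. chk \<delta>)"
    using reg unfolding Regular_fm_def forces.simps(4)[of _ _ _ "Conj _ _"] forces.simps(4)[of _ _ _ "Exists _ _"]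
    by (simp only: forces.simps(4))
  then have "frc p (Imp (Mem 1 0) (Forall 2 (Imp Function_fm (ExistsIn 3 0 ?\<chi>)))) ((\<lambda>_. chk \<delta>)(1 := chk \<mu>))"
    unfolding forces.simps(5)[of _ _ _ 1] using is_name_chk by blast
  moreover have "frc p (Mem 1 0) ((\<lambda>_. chk \<delta>)(1 := chk \<mu>))" using fmem_chk_chk[OF \<mu>] by simp
  ultimately have "frc p (Forall 2 (Imp Function_fm (ExistsIn 3 0 ?\<chi>))) ((\<lambda>_. chk \<delta>)(1 := chk \<mu>))"
    unfolding frc_Imp using le_refl[OF p] by blast
  then have "frc p (Imp Function_fm (ExistsIn 3 0 ?\<chi>)) ?e"
    unfolding forces.simps(5)[of _ _ _ 2] using name_F by blast
  then have "frc p (ExistsIn 3 0 ?\<chi>) ?e"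
    unfolding frc_Imp using le_refl[OF p] Function[OF p] by blast
  then obtain r b where r: "le r p" "is_name P b" "frc r (Conj (Mem 3 0) ?\<chi>) (?e(3 := b))"
    using dense_belowD[OF _ le_refl[OF p]] unfolding frc_Exists by blast
  have b: "fmem r b (chk \<delta>)" "frc r ?\<chi> (?e(3 := b))"
    using r(3) by (simp_all only: forces.simps(1,4)) simp_all
  have rP: "r \<in> P" using le_in[OF r(1)] by blast
  \<comment> \<open>Being forced into the check name of \<delta>, the bound \<open>b\<close> equals
    a check name below a stronger condition.\<close>
  obtain q \<beta> where q: "le q r" "\<beta> \<in> elts \<delta>" "feq q b (chk \<beta>)"
    using dense_belowD[OF b(1)[unfolded fmem_chk] le_refl[OF rP]] by blast
  have "\<alpha> \<in> elts \<beta>" if s: "le s q" "i \<in> elts \<mu>" "\<alpha> \<in> elts \<delta>" "decides i \<alpha> s" for s i \<alpha>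
  proof -
    have sP: "s \<in> P" and sr: "le s r" using le_in[OF s(1)] le_trans[OF s(1) q(1)] by blast+
    have "frc r (Imp (Mem 4 1) (Forall 5 (Imp (PairIn_fm 4 5 2) (Mem 5 3)))) (?e(3 := b, 4 := chk i))"
      using b(2) is_name_chk unfolding forces.simps(5)[of _ _ _ 4] by blast
    moreover have "frc s (Mem 4 1) (?e(3 := b, 4 := chk i))" using fmem_chk_chk[OF s(2)] by simp
    ultimately have "frc s (Forall 5 (Imp (PairIn_fm 4 5 2) (Mem 5 3))) (?e(3 := b, 4 := chk i))"
      unfolding frc_Imp[of r] using sr by blast
    then have "frc s (Imp (PairIn_fm 4 5 2) (Mem 5 3)) (?e(3 := b, 4 := chk i, 5 := chk \<alpha>))"
      unfolding forces.simps(5)[of _ _ _ 5] using is_name_chk by blast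
    moreover have "frc s (PairIn_fm 4 5 2) (?e(3 := b, 4 := chk i, 5 := chk \<alpha>))"
      by (subst frc_PairIn) (use r(2) is_name_chk name_F in_F[OF s(2,3,4) sP] in simp_all)
    ultimately have "frc s (Mem 5 3) (?e(3 := b, 4 := chk i, 5 := chk \<alpha>))"
      unfolding frc_Imp using le_refl[OF sP] by blast
    then have "fmem s (chk \<alpha>) b" by simp
    then have "fmem s (chk \<alpha>) (chk \<beta>)" using fmem_cong[OF _ feq_refl feq_mono[OF q(3) s(1)]] by blast
    then show ?thesis using fmem_chk_mem[OF sP] by blast
  qed
  then show ?thesis using q(2) le_trans[OF q(1) r(1)] by blast
qed

end

section \<open>Towers of ideals\<close>

context
  fixes Z :: "'a set set" and I :: "'a set set set"
  assumes I: "ideal_on Z I"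
begin

lemma ideal_subset:
  assumes "A \<in> I" "B \<subseteq> A"
  shows "B \<in> I"
proof -
  have "\<forall>A \<in> I. \<forall>B \<subseteq> A. B \<in> I" using I unfolding ideal_on_def by (elim conjE)
  then show ?thesis using assms by blast
qed

lemma ideal_Un:
  assumes "A \<in> I" "B \<in> I"
  shows "A \<union> B \<in> I"
proof -
  have "\<forall>\<A> \<subseteq> I. countable \<A> \<longrightarrow> \<Union> \<A> \<in> I" using I unfolding ideal_on_def by (elim conjE)
  from spec[OF this, of "{A, B}"] have "\<Union> {A, B} \<in> I" using assms by simp
  then show ?thesis by simp
qed

lemma ideal_empty: "{} \<in> I"
proof -
  have "\<forall>\<A> \<subseteq> I. countable \<A> \<longrightarrow> \<Union> \<A> \<in> I" using I unfolding ideal_on_def by (elim conjE)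
  from spec[OF this, of "{}"] have "\<Union> {} \<in> I" by simp
  then show ?thesis by simp
qed

lemma ideal_proper: "Z \<notin> I"
  using I unfolding ideal_on_def by (elim conjE)

lemma ideal_fine: "b \<in> \<Union> Z \<Longrightarrow> {M \<in> Z. b \<notin> M} \<in> I"
proof -
  have "\<forall>b \<in> \<Union> Z. {M \<in> Z. b \<notin> M} \<in> I" using I unfolding ideal_on_def by (elim conjE)
  then show "b \<in> \<Union> Z \<Longrightarrow> {M \<in> Z. b \<notin> M} \<in> I" by (rule bspec)
qed

lemma ideal_normal:
  assumes "S \<subseteq> Z" "S \<notin> I" "\<And>M. M \<in> S \<Longrightarrow> g M \<in> M"
  shows "\<exists>S' c. S' \<subseteq> S \<and> S' \<notin> I \<and> (\<forall>M \<in> S'. g M = c)"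
proof -
  have "\<forall>S g. S \<subseteq> Z \<and> S \<notin> I \<and> (\<forall>M \<in> S. g M \<in> M) \<longrightarrow>
      (\<exists>S' c. S' \<subseteq> S \<and> S' \<notin> I \<and> (\<forall>M \<in> S'. g M = c))"
    using I unfolding ideal_on_def by (elim conjE)
  from spec[OF spec[OF this, of S], of g] show ?thesis using assms by blast
qed

lemma positive_Diff: "S \<notin> I \<Longrightarrow> A \<in> I \<Longrightarrow> S - A \<notin> I"
  using ideal_Un[of "S - A" A] ideal_subset[of "S - A \<union> A" S] by blast

end

section \<open>The tower as a forcing notion\<close>

locale GIC_tower =
  fixes \<kappa> \<delta> :: "'v::set_universe" and U :: "'v set" and I :: "'v \<Rightarrow> 'v set set set"
  assumes tower: "tower \<kappa> \<delta> U I"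
    and GIC: "tower_concentrates \<kappa> U I GIC_omega1"
    and regular_\<delta>: "regular \<delta>"
begin

abbreviation "Z \<equiv> Z_of \<kappa>"

definition cnd :: "'v \<Rightarrow> 'v set set \<Rightarrow> bool" where
  "cnd \<nu> S \<longleftrightarrow> \<nu> \<in> U \<and> S \<subseteq> Z \<nu> \<and> S \<notin> I \<nu>"

lemma Ord_\<delta>: "Ord \<delta>" using tower unfolding tower_def by blast
lemma Ord_\<kappa>: "Ord \<kappa>" using tower unfolding tower_def regular_def by blast
lemma U_\<delta>: "\<nu> \<in> U \<Longrightarrow> \<nu> \<in> elts \<delta>" using tower unfolding tower_def by blast
lemma Ord_U: "\<nu> \<in> U \<Longrightarrow> Ord \<nu>" using Ord_in[OF Ord_\<delta> U_\<delta>] .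
lemma ideal: "\<nu> \<in> U \<Longrightarrow> ideal_on (Z \<nu>) (I \<nu>)" using tower unfolding tower_def by blast
lemma \<kappa>_subset: "\<nu> \<in> U \<Longrightarrow> elts \<kappa> \<subseteq> elts \<nu>" using tower unfolding tower_def by blast

lemma cofinal: "\<alpha> \<in> elts \<delta> \<Longrightarrow> \<exists>\<nu> \<in> U. elts \<alpha> \<subseteq> elts \<nu>"
  using tower unfolding tower_def by blast

lemma \<delta>_limit: "\<alpha> \<in> elts \<delta> \<Longrightarrow> \<exists>\<beta> \<in> elts \<delta>. \<alpha> \<in> elts \<beta>"
  using regular_\<delta> unfolding regular_def by blast

lemma \<delta>_nonempty: "\<exists>\<alpha>. \<alpha> \<in> elts \<delta>"
  using regular_\<delta> unfolding regular_def by blast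

lemma U_nonempty: "\<exists>\<nu>. \<nu> \<in> U"
  using \<delta>_nonempty cofinal by blast

text \<open>Strictness at \<beta> makes \<beta> an element of \<open>H \<nu>'\<close>, so fineness
  applies to it at level \<open>\<nu>'\<close>.\<close>

lemma cofinal2:
  assumes "\<nu> \<in> U" "\<beta> \<in> elts \<delta>"
  shows "\<exists>\<nu>' \<in> U. elts \<nu> \<subseteq> elts \<nu>' \<and> \<beta> \<in> elts \<nu>'"
proof -
  obtain \<beta>' where \<beta>': "\<beta>' \<in> elts \<delta>" "\<beta> \<in> elts \<beta>'" using \<delta>_limit[OF assms(2)] by blast
  have Ord: "Ord \<beta>'" "Ord \<nu>" using Ord_in[OF Ord_\<delta> \<beta>'(1)] Ord_U[OF assms(1)] .
  have "elts \<nu> \<subseteq> elts \<beta>' \<or> elts \<beta>' \<subseteq> elts \<nu>"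
    using Ord_linear[OF Ord] Ord_subset[OF Ord(1)] Ord_subset[OF Ord(2)] by blast
  then show ?thesis
  proof
    assume "elts \<nu> \<subseteq> elts \<beta>'"
    then show ?thesis using cofinal[OF \<beta>'(1)] \<beta>'(2) by blast
  next
    assume "elts \<beta>' \<subseteq> elts \<nu>"
    then show ?thesis using assms(1) \<beta>'(2) by blast
  qed
qed

lemma ex_GIC:
  assumes "\<nu> \<in> U"
  obtains A where "A \<subseteq> GIC_omega1" "A \<subseteq> Z \<nu>" "Z \<nu> - A \<in> I \<nu>" "cnd \<nu> A"
proof -
  obtain A where A: "A \<subseteq> GIC_omega1" "A \<subseteq> Z \<nu>" "Z \<nu> - A \<in> I \<nu>"
    using GIC assms unfolding tower_concentrates_def concentrates_def by blast
  have "A \<notin> I \<nu>"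
  proof
    assume "A \<in> I \<nu>"
    then have "Z \<nu> - A \<union> A \<in> I \<nu>" using A(3) ideal_Un[OF ideal[OF assms]] by blast
    moreover have "Z \<nu> - A \<union> A = Z \<nu>" using A(2) by blast
    ultimately show False using ideal_proper[OF ideal[OF assms]] by simp
  qed
  then show thesis using A assms that unfolding cnd_def by blast
qed

lemma GIC_D:
  assumes "(M :: 'v set) \<in> GIC_omega1"
  shows "M \<in> G_omega1" "W1 \<subseteq> M" "M \<approx> (W1 :: 'v set)"
  using assms unfolding GIC_omega1_def G_omega1_def by blast+

lemma cnd_nonempty:
  assumes "cnd \<nu> S"
  shows "\<exists>M. M \<in> S"
proof -
  have "{} \<in> I \<nu>" using assms ideal_empty[OF ideal] unfolding cnd_def by simp
  then have "S \<noteq> {}" using assms unfolding cnd_def by blast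
  then show ?thesis by blast
qed

text \<open>A positive set of members of \<open>GIC_omega1\<close> is nonempty, and its elements
  have size omega1 as well as size below \<kappa>.\<close>

lemma omega1_\<kappa>: "omega1 \<in> elts \<kappa>"
proof -
  obtain \<nu> where \<nu>: "\<nu> \<in> U" using U_nonempty by blast
  obtain A where A: "A \<subseteq> GIC_omega1" "A \<subseteq> Z \<nu>" "cnd \<nu> A" using ex_GIC[OF \<nu>] by metis
  obtain M where M: "M \<in> A" using cnd_nonempty[OF A(3)] by blast
  obtain \<mu> where \<mu>: "\<mu> \<in> elts \<kappa>" "M \<approx> elts \<mu>"
    using M A(2) unfolding Z_of_def size_less_def by blast
  have "M \<approx> (W1 :: 'v set)" using GIC_D(3) M A(1) by blast
  then have "elts \<mu> \<approx> (W1 :: 'v set)" using eqpoll_trans[OF eqpoll_sym[OF \<mu>(2)]] by blast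
  then have "\<mu> \<notin> W1"
    using uncountable_omega1 countable_eqpoll[OF _ eqpoll_sym] by (auto simp: elts_omega1)
  then have "elts omega1 \<subseteq> elts \<mu>"
    using Ord_not_in_iff[OF Ord_in[OF Ord_\<kappa> \<mu>(1)] Ord_omega1] by blast
  then show ?thesis
    using Ord_subset_trans[OF Ord_\<kappa> Ord_omega1 _ Ord_in[OF Ord_\<kappa> \<mu>(1)] \<mu>(1)] by blast
qed

lemma omega1_U: "\<nu> \<in> U \<Longrightarrow> omega1 \<in> elts \<nu>"
  using omega1_\<kappa> \<kappa>_subset by blast

lemma omega1_\<delta>: "omega1 \<in> elts \<delta>"
  using U_nonempty omega1_U Ord_trans[OF Ord_\<delta> U_\<delta>] by blast

lemma Union_Z: "\<Union> (Z \<nu>) = H \<nu>"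
proof
  show "\<Union> (Z \<nu>) \<subseteq> H \<nu>" unfolding Z_of_def by blast
  have "{x} \<lesssim> (W1 :: 'v set)" for x :: 'v by (rule countable_lepoll_omega1) simp
  then have "size_less {x} \<kappa>" for x :: 'v using size_lessI[OF Ord_\<kappa> omega1_\<kappa>] by blast
  then show "H \<nu> \<subseteq> \<Union> (Z \<nu>)" unfolding Z_of_def by blast
qed

lemma lift_positive:
  assumes "cnd \<nu> S" "\<nu>' \<in> U" "elts \<nu> \<subseteq> elts \<nu>'"
  shows "cnd \<nu>' {M' \<in> Z \<nu>'. M' \<inter> H \<nu> \<in> S}"
proof -
  have "\<forall>\<nu> \<in> U. \<forall>\<nu>' \<in> U. elts \<nu> \<subseteq> elts \<nu>' \<longrightarrow> canonical_projection (Z \<nu>) (I \<nu>) (Z \<nu>') (I \<nu>')"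
    using tower unfolding tower_def by (elim conjE)
  then have "I \<nu> = {A. A \<subseteq> Z \<nu> \<and> {M' \<in> Z \<nu>'. M' \<inter> H \<nu> \<in> A} \<in> I \<nu>'}"
    using assms unfolding canonical_projection_def Union_Z cnd_def by blast
  then show ?thesis using assms unfolding cnd_def by blast
qed

lemma cond_inject:
  assumes "cnd \<nu> S" "cnd \<nu>' S'" "cond \<nu> S = cond \<nu>' S'"
  shows "\<nu> = \<nu>'" "S = S'"
proof -
  show \<nu>: "\<nu> = \<nu>'" using assms(3) unfolding cond_def by simp
  have smH: "small (H \<nu>)" using small_H[OF Ord_U] assms(1) unfolding cnd_def by blast
  have sub: "S \<subseteq> Pow (H \<nu>)" "S' \<subseteq> Pow (H \<nu>)"
    using assms(1,2) \<nu> unfolding cnd_def Z_of_def by blast+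
  have sm: "small (set_of ` T)" if "T \<subseteq> Pow (H \<nu>)" for T
    by (rule small_subset[OF small_image_set_of_Pow[OF smH]]) (use that in blast)
  have "set_of (set_of ` S) = set_of (set_of ` S')" using assms(3) unfolding cond_def by simp
  then have eq: "set_of ` S = set_of ` S'" using set_of_inject_small[OF sm[OF sub(1)] sm[OF sub(2)]] by blast
  have "inj_on set_of (Pow (H \<nu>))"
  proof (rule inj_onI)
    fix A B assume AB: "A \<in> Pow (H \<nu>)" "B \<in> Pow (H \<nu>)" "set_of A = set_of B"
    have "small A" "small B" using AB(1,2) small_subset[OF smH] by blast+
    then show "A = B" using AB(3) set_of_inject_small by blast
  qed
  then show "S = S'" using inj_on_image_eq_iff[OF _ sub] eq by blast
qed

lemma poset_iff: "p \<in> tower_poset \<kappa> U I \<longleftrightarrow> (\<exists>\<nu> S. p = cond \<nu> S \<and> cnd \<nu> S)"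
  unfolding tower_poset_def cnd_def by blast

lemma le_iff:
  assumes "cnd \<nu>' S'" "cnd \<nu> S"
  shows "tower_le \<kappa> U I (cond \<nu>' S') (cond \<nu> S) \<longleftrightarrow>
    elts \<nu> \<subseteq> elts \<nu>' \<and> (\<forall>M \<in> S'. M \<inter> H \<nu> \<in> S)"
proof
  assume "tower_le \<kappa> U I (cond \<nu>' S') (cond \<nu> S)"
  then obtain \<mu>' T' \<mu> T where *: "cond \<nu>' S' = cond \<mu>' T'" "cond \<nu> S = cond \<mu> T"
    "cnd \<mu>' T'" "cnd \<mu> T" "elts \<mu> \<subseteq> elts \<mu>'" "T' \<subseteq> {M' \<in> Z \<mu>'. M' \<inter> H \<mu> \<in> T}"
    unfolding tower_le_def cnd_def by blast
  have "\<nu>' = \<mu>'" "S' = T'" "\<nu> = \<mu>" "S = T"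
    using cond_inject[OF assms(1) *(3,1)] cond_inject[OF assms(2) *(4,2)] by blast+
  then show "elts \<nu> \<subseteq> elts \<nu>' \<and> (\<forall>M \<in> S'. M \<inter> H \<nu> \<in> S)" using *(5,6) by blast
next
  assume "elts \<nu> \<subseteq> elts \<nu>' \<and> (\<forall>M \<in> S'. M \<inter> H \<nu> \<in> S)"
  then show "tower_le \<kappa> U I (cond \<nu>' S') (cond \<nu> S)"
    using assms unfolding tower_le_def cnd_def by blast
qed

lemma le_poset: "tower_le \<kappa> U I p q \<Longrightarrow> p \<in> tower_poset \<kappa> U I \<and> q \<in> tower_poset \<kappa> U I"
  unfolding tower_le_def tower_poset_def by blast

sublocale forcing "tower_poset \<kappa> U I" "tower_le \<kappa> U I"
proof
  show "small (tower_poset \<kappa> U I)"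
  proof (rule small_subset)
    show "small (case_prod vpair ` (elts \<delta> \<times> {z. elts z \<subseteq> set_of ` Pow (H \<delta>)}))"
      by (intro small_times small_elts small_Pow small_image_set_of_Pow small_H Ord_\<delta>)
    show "tower_poset \<kappa> U I \<subseteq> case_prod vpair ` (elts \<delta> \<times> {z. elts z \<subseteq> set_of ` Pow (H \<delta>)})"
    proof
      fix p assume "p \<in> tower_poset \<kappa> U I"
      then obtain \<nu> S where p: "p = cond \<nu> S" "cnd \<nu> S" unfolding poset_iff by blast
      have \<nu>: "\<nu> \<in> elts \<delta>" using p(2) U_\<delta> unfolding cnd_def by blast
      have "H \<nu> \<subseteq> H \<delta>" using H_mono[OF Ord_subset[OF Ord_\<delta> \<nu>]] .
      then have "S \<subseteq> Pow (H \<delta>)" using p(2) unfolding cnd_def Z_of_def by blast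
      then have sub: "set_of ` S \<subseteq> set_of ` Pow (H \<delta>)" by (rule image_mono)
      have "small (set_of ` S)"
        by (rule small_subset[OF small_image_set_of_Pow[OF small_H[OF Ord_\<delta>]] sub])
      then have "elts (set_of (set_of ` S)) \<subseteq> set_of ` Pow (H \<delta>)" using sub by simp
      then have "(\<nu>, set_of (set_of ` S)) \<in> elts \<delta> \<times> {z. elts z \<subseteq> set_of ` Pow (H \<delta>)}" using \<nu> by simp
      then have "case_prod vpair (\<nu>, set_of (set_of ` S)) \<in>
          case_prod vpair ` (elts \<delta> \<times> {z. elts z \<subseteq> set_of ` Pow (H \<delta>)})" by (rule imageI)
      then show "p \<in> case_prod vpair ` (elts \<delta> \<times> {z. elts z \<subseteq> set_of ` Pow (H \<delta>)})"
        unfolding p(1) cond_def by simp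
    qed
  qed
next
  fix p assume "p \<in> tower_poset \<kappa> U I"
  then obtain \<nu> S where p: "p = cond \<nu> S" "cnd \<nu> S" unfolding poset_iff by blast
  have "M \<inter> H \<nu> \<in> S" if "M \<in> S" for M
  proof -
    have "M \<subseteq> H \<nu>" using p(2) that unfolding cnd_def Z_of_def by blast
    then show ?thesis using that by (simp add: Int_absorb2)
  qed
  then show "tower_le \<kappa> U I p p" unfolding p(1) le_iff[OF p(2,2)] by blast
next
  fix p q r assume pq: "tower_le \<kappa> U I p q" and qr: "tower_le \<kappa> U I q r"
  obtain \<nu>1 S1 where p: "p = cond \<nu>1 S1" "cnd \<nu>1 S1" using le_poset[OF pq] unfolding poset_iff by blast
  obtain \<nu>2 S2 where q: "q = cond \<nu>2 S2" "cnd \<nu>2 S2" using le_poset[OF pq] unfolding poset_iff by blast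
  obtain \<nu>3 S3 where r: "r = cond \<nu>3 S3" "cnd \<nu>3 S3" using le_poset[OF qr] unfolding poset_iff by blast
  have 12: "elts \<nu>2 \<subseteq> elts \<nu>1" "\<And>M. M \<in> S1 \<Longrightarrow> M \<inter> H \<nu>2 \<in> S2"
    using pq unfolding p(1) q(1) le_iff[OF p(2) q(2)] by blast+
  have 23: "elts \<nu>3 \<subseteq> elts \<nu>2" "\<And>M. M \<in> S2 \<Longrightarrow> M \<inter> H \<nu>3 \<in> S3"
    using qr unfolding q(1) r(1) le_iff[OF q(2) r(2)] by blast+
  have "M \<inter> H \<nu>3 \<in> S3" if "M \<in> S1" for M
  proof -
    have "M \<inter> H \<nu>2 \<inter> H \<nu>3 = M \<inter> H \<nu>3" using H_mono[OF 23(1)] by blast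
    then show ?thesis using 23(2)[OF 12(2)[OF that]] by simp
  qed
  then show "tower_le \<kappa> U I p r"
    using 12(1) 23(1) unfolding p(1) r(1) le_iff[OF p(2) r(2)] by blast
qed (rule le_poset)

text \<open>
  In terms of a generic embedding \<open>j\<close>: \<open>j(\<omega>\<^sub>2) \<le> \<delta>\<close>, since an ordinal below \<open>j(\<omega>\<^sub>2)\<close> with at least
  \<open>\<delta>\<close> predecessors would give a surjection from \<open>\<omega>\<^sub>1\<close> onto \<open>\<delta>\<close>. The conditions decide its
  values by comparing \<open>enum (f (M \<inter> H\<^sub>\<nu>)) i\<close> with the function \<open>M \<mapsto> collapse M \<alpha>\<close>
  representing \<open>\<alpha>\<close>.
\<close>

lemma presaturated_bound:
  assumes forced: "\<And>p. p \<in> tower_poset \<kappa> U I \<Longrightarrow> frc p Regular_fm (\<lambda>_. chk \<delta>)"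
    and S0: "cnd \<nu>0 S0" and f: "\<And>M. M \<in> S0 \<Longrightarrow> f M \<in> W2"
  shows "\<exists>\<nu> S \<alpha>. cnd \<nu> S \<and> Ord \<alpha> \<and> S \<subseteq> GIC_omega1 \<and>
    (\<forall>M \<in> S. M \<inter> H \<nu>0 \<in> S0 \<and> \<alpha> \<in> M \<and> f (M \<inter> H \<nu>0) \<in> elts (collapse M \<alpha>))"
proof (rule ccontr)
  assume none: "\<not> ?thesis"
  let ?P = "tower_poset \<kappa> U I" and ?le = "tower_le \<kappa> U I"
  \<comment> \<open>Throughout \<open>T\<close>, the value at \<open>i\<close> of the enumeration
    belonging to \<open>f\<close> is the ordinal represented by \<alpha>.\<close>
  define dec where "dec i \<alpha> q \<longleftrightarrow> (\<exists>\<nu> T. q = cond \<nu> T \<and> cnd \<nu> T \<and> elts \<nu>0 \<subseteq> elts \<nu> \<and>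
    (\<forall>M \<in> T. M \<inter> H \<nu>0 \<in> S0 \<and> \<alpha> \<in> M \<and> enum (f (M \<inter> H \<nu>0)) i = collapse M \<alpha>))" for i \<alpha> q
  have dec_mono: "dec i \<alpha> q'" if dq: "dec i \<alpha> q" and q': "?le q' q" for i \<alpha> q q'
  proof -
    obtain \<nu> T where q: "q = cond \<nu> T" "cnd \<nu> T" "elts \<nu>0 \<subseteq> elts \<nu>"
      "\<And>M. M \<in> T \<Longrightarrow> M \<inter> H \<nu>0 \<in> S0 \<and> \<alpha> \<in> M \<and> enum (f (M \<inter> H \<nu>0)) i = collapse M \<alpha>"
      using dq unfolding dec_def by blast
    obtain \<nu>' T' where q'_eq: "q' = cond \<nu>' T'" "cnd \<nu>' T'"
      using le_poset[OF q'] unfolding poset_iff by blast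
    have le: "elts \<nu> \<subseteq> elts \<nu>'" "\<And>M. M \<in> T' \<Longrightarrow> M \<inter> H \<nu> \<in> T"
      using q' unfolding q'_eq(1) q(1) le_iff[OF q'_eq(2) q(2)] by blast+
    have "M \<inter> H \<nu>0 \<in> S0 \<and> \<alpha> \<in> M \<and> enum (f (M \<inter> H \<nu>0)) i = collapse M \<alpha>" if M: "M \<in> T'" for M
    proof -
      have eq: "M \<inter> H \<nu> \<inter> H \<nu>0 = M \<inter> H \<nu>0" using H_mono[OF q(3)] by blast
      note * = q(4)[OF le(2)[OF M], unfolded eq]
      have "collapse (M \<inter> H \<nu>) \<alpha> = collapse M \<alpha>"
      proof (rule collapse_cong[of "H \<nu>"])
        show "elts z \<subseteq> H \<nu>" if "z \<in> H \<nu>" for z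
          using H_mem[OF Ord_U that] q(2) unfolding cnd_def by blast
      qed (use * in auto)
      then show ?thesis using * by auto
    qed
    then show ?thesis
      unfolding dec_def using q'_eq order_trans[OF q(3) le(1)] by (intro exI[of _ \<nu>'] exI[of _ T']) blast
  qed
  have dec_func: "\<alpha> = \<alpha>'" if d: "dec i \<alpha> q" "dec i \<alpha>' q" and \<alpha>: "\<alpha> \<in> elts \<delta>" "\<alpha>' \<in> elts \<delta>" for i \<alpha> \<alpha>' q
  proof -
    obtain \<nu> T where T: "q = cond \<nu> T" "cnd \<nu> T"
      "\<And>M. M \<in> T \<Longrightarrow> \<alpha> \<in> M \<and> enum (f (M \<inter> H \<nu>0)) i = collapse M \<alpha>"
      using d(1) unfolding dec_def by blast
    obtain \<nu>' T' where T': "q = cond \<nu>' T'" "cnd \<nu>' T'"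
      "\<And>M. M \<in> T' \<Longrightarrow> \<alpha>' \<in> M \<and> enum (f (M \<inter> H \<nu>0)) i = collapse M \<alpha>'"
      using d(2) unfolding dec_def by blast
    have "T = T'" using cond_inject[OF T(2) T'(2)] T(1) T'(1) by simp
    moreover obtain M where "M \<in> T" using cnd_nonempty[OF T(2)] by blast
    ultimately have "\<alpha> \<in> M" "\<alpha>' \<in> M" "collapse M \<alpha> = collapse M \<alpha>'" using T(3)[of M] T'(3)[of M] by simp_all
    then show ?thesis using collapse_inj[OF Ord_in[OF Ord_\<delta> \<alpha>(1)] Ord_in[OF Ord_\<delta> \<alpha>(2)]] by blast
  qed
  obtain \<alpha>0 where \<alpha>0: "\<alpha>0 \<in> elts \<delta>" using \<delta>_nonempty by blast
  \<comment> \<open>A value of the enumeration may be represented by no ordinal below \<delta>, so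
    \<open>dec\<close> need not be total. The default \<open>\<alpha>0\<close> is assigned once no
    stronger condition decides a value.\<close>
  define decides where "decides i \<alpha> q \<longleftrightarrow>
    dec i \<alpha> q \<or> \<alpha> = \<alpha>0 \<and> \<not> (\<exists>r \<beta>. ?le r q \<and> \<beta> \<in> elts \<delta> \<and> dec i \<beta> r)" for i \<alpha> q
  have p0: "cond \<nu>0 S0 \<in> ?P" using S0 unfolding poset_iff by blast
  have "\<exists>q \<beta>. ?le q (cond \<nu>0 S0) \<and> \<beta> \<in> elts \<delta> \<and>
      (\<forall>r i \<alpha>. ?le r q \<and> i \<in> elts omega1 \<and> \<alpha> \<in> elts \<delta> \<and> decides i \<alpha> r \<longrightarrow> \<alpha> \<in> elts \<beta>)"
  proof (rule forced_regular_bounded[OF p0 forced[OF p0] omega1_\<delta>])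
    fix i \<alpha> q q' assume "decides i \<alpha> q" "?le q' q"
    then show "decides i \<alpha> q'"
      unfolding decides_def using dec_mono[of i \<alpha> q q'] le_trans[of _ q' q] by blast
  next
    fix i \<alpha> \<alpha>' q assume "decides i \<alpha> q" "decides i \<alpha>' q" "q \<in> ?P" "\<alpha> \<in> elts \<delta>" "\<alpha>' \<in> elts \<delta>"
    then show "\<alpha> = \<alpha>'"
      unfolding decides_def using dec_func[of i \<alpha> q \<alpha>'] le_refl[of q] by blast
  next
    fix i q assume "q \<in> ?P"
    then show "\<exists>r \<alpha>. ?le r q \<and> \<alpha> \<in> elts \<delta> \<and> decides i \<alpha> r"
      unfolding decides_def using \<alpha>0 le_refl[of q] by blast
  qed
  then obtain q \<beta> where q: "?le q (cond \<nu>0 S0)" and \<beta>: "\<beta> \<in> elts \<delta>"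
    and bound: "\<And>r i \<alpha>. ?le r q \<Longrightarrow> i \<in> elts omega1 \<Longrightarrow> \<alpha> \<in> elts \<delta> \<Longrightarrow> decides i \<alpha> r \<Longrightarrow> \<alpha> \<in> elts \<beta>"
    by blast
  obtain \<nu>1 T1 where q_eq: "q = cond \<nu>1 T1" "cnd \<nu>1 T1" using le_poset[OF q] unfolding poset_iff by blast
  have le1: "elts \<nu>0 \<subseteq> elts \<nu>1" "\<And>M. M \<in> T1 \<Longrightarrow> M \<inter> H \<nu>0 \<in> S0"
    using q unfolding q_eq(1) le_iff[OF q_eq(2) S0] by blast+
  have "\<nu>1 \<in> U" using q_eq(2) unfolding cnd_def by blast
  then obtain \<nu>2 where \<nu>2: "\<nu>2 \<in> U" "elts \<nu>1 \<subseteq> elts \<nu>2" "\<beta> \<in> elts \<nu>2" using cofinal2[OF _ \<beta>] by blast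
  have Id: "ideal_on (Z \<nu>2) (I \<nu>2)" using ideal[OF \<nu>2(1)] .
  obtain A where A: "A \<subseteq> GIC_omega1" "Z \<nu>2 - A \<in> I \<nu>2" using ex_GIC[OF \<nu>2(1)] by metis
  have Ord\<beta>: "Ord \<beta>" using Ord_in[OF Ord_\<delta> \<beta>] .
  define T where "T = {M \<in> Z \<nu>2. M \<inter> H \<nu>1 \<in> T1} - {M \<in> Z \<nu>2. \<beta> \<notin> M} - (Z \<nu>2 - A)"
  have T_pos: "T \<notin> I \<nu>2"
    unfolding T_def
  proof (intro positive_Diff[OF Id])
    show "{M \<in> Z \<nu>2. M \<inter> H \<nu>1 \<in> T1} \<notin> I \<nu>2"
      using lift_positive[OF q_eq(2) \<nu>2(1,2)] unfolding cnd_def by blast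
    show "{M \<in> Z \<nu>2. \<beta> \<notin> M} \<in> I \<nu>2"
      using ideal_fine[OF Id] Ord_in_H[OF Ord_U[OF \<nu>2(1)] \<nu>2(3)] unfolding Union_Z by blast
  qed (rule A(2))
  have T: "M \<in> Z \<nu>2" "M \<inter> H \<nu>1 \<in> T1" "\<beta> \<in> M" "M \<in> GIC_omega1" "M \<inter> H \<nu>0 \<in> S0" if M: "M \<in> T" for M
  proof -
    show T1: "M \<inter> H \<nu>1 \<in> T1" and "M \<in> Z \<nu>2" "\<beta> \<in> M" "M \<in> GIC_omega1" using M A(1) unfolding T_def by blast+
    have "M \<inter> H \<nu>1 \<inter> H \<nu>0 = M \<inter> H \<nu>0" using H_mono[OF le1(1)] by blast
    then show "M \<inter> H \<nu>0 \<in> S0" using le1(2)[OF T1] by simp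
  qed
  \<comment> \<open>On \<open>N\<close> the bound \<beta> would be an \<alpha> as claimed, so
    \<open>N\<close> belongs to the ideal.\<close>
  define N where "N = {M \<in> T. f (M \<inter> H \<nu>0) \<in> elts (collapse M \<beta>)}"
  have "\<not> cnd \<nu>2 N"
  proof
    assume "cnd \<nu>2 N"
    moreover have "N \<subseteq> GIC_omega1" "\<forall>M \<in> N. M \<inter> H \<nu>0 \<in> S0 \<and> \<beta> \<in> M \<and> f (M \<inter> H \<nu>0) \<in> elts (collapse M \<beta>)"
      using T unfolding N_def by blast+
    ultimately show False using none Ord\<beta> by blast
  qed
  moreover have "N \<subseteq> Z \<nu>2" using T(1) unfolding N_def by blast
  ultimately have "N \<in> I \<nu>2" using \<nu>2(1) unfolding cnd_def by blast
  then have pos: "T - N \<notin> I \<nu>2" using positive_Diff[OF Id T_pos] by blast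
  \<comment> \<open>Outside \<open>N\<close> the ordinal represented by \<beta> is at most the value
    of \<open>f\<close>, hence enumerated at a countable index. Countable ordinals belong to
    \<open>M\<close>, so normality makes the index constant on a positive set. This condition
    decides \<beta> to be a value, although \<beta> was to bound all values strictly.\<close>
  have "\<exists>i. i \<in> W1 \<and> enum (f (M \<inter> H \<nu>0)) i = collapse M \<beta>" if M: "M \<in> T - N" for M
  proof -
    have fM: "f (M \<inter> H \<nu>0) \<in> W2" using f T(5) M by blast
    have "f (M \<inter> H \<nu>0) \<notin> elts (collapse M \<beta>)" using M unfolding N_def by blast
    then have "collapse M \<beta> \<in> insert (f (M \<inter> H \<nu>0)) (elts (f (M \<inter> H \<nu>0)))"
      using Ord_linear[OF Ord_collapse[OF Ord\<beta>, of M] Ord_in[OF Ord_omega2 fM]] by blast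
    then have "collapse M \<beta> \<in> enum (f (M \<inter> H \<nu>0)) ` W1" unfolding enum_image[OF fM] .
    then obtain i where "collapse M \<beta> = enum (f (M \<inter> H \<nu>0)) i" "i \<in> W1" by (rule imageE)
    then show ?thesis by (intro exI[of _ i]) simp
  qed
  then have "\<forall>M \<in> T - N. \<exists>i. i \<in> W1 \<and> enum (f (M \<inter> H \<nu>0)) i = collapse M \<beta>" ..
  from bchoice[OF this] obtain g
    where g: "\<forall>M \<in> T - N. g M \<in> W1 \<and> enum (f (M \<inter> H \<nu>0)) (g M) = collapse M \<beta>" ..
  have "T - N \<subseteq> Z \<nu>2" using T(1) by blast
  moreover have "g M \<in> M" if "M \<in> T - N" for M
    using bspec[OF g that] GIC_D(2)[OF T(4)[of M]] that by blast
  ultimately have "\<exists>T' c. T' \<subseteq> T - N \<and> T' \<notin> I \<nu>2 \<and> (\<forall>M \<in> T'. g M = c)"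
    using pos by (intro ideal_normal[OF Id])
  then obtain T' c where T': "T' \<subseteq> T - N" "T' \<notin> I \<nu>2" "\<forall>M \<in> T'. g M = c"
    by (elim exE conjE)
  have cT': "cnd \<nu>2 T'" using T' T(1) \<nu>2(1) unfolding cnd_def by blast
  obtain M where "M \<in> T'" using cnd_nonempty[OF cT'] by blast
  then have c: "c \<in> W1" using g T'(1,3) by auto
  have "?le (cond \<nu>2 T') q"
    unfolding q_eq(1) le_iff[OF cT' q_eq(2)] using \<nu>2(2) T(2) T'(1) by blast
  moreover have "dec c \<beta> (cond \<nu>2 T')"
    unfolding dec_def
  proof (intro exI conjI ballI)
    show "elts \<nu>0 \<subseteq> elts \<nu>2" using le1(1) \<nu>2(2) by (rule order_trans)
    fix M assume M: "M \<in> T'"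
    show "M \<inter> H \<nu>0 \<in> S0" "\<beta> \<in> M" using T M T'(1) by blast+
    show "enum (f (M \<inter> H \<nu>0)) c = collapse M \<beta>" using g T'(1,3) M by auto
  qed (rule refl cT')+
  ultimately have "\<beta> \<in> elts \<beta>" using bound[OF _ c \<beta>] unfolding decides_def by blast
  then show False by simp
qed

end

theorem theorem1:
  fixes \<kappa> \<delta> :: "'v::set_universe"
    and U :: "'v set"
    and I :: "'v \<Rightarrow> 'v set set set"
  assumes "RP_omega2 TYPE('v)"
    and "tower \<kappa> \<delta> U I"
    and "tower_concentrates \<kappa> U I GIC_omega1"
  shows "\<not> presaturated \<kappa> \<delta> U I"
proof
  assume pres: "presaturated \<kappa> \<delta> U I"
  interpret GIC_tower \<kappa> \<delta> U I
    by unfold_locales (use assms(2,3) pres in \<open>simp_all add: presaturated_def\<close>)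
  obtain \<nu>0 where \<nu>0: "\<nu>0 \<in> U" using U_nonempty by blast
  obtain S0 where S0: "S0 \<subseteq> GIC_omega1" "cnd \<nu>0 S0" using ex_GIC[OF \<nu>0] by metis
  have "\<exists>\<beta>. \<beta> \<in> W2 \<and> stationary (elts \<beta>) (uncoded M \<inter> countable_subsets (elts \<beta>))" if M: "M \<in> S0" for M
  proof -
    have "stationary W2 (uncoded M)" using stationary_uncoded GIC_D(1) M S0(1) by blast
    then obtain X where X: "X \<subseteq> W2" "W1 \<subseteq> X" "X \<approx> (W1 :: 'v set)"
      "stationary X (uncoded M \<inter> countable_subsets X)"
      using assms(1) unfolding RP_omega2_def by blast
    obtain \<beta> where "\<beta> \<in> W2" "X = elts \<beta>"
      using X by (rule reflecting_ordinal) (simp add: uncoded_def)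
    then show ?thesis using X(4) by blast
  qed
  then have "\<forall>M \<in> S0. \<exists>\<beta>. \<beta> \<in> W2 \<and> stationary (elts \<beta>) (uncoded M \<inter> countable_subsets (elts \<beta>))" ..
  \<comment> \<open>In the generic ultrapower, \<open>f\<close> represents the point to which the
    stationary set of uncoded sets reflects.\<close>
  from bchoice[OF this] obtain f where "\<forall>M \<in> S0. f M \<in> W2 \<and>
      stationary (elts (f M)) (uncoded M \<inter> countable_subsets (elts (f M)))" ..
  then have f: "f M \<in> W2 \<and> stationary (elts (f M)) (uncoded M \<inter> countable_subsets (elts (f M)))"
    if "M \<in> S0" for M using that by (rule bspec)
  have forced: "frc p Regular_fm (\<lambda>_. chk \<delta>)" if "p \<in> tower_poset \<kappa> U I" for p
    using pres that unfolding presaturated_def by blast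
  have f_W2: "f M \<in> W2" if "M \<in> S0" for M using f[OF that] by blast
  have "\<exists>\<nu> S \<alpha>. cnd \<nu> S \<and> Ord \<alpha> \<and> S \<subseteq> GIC_omega1 \<and>
      (\<forall>M \<in> S. M \<inter> H \<nu>0 \<in> S0 \<and> \<alpha> \<in> M \<and> f (M \<inter> H \<nu>0) \<in> elts (collapse M \<alpha>))"
    using forced S0(2) f_W2 by (rule presaturated_bound)
  then obtain \<nu> S \<alpha> where S: "cnd \<nu> S" "Ord \<alpha>" "S \<subseteq> GIC_omega1"
    "\<forall>M \<in> S. M \<inter> H \<nu>0 \<in> S0 \<and> \<alpha> \<in> M \<and> f (M \<inter> H \<nu>0) \<in> elts (collapse M \<alpha>)"
    by (elim exE conjE)
  obtain M' where M': "M' \<in> S" using cnd_nonempty[OF S(1)] by blast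
  \<comment> \<open>The stationary set is the one computed from \<open>M\<close>, while internal
    clubness is that of \<open>M'\<close>. The codes found in \<open>M'\<close> lie in
    \<open>H \<nu>0\<close>, which makes them elements of \<open>M\<close>.\<close>
  define M where "M = M' \<inter> H \<nu>0"
  have M: "M \<in> S0" "f M \<in> elts (collapse M' \<alpha>)" using bspec[OF S(4) M'] unfolding M_def by blast+
  \<comment> \<open>Being below the collapse of \<alpha>, the reflection point is itself the
    collapse of an ordinal \<xi> in \<open>M'\<close>, so \<open>club_coded\<close> applies to
    it.\<close>
  then obtain \<xi> where \<xi>: "\<xi> \<in> M'" "\<xi> \<in> elts \<alpha>" "f M = collapse M' \<xi>" unfolding elts_collapse by blast
  have G: "M' \<in> G_omega1" "M' \<in> IC_omega1" using S(3) M' unfolding GIC_omega1_def by blast+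
  obtain C where C: "club M' C" "\<And>x. x \<in> C \<Longrightarrow> set_of x \<in> M'"
    using G(2) unfolding IC_omega1_def by blast
  obtain \<theta> :: 'v where \<theta>: "regular \<theta>" "uncountable (elts \<theta>)" "M' \<prec>\<^sub>e H \<theta>"
    using G(1) unfolding G_omega1_def omega1_guessing_def by blast
  have "\<exists>D. club (elts (collapse M' \<xi>)) D \<and> D \<subseteq> coded_in M"
  proof (rule club_coded)
    show "collapse M' \<xi> \<in> W2" using f_W2[OF M(1)] unfolding \<xi>(3) .
    show "M' \<inter> H \<nu>0 \<subseteq> M" unfolding M_def ..
    show "Ord \<xi>" using Ord_in[OF S(2) \<xi>(2)] .
  qed (fact C \<theta> \<xi>(1) Ord_U[OF \<nu>0] omega1_U[OF \<nu>0])+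
  then obtain D where D: "club (elts (f M)) D" "D \<subseteq> coded_in M"
    unfolding \<xi>(3) by (elim exE conjE)
  have "uncoded M \<inter> countable_subsets (elts (f M)) \<inter> D \<noteq> {}"
    using f[OF M(1)] D(1) unfolding stationary_def by blast
  then show False using D(2) unfolding uncoded_def by blast
qed

end
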